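(* Let $n,m\ge 1$ and $k\ge 0$ be integers. The dimension of the degree $kn$ component $R(n,m)_{kn}$ of $R(n,m)$ is given by $$\dim\big(R(n,m)_{kn}\big)=\sum_{\lambda\vdash kn} a_{k^n,k^n,\lambda}\,\dim S_\lambda(\mathbb{C}^m).$$
   Context: The ground field is $\mathbb{C}$. $\operatorname{Mat}_{n,n}$ is the space of $n\times n$ complex matrices. The group $\operatorname{SL}_n\times\operatorname{SL}_n$ acts on $\operatorname{Mat}_{n,n}^m$ by $(A,B)\circ(X_1,\dots,X_m)=(AX_1B^{-1},\dots,AX_mB^{-1})$, and $R(n,m)=\mathbb{C}[\operatorname{Mat}_{n,n}^m]^{\operatorname{SL}_n\times\operatorname{SL}_n}$ is the ring of invariant polynomials, graded by the usual degree of polynomials in the matrix entries; $R(n,m)_d$ is its degree $d$ component. $\lambda\vdash d$ means that $\lambda$ is a partition of $d$; $k^n$ denotes the partition $(k,k,\dots,k)$ of $kn$ with $n$ parts equal to $k$. $S_\lambda$ is the Schur functor corresponding to $\lambda$ (with $S_\lambda(\mathbb{C}^m)=0$ if $\lambda$ has more than $m$ parts). For $\lambda,\mu,\nu\vdash d$, the Kronecker coefficient $a_{\lambda,\mu,\nu}$ is the multiplicity of $S_\mu(V)\otimes S_\nu(W)$ in $S_\lambda(V\otimes W)$ (for $V,W$ of sufficiently large dimension); equivalently, the multiplicity of $T_\nu$ in $T_\lambda\otimes T_\mu$, where $T_\lambda$ is the irreducible representation of the symmetric group on $d$ letters corresponding to $\lambda$. *)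

theory Defs
  imports
    "HOL-Library.Poly_Mapping"
    "HOL-Combinatorics.Permutations"
    "Jordan_Normal_Form.Determinant"
begin

section \<open>Complex vector spaces with a distinguished basis\<close>

text \<open>
  Every vector space below is a subspace of some free space \<open>'a \<Rightarrow>\<^sub>0 complex\<close>, whose basis
  vectors are \<open>Poly_Mapping.single a 1\<close>.
\<close>

definition smul :: "complex \<Rightarrow> ('a \<Rightarrow>\<^sub>0 complex) \<Rightarrow> ('a \<Rightarrow>\<^sub>0 complex)" where
  "smul c x = Poly_Mapping.map ((*) c) x"

lemma lookup_smul [simp]: "Poly_Mapping.lookup (smul c x) a = c * Poly_Mapping.lookup x a"
  by (simp add: smul_def Poly_Mapping.map.rep_eq when_def)

global_interpretation free_vs: vector_space smul
  by standard (auto intro!: poly_mapping_eqI simp: lookup_add algebra_simps)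

abbreviation basis_vec :: "'a \<Rightarrow> ('a \<Rightarrow>\<^sub>0 complex)" where
  "basis_vec a \<equiv> Poly_Mapping.single a 1"

definition free_on :: "'a set \<Rightarrow> ('a \<Rightarrow>\<^sub>0 complex) set" where
  "free_on A = {x. Poly_Mapping.keys x \<subseteq> A}"

text \<open>The linear map sending the basis vector of \<open>a\<close> to \<open>f a\<close>:\<close>

definition lin_ext :: "('a \<Rightarrow> ('b \<Rightarrow>\<^sub>0 complex)) \<Rightarrow> ('a \<Rightarrow>\<^sub>0 complex) \<Rightarrow> ('b \<Rightarrow>\<^sub>0 complex)" where
  "lin_ext f x = (\<Sum>a\<in>Poly_Mapping.keys x. smul (Poly_Mapping.lookup x a) (f a))"

text \<open>Tensors live over the product basis: \<open>(a, b)\<close> stands for the tensor product of the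
  basis vectors of \<open>a\<close> and \<open>b\<close>.\<close>

definition tensor :: "('a \<Rightarrow>\<^sub>0 complex) \<Rightarrow> ('b \<Rightarrow>\<^sub>0 complex) \<Rightarrow> ('a \<times> 'b \<Rightarrow>\<^sub>0 complex)" where
  "tensor x y = lin_ext (\<lambda>a. lin_ext (\<lambda>b. basis_vec (a, b)) y) x"

definition tensor_space ::
    "('a \<Rightarrow>\<^sub>0 complex) set \<Rightarrow> ('b \<Rightarrow>\<^sub>0 complex) set \<Rightarrow> ('a \<times> 'b \<Rightarrow>\<^sub>0 complex) set" where
  "tensor_space U W = free_vs.span {tensor u w |u w. u \<in> U \<and> w \<in> W}"


section \<open>Representations of the symmetric group and multiplicities\<close>

text \<open>The symmetric group on \<open>d\<close> letters acts on the letters \<open>0, \<dots>, d - 1\<close>.\<close>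

definition symgroup :: "nat \<Rightarrow> (nat \<Rightarrow> nat) set" where
  "symgroup d = {g. g permutes {..<d}}"

text \<open>A representation is given by an action \<open>\<rho>\<close> on an ambient free space together with an
  invariant subspace; the actions used below are linear on the ambient space by construction.\<close>

type_synonym 'a action = "(nat \<Rightarrow> nat) \<Rightarrow> ('a \<Rightarrow>\<^sub>0 complex) \<Rightarrow> ('a \<Rightarrow>\<^sub>0 complex)"

definition subrep :: "nat \<Rightarrow> 'a action \<Rightarrow> ('a \<Rightarrow>\<^sub>0 complex) set \<Rightarrow> bool" where
  "subrep d \<rho> W \<longleftrightarrow> free_vs.subspace W \<and> (\<forall>g\<in>symgroup d. \<forall>w\<in>W. \<rho> g w \<in> W)"

definition irreducible_rep :: "nat \<Rightarrow> 'a action \<Rightarrow> ('a \<Rightarrow>\<^sub>0 complex) set \<Rightarrow> bool" where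
  "irreducible_rep d \<rho> W \<longleftrightarrow>
     subrep d \<rho> W \<and> W \<noteq> {0} \<and> (\<forall>U. subrep d \<rho> U \<and> U \<subseteq> W \<longrightarrow> U = {0} \<or> U = W)"

text \<open>A linear map between subspaces extends to the ambient spaces, so asking \<open>\<phi>\<close> to be linear
  everywhere is no restriction.\<close>

definition iso_rep :: "nat \<Rightarrow> 'a action \<Rightarrow> ('a \<Rightarrow>\<^sub>0 complex) set \<Rightarrow>
    'b action \<Rightarrow> ('b \<Rightarrow>\<^sub>0 complex) set \<Rightarrow> bool" where
  "iso_rep d \<rho> U \<sigma> W \<longleftrightarrow>
     (\<exists>\<phi>. Vector_Spaces.linear smul smul \<phi> \<and> bij_betw \<phi> U W \<and>
          (\<forall>g\<in>symgroup d. \<forall>u\<in>U. \<phi> (\<rho> g u) = \<sigma> g (\<phi> u)))"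

text \<open>\<open>W\<close> is the internal direct sum of the irreducible subrepresentations in \<open>D\<close>.\<close>

definition irreducible_decomposition ::
    "nat \<Rightarrow> 'a action \<Rightarrow> ('a \<Rightarrow>\<^sub>0 complex) set \<Rightarrow> ('a \<Rightarrow>\<^sub>0 complex) set set \<Rightarrow> bool" where
  "irreducible_decomposition d \<rho> W D \<longleftrightarrow>
     finite D \<and> (\<forall>P\<in>D. irreducible_rep d \<rho> P) \<and> free_vs.span (\<Union>D) = W \<and>
     (\<forall>f. (\<forall>P\<in>D. f P \<in> P) \<and> (\<Sum>P\<in>D. f P) = 0 \<longrightarrow> (\<forall>P\<in>D. f P = 0))"

text \<open>The multiplicity of the irreducible \<open>(\<rho>, U)\<close> in \<open>(\<sigma>, W)\<close>. The description is proper for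
  finite-dimensional \<open>W\<close>: decompositions exist by Maschke's theorem, and the number of
  summands isomorphic to \<open>U\<close> does not depend on the decomposition.\<close>

definition rep_multiplicity :: "nat \<Rightarrow> 'a action \<Rightarrow> ('a \<Rightarrow>\<^sub>0 complex) set \<Rightarrow>
    'b action \<Rightarrow> ('b \<Rightarrow>\<^sub>0 complex) set \<Rightarrow> nat" where
  "rep_multiplicity d \<rho> U \<sigma> W =
     (THE r. \<exists>D. irreducible_decomposition d \<sigma> W D \<and> r = card {P\<in>D. iso_rep d \<rho> U \<sigma> P})"


section \<open>Partitions, Young symmetrizers, Schur functors\<close>

text \<open>A partition is its weakly decreasing sequence of parts, padded with zeros.\<close>

definition partition_size :: "(nat \<Rightarrow> nat) \<Rightarrow> nat" where
  "partition_size \<alpha> = (\<Sum>i | \<alpha> i \<noteq> 0. \<alpha> i)"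

definition partitions :: "nat \<Rightarrow> (nat \<Rightarrow> nat) set" where
  "partitions d = {\<alpha>. antimono \<alpha> \<and> finite {i. \<alpha> i \<noteq> 0} \<and> partition_size \<alpha> = d}"

definition rect_partition :: "nat \<Rightarrow> nat \<Rightarrow> (nat \<Rightarrow> nat)" where
  "rect_partition k n = (\<lambda>i. if i < n then k else 0)"

text \<open>Rows and columns of the canonical tableau of shape \<open>\<alpha>\<close>, which numbers the boxes
  \<open>0, 1, 2, \<dots>\<close> row by row, from left to right.\<close>

definition tableau_row :: "(nat \<Rightarrow> nat) \<Rightarrow> nat \<Rightarrow> nat set" where
  "tableau_row \<alpha> i = {sum \<alpha> {..<i} + j |j. j < \<alpha> i}"

definition tableau_col :: "(nat \<Rightarrow> nat) \<Rightarrow> nat \<Rightarrow> nat set" where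
  "tableau_col \<alpha> j = {sum \<alpha> {..<i} + j |i. j < \<alpha> i}"

definition row_group :: "(nat \<Rightarrow> nat) \<Rightarrow> (nat \<Rightarrow> nat) set" where
  "row_group \<alpha> = {p \<in> symgroup (partition_size \<alpha>). \<forall>i. p ` tableau_row \<alpha> i = tableau_row \<alpha> i}"

definition col_group :: "(nat \<Rightarrow> nat) \<Rightarrow> (nat \<Rightarrow> nat) set" where
  "col_group \<alpha> = {q \<in> symgroup (partition_size \<alpha>). \<forall>j. q ` tableau_col \<alpha> j = tableau_col \<alpha> j}"

text \<open>Elements of the group algebra of the symmetric group are formal linear combinations of
  permutations.\<close>

definition young_symmetrizer :: "(nat \<Rightarrow> nat) \<Rightarrow> ((nat \<Rightarrow> nat) \<Rightarrow>\<^sub>0 complex)" where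
  "young_symmetrizer \<alpha> =
     (\<Sum>p\<in>row_group \<alpha>. \<Sum>q\<in>col_group \<alpha>. Poly_Mapping.single (p \<circ> q) (of_int (sign q)))"

definition group_algebra_mult ::
    "((nat \<Rightarrow> nat) \<Rightarrow>\<^sub>0 complex) \<Rightarrow> ((nat \<Rightarrow> nat) \<Rightarrow>\<^sub>0 complex) \<Rightarrow> ((nat \<Rightarrow> nat) \<Rightarrow>\<^sub>0 complex)" where
  "group_algebra_mult x y = lin_ext (\<lambda>g. lin_ext (\<lambda>h. basis_vec (g \<circ> h)) y) x"

definition left_action :: "(nat \<Rightarrow> nat) action" where
  "left_action g = lin_ext (\<lambda>h. basis_vec (g \<circ> h))"

text \<open>The irreducible representation \<open>T\<^sub>\<alpha>\<close>, as the left ideal generated by the Young symmetrizer.\<close>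

definition irrep :: "(nat \<Rightarrow> nat) \<Rightarrow> ((nat \<Rightarrow> nat) \<Rightarrow>\<^sub>0 complex) set" where
  "irrep \<alpha> = (\<lambda>x. group_algebra_mult x (young_symmetrizer \<alpha>)) ` free_on (symgroup (partition_size \<alpha>))"

definition diagonal_action :: "((nat \<Rightarrow> nat) \<times> (nat \<Rightarrow> nat)) action" where
  "diagonal_action g = lin_ext (\<lambda>(h, h'). tensor (basis_vec (g \<circ> h)) (basis_vec (g \<circ> h')))"

text \<open>Multiplicity of \<open>T\<^sub>\<gamma>\<close> in \<open>T\<^sub>\<alpha> \<otimes> T\<^sub>\<beta>\<close>, for \<open>\<alpha>\<close>, \<open>\<beta>\<close>, \<open>\<gamma>\<close> partitions of the same number.\<close>

definition kronecker_coeff :: "(nat \<Rightarrow> nat) \<Rightarrow> (nat \<Rightarrow> nat) \<Rightarrow> (nat \<Rightarrow> nat) \<Rightarrow> nat" where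
  "kronecker_coeff \<alpha> \<beta> \<gamma> =
     rep_multiplicity (partition_size \<gamma>)
       left_action (irrep \<gamma>)
       diagonal_action (tensor_space (irrep \<alpha>) (irrep \<beta>))"

text \<open>
  The \<open>d\<close>-th tensor power of \<open>\<complex>\<^sup>m\<close> has as basis the words \<open>w\<close> of length \<open>d\<close> in the
  letters \<open>0, \<dots>, m - 1\<close>, standing for \<open>e\<^bsub>w 0\<^esub> \<otimes> \<dots> \<otimes> e\<^bsub>w (d - 1)\<^esub>\<close>. The symmetric group acts on it
  from the right by permuting the factors, \<open>(v\<^sub>0 \<otimes> v\<^sub>1 \<otimes> \<dots>) g = v\<^bsub>g 0\<^esub> \<otimes> v\<^bsub>g 1\<^esub> \<otimes> \<dots>\<close>, and \<open>S\<^sub>\<alpha>(\<complex>\<^sup>m)\<close> is the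
  image of the Young symmetrizer.
\<close>

definition tensor_power :: "nat \<Rightarrow> nat \<Rightarrow> ((nat \<Rightarrow> nat) \<Rightarrow>\<^sub>0 complex) set" where
  "tensor_power m d = free_on ({..<d} \<rightarrow>\<^sub>E {..<m})"

definition right_mult ::
    "((nat \<Rightarrow> nat) \<Rightarrow>\<^sub>0 complex) \<Rightarrow> ((nat \<Rightarrow> nat) \<Rightarrow>\<^sub>0 complex) \<Rightarrow> ((nat \<Rightarrow> nat) \<Rightarrow>\<^sub>0 complex)" where
  "right_mult v x = lin_ext (\<lambda>g. lin_ext (\<lambda>w. basis_vec (w \<circ> g)) v) x"

definition schur_functor :: "(nat \<Rightarrow> nat) \<Rightarrow> nat \<Rightarrow> ((nat \<Rightarrow> nat) \<Rightarrow>\<^sub>0 complex) set" where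
  "schur_functor \<alpha> m =
     (\<lambda>v. right_mult v (young_symmetrizer \<alpha>)) ` tensor_power m (partition_size \<alpha>)"


section \<open>The ring of matrix semi-invariants\<close>

text \<open>Polynomials in the variables \<open>(l, i, j)\<close>, the entry in row \<open>i\<close> and column \<open>j\<close> of the
  \<open>l\<close>-th matrix.\<close>

type_synonym mat_poly = "((nat \<times> nat \<times> nat) \<Rightarrow>\<^sub>0 nat) \<Rightarrow>\<^sub>0 complex"

definition mat_polys :: "nat \<Rightarrow> nat \<Rightarrow> mat_poly set" where
  "mat_polys n m =
     {p. \<forall>t\<in>Poly_Mapping.keys p. Poly_Mapping.keys t \<subseteq> {..<m} \<times> {..<n} \<times> {..<n}}"

definition eval_poly :: "mat_poly \<Rightarrow> (nat \<Rightarrow> complex mat) \<Rightarrow> complex" where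
  "eval_poly p X =
     (\<Sum>t\<in>Poly_Mapping.keys p. Poly_Mapping.lookup p t *
        (\<Prod>(l, i, j)\<in>Poly_Mapping.keys t. (X l $$ (i, j)) ^ Poly_Mapping.lookup t (l, i, j)))"

definition special_linear :: "nat \<Rightarrow> complex mat set" where
  "special_linear n = {A \<in> carrier_mat n n. det A = 1}"

text \<open>In the next definition \<open>B'\<close> is the inverse of \<open>B\<close>.\<close>

definition invariant_ring :: "nat \<Rightarrow> nat \<Rightarrow> mat_poly set" where
  "invariant_ring n m =
     {p \<in> mat_polys n m.
        \<forall>A\<in>special_linear n. \<forall>B\<in>special_linear n. \<forall>B'\<in>carrier_mat n n.
          inverts_mat B B' \<longrightarrow>
          (\<forall>X. (\<forall>l<m. X l \<in> carrier_mat n n) \<longrightarrow>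
               eval_poly p (\<lambda>l. A * X l * B') = eval_poly p X)}"

definition homogeneous :: "nat \<Rightarrow> mat_poly \<Rightarrow> bool" where
  "homogeneous d p \<longleftrightarrow>
     (\<forall>t\<in>Poly_Mapping.keys p. (\<Sum>v\<in>Poly_Mapping.keys t. Poly_Mapping.lookup t v) = d)"

definition invariant_component :: "nat \<Rightarrow> nat \<Rightarrow> nat \<Rightarrow> mat_poly set" where
  "invariant_component n m d = {p \<in> invariant_ring n m. homogeneous d p}"

end

theory Submission
  imports Defs "HOL-Combinatorics.Cycles" "Jordan_Normal_Form.Char_Poly"
begin

text \<open>
  A homogeneous polynomial of degree \<open>d = k n\<close> in the matrix entries is a tensor, symmetric under
  \<open>S\<^sub>d\<close>, whose entries are indexed by three words of length \<open>d\<close>: \<open>u\<close> for the numbers of the matrices,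
  \<open>v\<close> for the rows and \<open>w\<close> for the columns. The polynomial is invariant if and only if this tensor is
  \<open>SL\<^sub>n\<close>-invariant in \<open>v\<close> and in \<open>w\<close>. By the first fundamental theorem the invariant tensors in
  \<open>(\<complex>\<^sup>n)\<^bsup>\<otimes>d\<^esup>\<close> are spanned by products of \<open>k\<close> determinants and form a copy of the Specht module \<open>T\<close>
  of the partition \<open>k\<^sup>n\<close>. So \<open>R(n, m)\<^sub>d\<close> is the space of \<open>S\<^sub>d\<close>-equivariant maps from the words \<open>u\<close> to
  \<open>T \<otimes> T\<close>.

  For every \<open>S\<^sub>d\<close>-module \<open>M\<close> the dimension of the space of equivariant maps to \<open>M\<close> is the sum over all
  \<open>\<alpha>\<close> of the dimensions of \<open>c\<^sub>\<alpha> M\<close> times those of \<open>S\<^sub>\<alpha>(\<complex>\<^sup>m)\<close>, where \<open>c\<^sub>\<alpha>\<close> is the Young symmetrizer, and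
  \<open>c\<^sub>\<alpha> M\<close> has the multiplicity of \<open>T\<^sub>\<alpha>\<close> in \<open>M\<close> as its dimension. Both rest on the completeness of the
  Specht modules: averaging the \<open>c\<^sub>\<alpha>\<close> over all conjugates gives orthogonal central elements, as many as
  there are conjugacy classes, so that the unit of the group algebra is a linear combination of them.
\<close>

text \<open>The scalars that link the constructions are not evaluated, only shown to be nonzero, and
  the source is positivity. In the group algebra it is the inner product behind \<open>star\<close>:
  a self-adjoint element with square 0 is 0, which covers both the squares of the
  \<open>c\<^sub>\<alpha>\<close> and those of their averages. For the determinants it is a sum of
  squares of integers (\<open>first_fund_const_pos\<close>). The first fundamental theorem rests on
  the fact that relative invariance holds for an arbitrary matrix and is polynomial in its entries.
  Its multilinear part has one term for each permutation, which is how a sum over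
  \<open>S\<^sub>d\<close> of translates of a single product of determinants arises. The Specht
  module is the concrete left ideal of \<open>c\<^sub>\<alpha>\<close>, so its identification with
  the invariant tensors has to be explicit: \<open>det_sum\<close> forms combinations of translated
  determinant products, and \<open>col_proj\<close> reads a tensor along the translates of one word
  and antisymmetrizes over columns. The two are inverse to each other up to nonzero factors.\<close>

unbundle no m_inv_syntax

section \<open>The group algebra of the symmetric group\<close>

abbreviation coef :: "('a \<Rightarrow>\<^sub>0 'b::zero) \<Rightarrow> 'a \<Rightarrow> 'b" where
  "coef \<equiv> Poly_Mapping.lookup"

abbreviation lin :: "(('a \<Rightarrow>\<^sub>0 complex) \<Rightarrow> ('b \<Rightarrow>\<^sub>0 complex)) \<Rightarrow> bool" where
  "lin \<equiv> Vector_Spaces.linear smul smul"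

global_interpretation free_pair: vector_space_pair
  "smul :: complex \<Rightarrow> ('a \<Rightarrow>\<^sub>0 complex) \<Rightarrow> _" "smul :: complex \<Rightarrow> ('b \<Rightarrow>\<^sub>0 complex) \<Rightarrow> _"
  ..

lemma linI:
  assumes "\<And>x y. f (x + y) = f x + f y" "\<And>c x. f (smul c x) = smul c (f x)"
  shows "lin f"
  by (simp add: Vector_Spaces.linear_iff assms free_vs.vector_space_axioms)

lemma coef_sum: "coef (\<Sum>i\<in>I. f i) a = (\<Sum>i\<in>I. coef (f i) a)"
  by (rule lookup_sum)

definition of_fun :: "'a set \<Rightarrow> ('a \<Rightarrow> complex) \<Rightarrow> ('a \<Rightarrow>\<^sub>0 complex)" where
  "of_fun S f = (\<Sum>a\<in>S. Poly_Mapping.single a (f a))"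

lemma coef_of_fun [simp]: "finite S \<Longrightarrow> coef (of_fun S f) a = (if a \<in> S then f a else 0)"
  by (simp add: of_fun_def coef_sum lookup_single when_def)

lemma in_free_on_iff: "x \<in> free_on A \<longleftrightarrow> (\<forall>a. a \<notin> A \<longrightarrow> coef x a = 0)"
  by (auto simp: free_on_def in_keys_iff)

lemma of_fun_in_free_on [simp]: "finite S \<Longrightarrow> of_fun S f \<in> free_on S"
  by (simp add: in_free_on_iff)

lemma subspace_free_on: "free_vs.subspace (free_on A)"
  by (auto simp: free_vs.subspace_def in_free_on_iff lookup_add)

lemma free_on_eq_sum:
  "finite S \<Longrightarrow> x \<in> free_on S \<Longrightarrow> x = (\<Sum>a\<in>S. smul (coef x a) (basis_vec a))"
  by (rule poly_mapping_eqI)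
    (auto simp: coef_sum lookup_single when_def in_free_on_iff if_distrib[of "(*) _"] cong: if_cong)

lemma lin_ext_eq_sum:
  assumes "finite S" "Poly_Mapping.keys x \<subseteq> S"
  shows "lin_ext f x = (\<Sum>a\<in>S. smul (coef x a) (f a))"
  unfolding lin_ext_def using assms
  by (intro sum.mono_neutral_left) (auto simp: in_keys_iff)

lemma lin_lin_ext: "lin (lin_ext f)"
proof (rule linI)
  fix x y :: "'a \<Rightarrow>\<^sub>0 complex"
  let ?S = "Poly_Mapping.keys x \<union> Poly_Mapping.keys y"
  have "Poly_Mapping.keys (x + y) \<subseteq> ?S"
    by (rule keys_add)
  then show "lin_ext f (x + y) = lin_ext f x + lin_ext f y"
    by (simp add: lin_ext_eq_sum[of ?S] lookup_add free_vs.scale_left_distrib sum.distrib)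
next
  fix c and x :: "'a \<Rightarrow>\<^sub>0 complex"
  have "Poly_Mapping.keys (smul c x) \<subseteq> Poly_Mapping.keys x"
    by (auto simp: in_keys_iff)
  then show "lin_ext f (smul c x) = smul c (lin_ext f x)"
    by (simp add: lin_ext_eq_sum[of "Poly_Mapping.keys x"] free_vs.scale_sum_right)
qed

lemma lin_ext_basis [simp]: "lin_ext f (basis_vec a) = f a"
  by (simp add: lin_ext_def)

lemma coef_lin_ext: "coef (lin_ext f x) b = (\<Sum>a\<in>Poly_Mapping.keys x. coef x a * coef (f a) b)"
  by (simp add: lin_ext_def coef_sum)

lemma coef_lin_ext_basis:
  assumes "\<And>a. f' (f a) = a" "\<And>b. f (f' b) = b"
  shows "coef (lin_ext (\<lambda>a. basis_vec (f a)) x) b = coef x (f' b)"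
proof -
  have "coef (lin_ext (\<lambda>a. basis_vec (f a)) x) b
      = (\<Sum>a\<in>Poly_Mapping.keys x. if a = f' b then coef x a else 0)"
    unfolding coef_lin_ext by (intro sum.cong) (auto simp: lookup_single when_def assms)
  then show ?thesis
    by (simp add: in_keys_iff)
qed

lemma coef_tensor: "coef (tensor x y) (a, b) = coef x a * coef y b"
proof -
  have "coef (lin_ext (\<lambda>b. basis_vec (a', b)) y) (a, b) = (if a' = a then coef y b else 0)" for a'
    by (auto simp: coef_lin_ext lookup_single when_def in_keys_iff if_distrib[of "(*) _"] cong: if_cong)
  then have "coef (tensor x y) (a, b)
      = (\<Sum>a'\<in>Poly_Mapping.keys x. if a' = a then coef x a' * coef y b else 0)"
    unfolding tensor_def coef_lin_ext by (intro sum.cong) auto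
  then show ?thesis
    by (auto simp: in_keys_iff)
qed

lemma tensor_basis [simp]: "tensor (basis_vec a) (basis_vec b) = basis_vec (a, b)"
  by (rule poly_mapping_eqI) (auto simp: coef_tensor lookup_single when_def split: if_splits)

section \<open>The symmetric group as a finite group\<close>

lemma symgroup_comp [intro, simp]: "g \<in> symgroup d \<Longrightarrow> h \<in> symgroup d \<Longrightarrow> g \<circ> h \<in> symgroup d"
  by (simp add: symgroup_def permutes_compose)

lemma symgroup_inv [intro, simp]: "g \<in> symgroup d \<Longrightarrow> inv g \<in> symgroup d"
  by (simp add: symgroup_def permutes_inv)

lemma symgroup_id [intro, simp]: "id \<in> symgroup d"
  by (simp add: symgroup_def permutes_id)

lemma finite_symgroup [intro, simp]: "finite (symgroup d)"
  by (simp add: symgroup_def finite_permutations)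

lemma symgroup_bij: "g \<in> symgroup d \<Longrightarrow> bij g"
  by (simp add: symgroup_def permutes_bij)

lemma symgroup_inv_apply [simp]:
  "g \<in> symgroup d \<Longrightarrow> inv g (g x) = x" "g \<in> symgroup d \<Longrightarrow> g (inv g x) = x"
  by (simp_all add: symgroup_def permutes_inverses)

lemma symgroup_inv_o [simp]:
  "g \<in> symgroup d \<Longrightarrow> inv g \<circ> g = id" "g \<in> symgroup d \<Longrightarrow> g \<circ> inv g = id"
  by (simp_all add: symgroup_def permutes_inv_o)

lemma symgroup_inv_inv [simp]: "g \<in> symgroup d \<Longrightarrow> inv (inv g) = g"
  by (simp add: symgroup_bij inv_inv_eq)

lemma symgroup_inv_comp:
  "g \<in> symgroup d \<Longrightarrow> h \<in> symgroup d \<Longrightarrow> inv (g \<circ> h) = inv h \<circ> inv g"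
  by (simp add: symgroup_bij o_inv_distrib)

lemma symgroup_cancel [simp]:
  "g \<in> symgroup d \<Longrightarrow> inv g \<circ> (g \<circ> f) = f" "g \<in> symgroup d \<Longrightarrow> g \<circ> (inv g \<circ> f) = f"
  "g \<in> symgroup d \<Longrightarrow> f' \<circ> g \<circ> inv g = f'" "g \<in> symgroup d \<Longrightarrow> f' \<circ> inv g \<circ> g = f'"
  by (simp_all add: fun_eq_iff)

lemma symgroup_permutation: "g \<in> symgroup d \<Longrightarrow> permutation g"
  by (auto simp: symgroup_def permutation_permutes)

lemma symgroup_lt: "g \<in> symgroup d \<Longrightarrow> x < d \<Longrightarrow> g x < d"
  by (simp add: symgroup_def) (metis lessThan_iff permutes_in_image)

lemma sum_symgroup_inv: "(\<Sum>g\<in>symgroup d. f (inv g)) = (\<Sum>g\<in>symgroup d. f g)"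
  unfolding symgroup_def by (rule sum_permutations_inverse[symmetric])

lemma sum_symgroup_left: "k \<in> symgroup d \<Longrightarrow> (\<Sum>g\<in>symgroup d. f (k \<circ> g)) = (\<Sum>g\<in>symgroup d. f g)"
  unfolding symgroup_def by (rule setum_permutations_compose_left[symmetric]) simp

lemma sum_symgroup_right: "k \<in> symgroup d \<Longrightarrow> (\<Sum>g\<in>symgroup d. f (g \<circ> k)) = (\<Sum>g\<in>symgroup d. f g)"
  unfolding symgroup_def by (rule sum_permutations_compose_right[symmetric]) simp

text \<open>Only the coefficients of \<open>x\<close> on the symmetric group count, so that \<open>x\<close> need not be
  assumed to lie in the group algebra.\<close>

definition act :: "nat \<Rightarrow> 'a action \<Rightarrow> ((nat \<Rightarrow> nat) \<Rightarrow>\<^sub>0 complex) \<Rightarrow> ('a \<Rightarrow>\<^sub>0 complex) \<Rightarrow> ('a \<Rightarrow>\<^sub>0 complex)" where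
  "act d \<rho> x m = (\<Sum>g\<in>symgroup d. smul (coef x g) (\<rho> g m))"

lemma act_add_left: "act d \<rho> (x + y) m = act d \<rho> x m + act d \<rho> y m"
  by (simp add: act_def lookup_add free_vs.scale_left_distrib sum.distrib)

lemma act_smul_left: "act d \<rho> (smul c x) m = smul c (act d \<rho> x m)"
  by (simp add: act_def free_vs.scale_sum_right)

lemma act_zero_left [simp]: "act d \<rho> 0 m = 0"
  by (simp add: act_def)

lemma act_sum_left: "act d \<rho> (\<Sum>i\<in>I. x i) m = (\<Sum>i\<in>I. act d \<rho> (x i) m)"
  by (induction I rule: infinite_finite_induct) (simp_all add: act_add_left)

lemma act_basis: "g \<in> symgroup d \<Longrightarrow> act d \<rho> (basis_vec g) m = \<rho> g m"
proof -
  assume g: "g \<in> symgroup d"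
  have "act d \<rho> (basis_vec g) m = (\<Sum>h\<in>symgroup d. if h = g then \<rho> h m else 0)"
    unfolding act_def by (intro sum.cong) (auto simp: lookup_single when_def)
  then show ?thesis using g by simp
qed

lemma lin_act_left: "lin (\<lambda>x. act d \<rho> x m)"
  by (rule linI) (simp_all add: act_add_left act_smul_left)

lemma act_cong: "(\<And>g. g \<in> symgroup d \<Longrightarrow> coef x g = coef y g) \<Longrightarrow> act d \<rho> x m = act d \<rho> y m"
  by (simp add: act_def)

lemma coef_left_action: "g \<in> symgroup d \<Longrightarrow> coef (left_action g x) k = coef x (inv g \<circ> k)"
  unfolding left_action_def
  by (rule coef_lin_ext_basis) simp_all

lemma left_action_basis [simp]: "left_action g (basis_vec h) = basis_vec (g \<circ> h)"
  by (simp add: left_action_def)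

lemma diagonal_action_alt:
  "diagonal_action g = lin_ext (\<lambda>p. basis_vec (g \<circ> fst p, g \<circ> snd p))"
  by (simp add: diagonal_action_def case_prod_unfold)

lemma coef_diagonal_action:
  "g \<in> symgroup d \<Longrightarrow> coef (diagonal_action g x) (k, l) = coef x (inv g \<circ> k, inv g \<circ> l)"
  unfolding diagonal_action_alt
  by (subst coef_lin_ext_basis[where f' = "\<lambda>p. (inv g \<circ> fst p, inv g \<circ> snd p)"]) simp_all

text \<open>The action lives on the whole ambient space; modules are invariant subspaces, supplied
  separately as \<open>subrep d \<rho> M\<close>. The instances are \<open>left_action\<close> and
  \<open>diagonal_action\<close>.\<close>

locale sym_rep =
  fixes d :: nat and \<rho> :: "'a action"
  assumes lin_rep: "g \<in> symgroup d \<Longrightarrow> lin (\<rho> g)"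
    and rep_id: "\<rho> id x = x"
    and rep_comp: "g \<in> symgroup d \<Longrightarrow> h \<in> symgroup d \<Longrightarrow> \<rho> (g \<circ> h) x = \<rho> g (\<rho> h x)"
begin

lemma lin_act: "lin (act d \<rho> x)"
proof (rule linI)
  show "act d \<rho> x (m + n) = act d \<rho> x m + act d \<rho> x n" for m n
    by (simp add: act_def free_pair.linear_add[OF lin_rep] free_vs.scale_right_distrib sum.distrib)
  show "act d \<rho> x (smul c m) = smul c (act d \<rho> x m)" for c m
    by (simp add: act_def free_pair.linear_scale[OF lin_rep] free_vs.scale_sum_right
        mult.commute)
qed

lemmas act_add = free_pair.linear_add[OF lin_act]
  and act_smul = free_pair.linear_scale[OF lin_act]
  and act_diff = free_pair.linear_diff[OF lin_act]
  and act_zero = free_pair.linear_0[OF lin_act]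
  and act_sum = free_pair.linear_sum[OF lin_act]

text \<open>The product of the group algebra is \<open>act\<close> for \<open>left_action\<close>.
  So the reindexing k = g h in the double sum yields the module axiom in general and, for
  \<open>left_action\<close> itself, associativity of the product.\<close>

lemma act_assoc: "act d \<rho> x (act d \<rho> y m) = act d \<rho> (act d left_action x y) m"
proof -
  have "act d \<rho> x (act d \<rho> y m)
      = (\<Sum>g\<in>symgroup d. \<Sum>h\<in>symgroup d. smul (coef x g * coef y h) (\<rho> (g \<circ> h) m))"
    unfolding act_def[of d \<rho> x]
  proof (rule sum.cong[OF refl])
    fix g assume g: "g \<in> symgroup d"
    show "smul (coef x g) (\<rho> g (act d \<rho> y m))
        = (\<Sum>h\<in>symgroup d. smul (coef x g * coef y h) (\<rho> (g \<circ> h) m))"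
      using g by (simp add: act_def free_pair.linear_sum[OF lin_rep] free_pair.linear_scale[OF lin_rep]
          rep_comp free_vs.scale_sum_right)
  qed
  also have "\<dots> = (\<Sum>g\<in>symgroup d. \<Sum>k\<in>symgroup d. smul (coef x g * coef y (inv g \<circ> k)) (\<rho> k m))"
  proof (rule sum.cong[OF refl])
    fix g assume g: "g \<in> symgroup d"
    show "(\<Sum>h\<in>symgroup d. smul (coef x g * coef y h) (\<rho> (g \<circ> h) m))
        = (\<Sum>k\<in>symgroup d. smul (coef x g * coef y (inv g \<circ> k)) (\<rho> k m))"
      using sum_symgroup_left[OF g, of "\<lambda>k. smul (coef x g * coef y (inv g \<circ> k)) (\<rho> k m)"] g
      by simp
  qed
  also have "\<dots> = (\<Sum>k\<in>symgroup d. smul (\<Sum>g\<in>symgroup d. coef x g * coef y (inv g \<circ> k)) (\<rho> k m))"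
    by (subst sum.swap) (simp add: free_vs.scale_sum_left)
  also have "\<dots> = act d \<rho> (act d left_action x y) m"
    unfolding act_def[of d \<rho>]
    by (intro sum.cong refl arg_cong2[where f = smul]) (simp add: act_def coef_sum coef_left_action)
  finally show ?thesis .
qed

lemma act_one: "act d \<rho> (basis_vec id) m = m"
  by (simp add: act_basis rep_id)

lemma subrep_act: "subrep d \<rho> M \<Longrightarrow> m \<in> M \<Longrightarrow> act d \<rho> x m \<in> M"
  unfolding act_def subrep_def
  by (intro free_vs.subspace_sum free_vs.subspace_scale) auto

lemma subrep_cyclic: "subrep d \<rho> (range (\<lambda>x. act d \<rho> x m))"
  unfolding subrep_def
proof (intro conjI ballI)
  show "free_vs.subspace (range (\<lambda>x. act d \<rho> x m))"
    using free_pair.linear_subspace_image[OF lin_act_left free_vs.subspace_UNIV] .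
  fix g w assume "g \<in> symgroup d" "w \<in> range (\<lambda>x. act d \<rho> x m)"
  then show "\<rho> g w \<in> range (\<lambda>x. act d \<rho> x m)"
    by (auto simp: act_basis[symmetric] act_assoc)
qed

lemma cyclic_mem: "m \<in> range (\<lambda>x. act d \<rho> x m)"
  by (metis act_one rangeI)

end

lemma sym_rep_left_action: "sym_rep d left_action"
proof (rule sym_rep.intro)
  show "lin (left_action g)" for g
    unfolding left_action_def by (rule lin_lin_ext)
  show "left_action id x = x" for x
    by (rule poly_mapping_eqI) (simp add: coef_left_action[OF symgroup_id])
  show "left_action (g \<circ> h) x = left_action g (left_action h x)"
    if "g \<in> symgroup d" "h \<in> symgroup d" for g h x
    using that
    by (intro poly_mapping_eqI) (simp add: coef_left_action[of _ d] symgroup_inv_comp comp_assoc)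
qed

lemma sym_rep_diagonal_action: "sym_rep d diagonal_action"
proof (rule sym_rep.intro)
  show "lin (diagonal_action g)" for g
    unfolding diagonal_action_alt by (rule lin_lin_ext)
  show "diagonal_action id x = x" for x
    by (rule poly_mapping_eqI) (auto simp: coef_diagonal_action[OF symgroup_id])
  show "diagonal_action (g \<circ> h) x = diagonal_action g (diagonal_action h x)"
    if "g \<in> symgroup d" "h \<in> symgroup d" for g h x
    using that
    by (intro poly_mapping_eqI)
      (auto simp: coef_diagonal_action[of _ d] symgroup_inv_comp comp_assoc)
qed

text \<open>Coefficients of the left factor outside the symmetric group are dropped, those of the
  right factor are not. Hence \<open>gmult_free_on\<close> asks for the support of the right factor,
  and \<open>gmult_one_right\<close> for that of the left one.\<close>

abbreviation gmult :: "nat \<Rightarrow> ((nat \<Rightarrow> nat) \<Rightarrow>\<^sub>0 complex) \<Rightarrow> ((nat \<Rightarrow> nat) \<Rightarrow>\<^sub>0 complex) \<Rightarrow> ((nat \<Rightarrow> nat) \<Rightarrow>\<^sub>0 complex)" where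
  "gmult d \<equiv> act d left_action"

lemmas gmult_assoc = sym_rep.act_assoc[OF sym_rep_left_action, symmetric]
  and gmult_add = sym_rep.act_add[OF sym_rep_left_action]
  and gmult_smul = sym_rep.act_smul[OF sym_rep_left_action]
  and gmult_diff = sym_rep.act_diff[OF sym_rep_left_action]
  and gmult_zero [simp] = sym_rep.act_zero[OF sym_rep_left_action]
  and gmult_sum = sym_rep.act_sum[OF sym_rep_left_action]
  and gmult_one_left [simp] = sym_rep.act_one[OF sym_rep_left_action]

lemma coef_gmult: "coef (gmult d x y) k = (\<Sum>g\<in>symgroup d. coef x g * coef y (inv g \<circ> k))"
  by (simp add: act_def coef_sum coef_left_action)

lemma coef_gmult': "k \<in> symgroup d \<Longrightarrow>
   coef (gmult d x y) k = (\<Sum>g\<in>symgroup d. coef x (k \<circ> inv g) * coef y g)"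
  using sum_symgroup_inv[of "\<lambda>g. coef x g * coef y (inv g \<circ> k)" d]
   sum_symgroup_right[of "inv k" d "\<lambda>g. coef x (inv g) * coef y (g \<circ> k)"]
  by (simp add: coef_gmult symgroup_inv_comp)

lemma gmult_free_on: "y \<in> free_on (symgroup d) \<Longrightarrow> gmult d x y \<in> free_on (symgroup d)"
proof -
  assume y: "y \<in> free_on (symgroup d)"
  have "coef y (inv g \<circ> k) = 0" if "k \<notin> symgroup d" "g \<in> symgroup d" for g k
  proof -
    have "inv g \<circ> k \<notin> symgroup d"
    proof
      assume "inv g \<circ> k \<in> symgroup d"
      then have "g \<circ> (inv g \<circ> k) \<in> symgroup d"
        using that(2) by blast
      then show False using that by simp
    qed
    then show ?thesis using y by (simp add: in_free_on_iff)
  qed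
  then show ?thesis
    by (auto simp: in_free_on_iff coef_gmult)
qed

lemma basis_free_on [simp]: "a \<in> A \<Longrightarrow> basis_vec a \<in> free_on A"
  by (auto simp: in_free_on_iff lookup_single when_def)

lemma gmult_one_right: "x \<in> free_on (symgroup d) \<Longrightarrow> gmult d x (basis_vec id) = x"
proof -
  assume x: "x \<in> free_on (symgroup d)"
  then have "gmult d x (basis_vec id) \<in> free_on (symgroup d)"
    by (simp add: gmult_free_on)
  moreover have "coef (gmult d x (basis_vec id)) k = coef x k" if "k \<in> symgroup d" for k
  proof -
    have "coef (gmult d x (basis_vec id)) k = (\<Sum>g\<in>symgroup d. if g = id then coef x (k \<circ> inv g) else 0)"
      unfolding coef_gmult'[OF that] by (intro sum.cong) (auto simp: lookup_single when_def)
    then show ?thesis by simp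
  qed
  ultimately show ?thesis using x
    by (metis (no_types, lifting) in_free_on_iff poly_mapping_eqI)
qed

lemma gmult_basis: "g \<in> symgroup d \<Longrightarrow> gmult d (basis_vec g) (basis_vec h) = basis_vec (g \<circ> h)"
  by (simp add: act_basis)

text \<open>The adjoint with respect to the Hermitian inner product in which the permutations are
  orthonormal.\<close>

definition star :: "nat \<Rightarrow> ((nat \<Rightarrow> nat) \<Rightarrow>\<^sub>0 complex) \<Rightarrow> ((nat \<Rightarrow> nat) \<Rightarrow>\<^sub>0 complex)" where
  "star d x = of_fun (symgroup d) (\<lambda>g. cnj (coef x (inv g)))"

lemma coef_star: "coef (star d x) g = (if g \<in> symgroup d then cnj (coef x (inv g)) else 0)"
  by (simp add: star_def)

lemma star_gmult: "star d (gmult d x y) = gmult d (star d y) (star d x)"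
proof (rule poly_mapping_eqI)
  fix k
  have *: "gmult d (star d y) (star d x) \<in> free_on (symgroup d)"
    by (intro gmult_free_on) (simp add: star_def)
  show "coef (star d (gmult d x y)) k = coef (gmult d (star d y) (star d x)) k"
  proof (cases "k \<in> symgroup d")
    case True
    have "coef (gmult d (star d y) (star d x)) k
        = (\<Sum>g\<in>symgroup d. cnj (coef x (inv g)) * cnj (coef y (g \<circ> inv k)))"
      unfolding coef_gmult'[OF True] using True
      by (intro sum.cong refl) (auto simp: coef_star True symgroup_inv_comp[of _ d])
    also have "\<dots> = (\<Sum>g\<in>symgroup d. cnj (coef x g) * cnj (coef y (inv g \<circ> inv k)))"
      using sum_symgroup_inv[of "\<lambda>g. cnj (coef x g) * cnj (coef y (inv g \<circ> inv k))" d]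
      by simp
    also have "\<dots> = coef (star d (gmult d x y)) k"
      using True by (simp add: coef_star coef_gmult)
    finally show ?thesis by simp
  qed (use * in \<open>simp add: in_free_on_iff coef_star\<close>)
qed

lemma star_add: "star d (x + y) = star d x + star d y"
  by (rule poly_mapping_eqI) (simp add: coef_star lookup_add)

lemma star_smul: "star d (smul c x) = smul (cnj c) (star d x)"
  by (rule poly_mapping_eqI) (simp add: coef_star)

lemma star_zero [simp]: "star d 0 = 0"
  by (rule poly_mapping_eqI) (simp add: coef_star)

lemma star_sum: "star d (\<Sum>i\<in>I. f i) = (\<Sum>i\<in>I. star d (f i))"
  by (induction I rule: infinite_finite_induct) (simp_all add: star_add)

lemma star_basis: "g \<in> symgroup d \<Longrightarrow> star d (basis_vec g) = basis_vec (inv g)"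
proof (rule poly_mapping_eqI)
  fix k assume g: "g \<in> symgroup d"
  then have "g = inv k \<longleftrightarrow> inv g = k" if "k \<in> symgroup d"
    using that by auto
  then show "coef (star d (basis_vec g)) k = coef (basis_vec (inv g)) k"
    using g by (cases "k \<in> symgroup d") (auto simp: coef_star lookup_single when_def)
qed

lemma star_star: "x \<in> free_on (symgroup d) \<Longrightarrow> star d (star d x) = x"
  by (rule poly_mapping_eqI) (auto simp: coef_star in_free_on_iff)

text \<open>The coefficient of x times its adjoint at \<open>id\<close> is the squared norm of x.
  This definiteness later keeps the squares of Young symmetrizers and of their averages from
  vanishing.\<close>

lemma gmult_star_eq_0D:
  assumes "gmult d x (star d x) = 0" "x \<in> free_on (symgroup d)"
  shows "x = 0"
proof -
  have "coef (gmult d x (star d x)) id = of_real (\<Sum>g\<in>symgroup d. (cmod (coef x g))\<^sup>2)"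
    by (simp add: coef_gmult coef_star complex_norm_square del: of_real_power)
  then have "(\<Sum>g\<in>symgroup d. (cmod (coef x g))\<^sup>2) = 0"
    unfolding assms(1) by (metis lookup_zero of_real_eq_0_iff)
  then have "\<forall>g\<in>symgroup d. coef x g = 0"
    by (subst (asm) sum_nonneg_eq_0_iff) auto
  then show "x = 0"
    using assms(2) by (intro poly_mapping_eqI) (auto simp: in_free_on_iff)
qed

lemma gmult_self_adjoint_eq_0D:
  "gmult d x x = 0 \<Longrightarrow> star d x = x \<Longrightarrow> x \<in> free_on (symgroup d) \<Longrightarrow> x = 0"
  using gmult_star_eq_0D by metis

section \<open>Young tableaux\<close>

definition box :: "(nat \<Rightarrow> nat) \<Rightarrow> nat \<Rightarrow> nat \<Rightarrow> nat" where
  "box \<alpha> i j = sum \<alpha> {..<i} + j"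

lemma tableau_row_box: "tableau_row \<alpha> i = box \<alpha> i ` {..<\<alpha> i}"
  by (auto simp: tableau_row_def box_def)

lemma tableau_col_box: "tableau_col \<alpha> j = (\<lambda>i. box \<alpha> i j) ` {i. j < \<alpha> i}"
  by (auto simp: tableau_col_def box_def)

lemma sum_lessThan_mono: "i \<le> i' \<Longrightarrow> sum \<alpha> {..<i} \<le> sum \<alpha> {..<i'}" for \<alpha> :: "nat \<Rightarrow> nat"
  by (intro sum_mono2) auto

lemma box_less: "i < i' \<Longrightarrow> j < \<alpha> i \<Longrightarrow> box \<alpha> i j < sum \<alpha> {..<i'}"
  using sum_lessThan_mono[of "Suc i" i' \<alpha>] by (simp add: box_def)

lemma box_inject:
  assumes "j < \<alpha> i" "j' < \<alpha> i'"
  shows "box \<alpha> i j = box \<alpha> i' j' \<longleftrightarrow> i = i' \<and> j = j'"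
proof
  assume eq: "box \<alpha> i j = box \<alpha> i' j'"
  have "i = i'"
  proof (rule linorder_cases[of i i'])
    assume "i < i'"
    then show ?thesis
      using box_less[of i i' j \<alpha>] assms eq by (simp add: box_def)
  next
    assume "i' < i"
    then show ?thesis
      using box_less[of i' i j' \<alpha>] assms eq by (simp add: box_def)
  qed
  then show "i = i' \<and> j = j'" using eq by (simp add: box_def)
qed auto

lemma box_cases:
  assumes "x < sum \<alpha> {..<N}"
  obtains i j where "i < N" "j < \<alpha> i" "x = box \<alpha> i j"
proof -
  have "\<exists>i<N. \<exists>j<\<alpha> i. x = box \<alpha> i j"
    using assms
  proof (induction N)
    case (Suc N)
    show ?case
    proof (cases "x < sum \<alpha> {..<N}")
      case True
      then show ?thesis using Suc.IH less_SucI by blast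
    next
      case False
      then have "x - sum \<alpha> {..<N} < \<alpha> N" "x = box \<alpha> N (x - sum \<alpha> {..<N})"
        using Suc.prems by (auto simp: box_def)
      then show ?thesis by blast
    qed
  qed simp
  then show ?thesis using that by blast
qed

lemma partition_size_partitions: "\<alpha> \<in> partitions d \<Longrightarrow> partition_size \<alpha> = d"
  by (simp add: partitions_def)

lemma partitions_mono: "\<alpha> \<in> partitions d \<Longrightarrow> i \<le> i' \<Longrightarrow> \<alpha> i' \<le> \<alpha> i"
  by (simp add: partitions_def antimonoD)

text \<open>If part number i were positive, so would be all parts before it, which makes i + 1 > d
  parts of size at least 1.\<close>

lemma partitions_support: "\<alpha> \<in> partitions d \<Longrightarrow> d \<le> i \<Longrightarrow> \<alpha> i = 0"
proof (rule ccontr)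
  assume \<alpha>: "\<alpha> \<in> partitions d" and "d \<le> i" and nz: "\<alpha> i \<noteq> 0"
  have pos: "\<alpha> i' \<ge> 1" if "i' \<le> i" for i'
    using partitions_mono[OF \<alpha> that] nz by linarith
  have "(\<Sum>i'\<in>{..i}. 1) \<le> sum \<alpha> {..i}"
    using pos by (intro sum_mono) auto
  also have "\<dots> \<le> sum \<alpha> {i. \<alpha> i \<noteq> 0}"
    using \<alpha> pos by (intro sum_mono2) (auto simp: partitions_def Suc_le_eq)
  also have "\<dots> = d"
    using \<alpha> by (simp add: partitions_def partition_size_def)
  finally show False using \<open>d \<le> i\<close> by simp
qed

lemma partitions_sum: "\<alpha> \<in> partitions d \<Longrightarrow> sum \<alpha> {..<d} = d"
proof -
  assume \<alpha>: "\<alpha> \<in> partitions d"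
  have "{i. \<alpha> i \<noteq> 0} \<subseteq> {..<d}"
  proof
    fix i assume "i \<in> {i. \<alpha> i \<noteq> 0}"
    then show "i \<in> {..<d}" using partitions_support[OF \<alpha>, of i] by (cases "i < d") auto
  qed
  then have "sum \<alpha> {i. \<alpha> i \<noteq> 0} = sum \<alpha> {..<d}"
    by (intro sum.mono_neutral_left) auto
  then show ?thesis using \<alpha> by (simp add: partitions_def partition_size_def)
qed

lemma partitions_sum_le:
  assumes \<alpha>: "\<alpha> \<in> partitions d"
  shows "sum \<alpha> {..<i} \<le> d"
proof (cases "i \<le> d")
  case True
  then show ?thesis
    using sum_lessThan_mono[OF True, of \<alpha>] partitions_sum[OF \<alpha>] by simp
next
  case False
  have "sum \<alpha> {..<i} = sum \<alpha> {..<d}"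
    using partitions_support[OF \<alpha>] False by (intro sum.mono_neutral_right) auto
  then show ?thesis using partitions_sum[OF \<alpha>] by simp
qed

lemma partitions_le: "\<alpha> \<in> partitions d \<Longrightarrow> \<alpha> i \<le> d"
  using partitions_sum_le[of \<alpha> d "Suc i"] by simp

lemma finite_partitions: "finite (partitions d)"
proof (rule finite_subset)
  show "partitions d \<subseteq> {\<alpha>. \<forall>i. (i \<in> {..<d} \<longrightarrow> \<alpha> i \<in> {..d}) \<and> (i \<notin> {..<d} \<longrightarrow> \<alpha> i = 0)}"
    using partitions_le partitions_support by auto
qed (rule finite_set_of_finite_funs; simp)

lemma partition_box_less: "\<alpha> \<in> partitions d \<Longrightarrow> j < \<alpha> i \<Longrightarrow> box \<alpha> i j < d"
  using box_less[of i "Suc i" j \<alpha>] partitions_sum_le[of \<alpha> d "Suc i"] by linarith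

lemma partition_box_cases:
  assumes "\<alpha> \<in> partitions d" "x < d"
  obtains i j where "j < \<alpha> i" "x = box \<alpha> i j"
  using box_cases[of x \<alpha> d] partitions_sum[OF assms(1)] assms(2) by metis

text \<open>Row and column groups are both of this form, so the subgroup laws and the reindexing of
  sums are proved once for both.\<close>

definition set_stab :: "nat \<Rightarrow> (nat \<Rightarrow> nat set) \<Rightarrow> (nat \<Rightarrow> nat) set" where
  "set_stab d F = {p \<in> symgroup d. \<forall>i. p ` F i = F i}"

lemma row_group_eq: "\<alpha> \<in> partitions d \<Longrightarrow> row_group \<alpha> = set_stab d (tableau_row \<alpha>)"
  by (simp add: row_group_def set_stab_def partition_size_partitions)

lemma col_group_eq: "\<alpha> \<in> partitions d \<Longrightarrow> col_group \<alpha> = set_stab d (tableau_col \<alpha>)"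
  by (simp add: col_group_def set_stab_def partition_size_partitions)

lemma set_stab_symgroup: "set_stab d F \<subseteq> symgroup d"
  by (auto simp: set_stab_def)

lemma finite_set_stab [simp]: "finite (set_stab d F)"
  using finite_subset[OF set_stab_symgroup] by blast

lemma set_stab_id [simp]: "id \<in> set_stab d F"
  by (simp add: set_stab_def)

lemma set_stab_comp:
  assumes "p \<in> set_stab d F" "q \<in> set_stab d F"
  shows "p \<circ> q \<in> set_stab d F"
proof -
  have "(p \<circ> q) ` F i = F i" for i
  proof -
    have "(p \<circ> q) ` F i = p ` (q ` F i)"
      by (simp only: image_comp)
    then show ?thesis using assms by (simp only: set_stab_def mem_Collect_eq)
  qed
  moreover have "p \<circ> q \<in> symgroup d"
    using assms by (simp add: set_stab_def)
  ultimately show ?thesis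
    by (simp only: set_stab_def mem_Collect_eq) simp
qed

lemma set_stab_inv:
  assumes p: "p \<in> set_stab d F"
  shows "inv p \<in> set_stab d F"
proof -
  have *: "p \<in> symgroup d" "p ` F i = F i" for i
    using p by (simp_all add: set_stab_def)
  have "inv p ` F i = F i" for i
  proof -
    have "inv p ` (p ` F i) = F i"
      by (simp only: image_comp symgroup_inv_o[OF *(1)] image_id id_apply)
    then show ?thesis by (simp only: *(2))
  qed
  then show ?thesis using * by (simp add: set_stab_def)
qed

lemma sum_set_stab_left:
  assumes "k \<in> set_stab d F" shows "(\<Sum>g\<in>set_stab d F. f (k \<circ> g)) = (\<Sum>g\<in>set_stab d F. f g)"
proof -
  have "k \<in> symgroup d"
    using assms set_stab_symgroup by blast
  then show ?thesis
    by (intro sum.reindex_bij_witness[of _ "\<lambda>g. inv k \<circ> g" "\<lambda>g. k \<circ> g"])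
      (simp_all add: set_stab_comp set_stab_inv assms)
qed

lemma sum_set_stab_right:
  assumes "k \<in> set_stab d F" shows "(\<Sum>g\<in>set_stab d F. f (g \<circ> k)) = (\<Sum>g\<in>set_stab d F. f g)"
proof -
  have "k \<in> symgroup d"
    using assms set_stab_symgroup by blast
  then show ?thesis
    by (intro sum.reindex_bij_witness[of _ "\<lambda>g. g \<circ> inv k" "\<lambda>g. g \<circ> k"])
      (simp_all add: set_stab_comp set_stab_inv assms)
qed

lemma sum_set_stab_inv: "(\<Sum>g\<in>set_stab d F. f (inv g)) = (\<Sum>g\<in>set_stab d F. f g)"
  by (intro sum.reindex_bij_witness[of _ inv inv])
    (simp_all add: set_stab_inv symgroup_inv_inv[OF subsetD[OF set_stab_symgroup]])

lemma set_stab_transpose: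
  assumes "\<And>i. x \<in> F i \<longleftrightarrow> y \<in> F i" "x < d" "y < d"
  shows "transpose x y \<in> set_stab d F"
proof -
  have "transpose x y permutes {..<d}"
    using assms by (auto intro: permutes_swap_id)
  moreover have "transpose x y ` F i = F i" for i
    using assms(1)[of i] by (cases "x \<in> F i"; cases "y \<in> F i") auto
  ultimately show ?thesis
    by (simp add: set_stab_def symgroup_def)
qed

lemma in_tableau_row_box:
  "j < \<alpha> i \<Longrightarrow> box \<alpha> i j \<in> tableau_row \<alpha> i' \<longleftrightarrow> i' = i"
  by (auto simp: tableau_row_box box_inject)

lemma in_tableau_col_box:
  "j < \<alpha> i \<Longrightarrow> box \<alpha> i j \<in> tableau_col \<alpha> j' \<longleftrightarrow> j' = j"
  by (auto simp: tableau_col_box box_inject)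

lemma tableau_rows_disjoint: "x \<in> tableau_row \<alpha> i \<Longrightarrow> x \<in> tableau_row \<alpha> i' \<Longrightarrow> i = i'"
  by (auto simp: tableau_row_box box_inject)

lemma tableau_cols_disjoint: "x \<in> tableau_col \<alpha> j \<Longrightarrow> x \<in> tableau_col \<alpha> j' \<Longrightarrow> j = j'"
  by (auto simp: tableau_col_box box_inject)

lemma tableau_row_less: "\<alpha> \<in> partitions d \<Longrightarrow> x \<in> tableau_row \<alpha> i \<Longrightarrow> x < d"
  by (auto simp: tableau_row_box partition_box_less)

lemma tableau_col_less: "\<alpha> \<in> partitions d \<Longrightarrow> x \<in> tableau_col \<alpha> i \<Longrightarrow> x < d"
  by (auto simp: tableau_col_box partition_box_less)

text \<open>\<open>h\<close> fills the boxes of \<open>\<beta>\<close> with the boxes of \<open>\<alpha>\<close>; the hypothesis \<open>sep\<close> says that no two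
  entries of a column come from the same row of \<open>\<alpha>\<close>. Hence the first \<open>i\<close> rows of \<open>\<alpha>\<close>
  contribute at most as many entries to each column as the column has boxes in the first \<open>i\<close>
  rows of \<open>\<beta>\<close>.\<close>

locale separated =
  fixes d and \<alpha> \<beta> h :: "nat \<Rightarrow> nat"
  assumes \<alpha>: "\<alpha> \<in> partitions d" and \<beta>: "\<beta> \<in> partitions d" and h: "h \<in> symgroup d"
    and sep: "\<And>i j x y. x \<in> tableau_row \<alpha> i \<Longrightarrow> y \<in> tableau_row \<alpha> i \<Longrightarrow>
      h x \<in> tableau_col \<beta> j \<Longrightarrow> h y \<in> tableau_col \<beta> j \<Longrightarrow> x = y"
begin

definition entries :: "nat \<Rightarrow> nat \<Rightarrow> nat set" where
  "entries i j = {x. x < sum \<alpha> {..<i} \<and> h x \<in> tableau_col \<beta> j}"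

lemma finite_entries [simp]: "finite (entries i j)"
  by (rule finite_subset[of _ "{..<sum \<alpha> {..<i}}"]) (auto simp: entries_def)

text \<open>If column j has boxes in all of the first i rows of \<beta>, the bound is i, and
  \<open>sep\<close> maps the entries injectively to rows of \<alpha>. Otherwise the whole column
  lies in the first i rows of \<beta>, and h maps the entries injectively into it.\<close>

lemma card_entries_le: "card (entries i j) \<le> card {i'. i' < i \<and> j < \<beta> i'}"
proof (cases "\<forall>i'<i. j < \<beta> i'")
  case True
  then have "{i'. i' < i \<and> j < \<beta> i'} = {..<i}" by auto
  moreover
  have "\<forall>x\<in>entries i j. \<exists>r. r < i \<and> x \<in> tableau_row \<alpha> r"
    by (auto simp: entries_def tableau_row_box elim!: box_cases)
  then obtain r where r: "\<And>x. x \<in> entries i j \<Longrightarrow> r x < i \<and> x \<in> tableau_row \<alpha> (r x)"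
    by metis
  then have "inj_on r (entries i j)"
    by (intro inj_onI sep[where j = j]) (auto simp: entries_def)
  then have "card (entries i j) \<le> card {..<i}"
    using r by (intro card_inj_on_le[of r]) auto
  ultimately show ?thesis by simp
next
  case False
  then obtain i0 where i0: "i0 < i" "\<beta> i0 \<le> j" by auto
  have *: "i' < i0" if "j < \<beta> i'" for i'
    using partitions_mono[OF \<beta>, of i0 i'] i0 that by linarith
  then have fin: "finite {i'. j < \<beta> i'}"
    by (metis (mono_tags, lifting) bounded_nat_set_is_finite mem_Collect_eq)
  have "card (entries i j) \<le> card (tableau_col \<beta> j)"
    using fin inj_on_subset[OF bij_is_inj[OF symgroup_bij[OF h]] subset_UNIV]
    by (intro card_inj_on_le[of h]) (auto simp: entries_def tableau_col_box)
  also have "\<dots> \<le> card {i'. j < \<beta> i'}"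
    unfolding tableau_col_box by (rule card_image_le[OF fin])
  also have "{i'. j < \<beta> i'} = {i'. i' < i \<and> j < \<beta> i'}"
    using * i0 by force
  finally show ?thesis .
qed

lemma sum_card_entries: "(\<Sum>j<d. card (entries i j)) = sum \<alpha> {..<i}"
proof -
  have "{..<sum \<alpha> {..<i}} = (\<Union>j\<in>{..<d}. entries i j)"
  proof (intro equalityI subsetI)
    fix x assume x: "x \<in> {..<sum \<alpha> {..<i}}"
    then have "h x < d"
      using symgroup_lt[OF h] partitions_sum_le[OF \<alpha>, of i] by auto
    then obtain i' j where "j < \<beta> i'" "h x = box \<beta> i' j"
      using partition_box_cases[OF \<beta>] by metis
    moreover from this have "j < d"
      using partitions_le[OF \<beta>, of i'] by linarith
    ultimately show "x \<in> (\<Union>j\<in>{..<d}. entries i j)"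
      using x by (auto simp: entries_def in_tableau_col_box)
  qed (auto simp: entries_def)
  then have "sum \<alpha> {..<i} = card (\<Union>j\<in>{..<d}. entries i j)"
    by (metis card_lessThan)
  also have "\<dots> = (\<Sum>j<d. card (entries i j))"
    by (intro card_UN_disjoint) (auto simp: entries_def dest: tableau_cols_disjoint)
  finally show ?thesis by simp
qed

lemma sum_card_boxes: "(\<Sum>j<d. card {i'. i' < i \<and> j < \<beta> i'}) = sum \<beta> {..<i}"
proof -
  have "(\<Sum>j<d. card {i'. i' < i \<and> j < \<beta> i'}) = (\<Sum>j<d. \<Sum>i'<i. if j < \<beta> i' then 1 else 0)"
    by (simp add: sum.If_cases Collect_conj_eq lessThan_def)
  also have "\<dots> = (\<Sum>i'<i. \<Sum>j<d. if j < \<beta> i' then 1 else 0)"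
    by (rule sum.swap)
  also have "\<dots> = sum \<beta> {..<i}"
  proof (rule sum.cong[OF refl])
    fix i'
    have "{..<d} \<inter> {j. j < \<beta> i'} = {..<\<beta> i'}"
      using partitions_le[OF \<beta>, of i'] by auto
    then show "(\<Sum>j<d. if j < \<beta> i' then 1 else 0) = \<beta> i'" by (simp add: sum.If_cases)
  qed
  finally show ?thesis .
qed

text \<open>Summed over all columns, the columnwise bound becomes a comparison of partial sums:
  \<beta> dominates \<alpha>.\<close>

lemma dominance: "sum \<alpha> {..<i} \<le> sum \<beta> {..<i}"
  unfolding sum_card_entries[symmetric] sum_card_boxes[symmetric]
  by (intro sum_mono card_entries_le)

end

text \<open>For equal shapes both sides of the columnwise bound have the same sum over the columns,
  so every bound is an equality. This forces row i to contain, for each box (i, j), an entry that h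
  sends to column j. Let p move box (i, j) to that entry; then \<open>h \<circ> p\<close> preserves
  columns, and its inverse is the column permutation sought.\<close>

lemma separated_same_shape:
  assumes "separated d \<alpha> \<alpha> h"
  obtains p q where "p \<in> row_group \<alpha>" "q \<in> col_group \<alpha>" "inv h = p \<circ> q"
proof -
  interpret separated d \<alpha> \<alpha> h by fact
  have card_eq: "card (entries i j) = card {i'. i' < i \<and> j < \<alpha> i'}" if "j < d" for i j
  proof -
    have "(\<Sum>j<d. card (entries i j)) = (\<Sum>j<d. card {i'. i' < i \<and> j < \<alpha> i'})"
      by (simp only: sum_card_entries sum_card_boxes)
    then show ?thesis
      by (rule sum_mono_inv) (use that card_entries_le in auto)
  qed
  have "\<exists>y. y \<in> tableau_row \<alpha> i \<and> h y \<in> tableau_col \<alpha> j" if ij: "j < \<alpha> i" for i j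
  proof (rule ccontr)
    assume no: "\<not> ?thesis"
    have jd: "j < d" using ij partitions_le[OF \<alpha>, of i] by linarith
    \<comment> \<open>Without such an entry row i would add nothing to column j, although the number
      of boxes grows by one there.\<close>
    have "entries (Suc i) j \<subseteq> entries i j"
    proof
      fix x assume x: "x \<in> entries (Suc i) j"
      then have "x < sum \<alpha> {..<Suc i}"
        by (simp add: entries_def)
      then obtain i' j' where ij': "i' < Suc i" "j' < \<alpha> i'" "x = box \<alpha> i' j'"
        by (rule box_cases)
      then have "x \<in> tableau_row \<alpha> i'" by (auto simp: tableau_row_box)
      then have "i' \<noteq> i" using no x by (auto simp: entries_def)
      then show "x \<in> entries i j" using ij' x box_less[of i' i j' \<alpha>] by (simp add: entries_def)
    qed
    then have "card (entries (Suc i) j) \<le> card (entries i j)"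
      by (intro card_mono) auto
    moreover have "{i'. i' < Suc i \<and> j < \<alpha> i'} = insert i {i'. i' < i \<and> j < \<alpha> i'}"
      using ij by (auto simp: less_Suc_eq)
    ultimately show False using card_eq[OF jd] by simp
  qed
  note ex_entry = this
  define Y where "Y i j = (SOME y. y \<in> tableau_row \<alpha> i \<and> h y \<in> tableau_col \<alpha> j)" for i j
  have Y: "Y i j \<in> tableau_row \<alpha> i \<and> h (Y i j) \<in> tableau_col \<alpha> j" if "j < \<alpha> i" for i j
    unfolding Y_def by (rule someI_ex[OF ex_entry[OF that]])
  define row where "row x = (SOME i. \<exists>j<\<alpha> i. x = box \<alpha> i j)" for x
  define col where "col x = x - sum \<alpha> {..<row x}" for x
  have row [simp]: "row (box \<alpha> i j) = i" if "j < \<alpha> i" for i j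
    unfolding row_def using that by (auto simp: box_inject intro!: some_equality)
  then have col [simp]: "col (box \<alpha> i j) = j" if "j < \<alpha> i" for i j
    unfolding col_def using that by (simp add: box_def)
  define p where "p x = (if x < d then Y (row x) (col x) else x)" for x
  have p_box: "p (box \<alpha> i j) = Y i j" if "j < \<alpha> i" for i j
    using that partition_box_less[OF \<alpha> that] by (simp add: p_def)
  have p_row: "p ` tableau_row \<alpha> i \<subseteq> tableau_row \<alpha> i" for i
  proof
    fix z assume "z \<in> p ` tableau_row \<alpha> i"
    then obtain j where "j < \<alpha> i" "z = Y i j"
      by (auto simp: tableau_row_box p_box)
    then show "z \<in> tableau_row \<alpha> i" using Y by blast
  qed
  have inj: "inj_on p {..<d}"
  proof (rule inj_onI)
    fix x y assume xy: "x \<in> {..<d}" "y \<in> {..<d}" and eq: "p x = p y"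
    obtain i j i' j' where *: "j < \<alpha> i" "x = box \<alpha> i j" "j' < \<alpha> i'" "y = box \<alpha> i' j'"
      using xy partition_box_cases[OF \<alpha>] by (metis lessThan_iff)
    then have eq': "Y i j = Y i' j'" using eq by (simp add: p_box)
    then have "i = i'" "j = j'"
      using Y[OF *(1)] Y[OF *(3)] tableau_rows_disjoint tableau_cols_disjoint by metis+
    then show "x = y" using * by simp
  qed
  have "p ` {..<d} \<subseteq> {..<d}"
  proof
    fix z assume "z \<in> p ` {..<d}"
    then obtain i j where "j < \<alpha> i" "z = Y i j"
      by (metis imageE lessThan_iff p_box partition_box_cases[OF \<alpha>])
    then show "z \<in> {..<d}" using Y tableau_row_less[OF \<alpha>] by blast
  qed
  with inj have "bij_betw p {..<d} {..<d}"
    by (simp add: bij_betw_def endo_inj_surj)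
  then have p: "p \<in> symgroup d"
    unfolding symgroup_def mem_Collect_eq by (rule bij_imp_permutes) (simp add: p_def)
  have fin: "finite (tableau_row \<alpha> i)" for i
    by (simp add: tableau_row_box)
  have injp: "inj_on p A" for A
    using symgroup_bij[OF p] bij_is_inj inj_on_subset by blast
  have "p ` tableau_row \<alpha> i = tableau_row \<alpha> i" for i
    using endo_inj_surj[OF fin p_row injp] .
  then have 1: "p \<in> row_group \<alpha>"
    using p by (simp add: row_group_eq[OF \<alpha>] set_stab_def)
  define q where "q = h \<circ> p"
  have q: "q \<in> symgroup d" using p h by (auto simp: q_def)
  have fin': "finite (tableau_col \<alpha> j)" for j
    by (rule finite_subset[of _ "{..<d}"]) (use tableau_col_less[OF \<alpha>] in auto)
  have q_col: "q ` tableau_col \<alpha> j \<subseteq> tableau_col \<alpha> j" for j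
  proof
    fix z assume "z \<in> q ` tableau_col \<alpha> j"
    then obtain i where "j < \<alpha> i" "z = h (Y i j)"
      by (auto simp: tableau_col_box p_box q_def)
    then show "z \<in> tableau_col \<alpha> j" using Y by blast
  qed
  have "inj_on q A" for A
    using symgroup_bij[OF q] bij_is_inj inj_on_subset by blast
  then have "q ` tableau_col \<alpha> j = tableau_col \<alpha> j" for j
    using endo_inj_surj[OF fin' q_col] by blast
  then have "q \<in> set_stab d (tableau_col \<alpha>)"
    using q by (simp add: set_stab_def)
  then have 2: "inv q \<in> col_group \<alpha>"
    by (simp add: col_group_eq[OF \<alpha>] set_stab_inv)
  have "inv h = p \<circ> inv q"
    using p h by (simp add: q_def symgroup_inv_comp[of _ d] o_assoc)
  with 1 2 show ?thesis by (rule that)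
qed

section \<open>The row symmetrizer a and the column antisymmetrizer b\<close>

definition row_sum :: "(nat \<Rightarrow> nat) \<Rightarrow> ((nat \<Rightarrow> nat) \<Rightarrow>\<^sub>0 complex)" where
  "row_sum \<alpha> = (\<Sum>p\<in>row_group \<alpha>. basis_vec p)"

definition col_sum :: "(nat \<Rightarrow> nat) \<Rightarrow> ((nat \<Rightarrow> nat) \<Rightarrow>\<^sub>0 complex)" where
  "col_sum \<alpha> = (\<Sum>q\<in>col_group \<alpha>. smul (of_int (sign q)) (basis_vec q))"

context
  fixes d and \<alpha> :: "nat \<Rightarrow> nat"
  assumes \<alpha>: "\<alpha> \<in> partitions d"
begin

lemma row_group_symgroup: "p \<in> row_group \<alpha> \<Longrightarrow> p \<in> symgroup d"
  using set_stab_symgroup by (auto simp: row_group_eq[OF \<alpha>])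

lemma col_group_symgroup: "p \<in> col_group \<alpha> \<Longrightarrow> p \<in> symgroup d"
  using set_stab_symgroup by (auto simp: col_group_eq[OF \<alpha>])

lemma finite_row_group: "finite (row_group \<alpha>)"
  by (simp add: row_group_eq[OF \<alpha>])

lemma finite_col_group: "finite (col_group \<alpha>)"
  by (simp add: col_group_eq[OF \<alpha>])

lemma card_row_group_pos: "card (row_group \<alpha>) > 0"
  by (auto simp: row_group_eq[OF \<alpha>] card_gt_0_iff intro: set_stab_id)

lemma card_col_group_pos: "card (col_group \<alpha>) > 0"
  by (auto simp: col_group_eq[OF \<alpha>] card_gt_0_iff intro: set_stab_id)

lemma row_sum_free_on: "row_sum \<alpha> \<in> free_on (symgroup d)"
  unfolding row_sum_def
  by (intro free_vs.subspace_sum subspace_free_on basis_free_on row_group_symgroup)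

lemma col_sum_free_on: "col_sum \<alpha> \<in> free_on (symgroup d)"
  unfolding col_sum_def
  by (intro free_vs.subspace_sum free_vs.subspace_scale subspace_free_on basis_free_on col_group_symgroup)

lemma young_symmetrizer_eq: "young_symmetrizer \<alpha> = gmult d (row_sum \<alpha>) (col_sum \<alpha>)"
proof -
  have "Poly_Mapping.single (p \<circ> q) (of_int (sign q)) = smul (of_int (sign q)) (basis_vec (p \<circ> q))" for p q
    by (rule poly_mapping_eqI) (auto simp: lookup_single when_def)
  note single_sign = this
  show ?thesis
    unfolding young_symmetrizer_def single_sign
    by (simp add: row_sum_def col_sum_def act_sum_left gmult_sum gmult_smul
        gmult_basis row_group_symgroup)
qed

lemma young_symmetrizer_free_on: "young_symmetrizer \<alpha> \<in> free_on (symgroup d)"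
  unfolding young_symmetrizer_eq by (intro gmult_free_on col_sum_free_on)

lemma row_sum_mult_basis: "p \<in> row_group \<alpha> \<Longrightarrow> gmult d (row_sum \<alpha>) (basis_vec p) = row_sum \<alpha>"
  by (simp add: row_sum_def act_sum_left gmult_basis row_group_symgroup)
    (simp add: row_group_eq[OF \<alpha>] sum_set_stab_right[where f = basis_vec])

lemma col_sum_mult_basis:
  assumes q: "q \<in> col_group \<alpha>"
  shows "gmult d (basis_vec q) (col_sum \<alpha>) = smul (of_int (sign q)) (col_sum \<alpha>)"
proof -
  have "gmult d (basis_vec q) (col_sum \<alpha>)
      = (\<Sum>r\<in>col_group \<alpha>. smul (of_int (sign r)) (basis_vec (q \<circ> r)))"
    using q by (simp add: col_sum_def gmult_sum gmult_smul gmult_basis col_group_symgroup)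
  also have "\<dots> = (\<Sum>r\<in>col_group \<alpha>. smul (of_int (sign q * sign (q \<circ> r))) (basis_vec (q \<circ> r)))"
    using q symgroup_permutation[OF col_group_symgroup]
    by (intro sum.cong) (simp_all add: sign_compose)
  also have "\<dots> = (\<Sum>r\<in>col_group \<alpha>. smul (of_int (sign q * sign r)) (basis_vec r))"
    using q sum_set_stab_left[where f = "\<lambda>r. smul (of_int (sign q * sign r)) (basis_vec r)"]
    unfolding col_group_eq[OF \<alpha>] by blast
  finally show ?thesis
    by (simp add: col_sum_def free_vs.scale_sum_right)
qed

lemma row_sum_square: "gmult d (row_sum \<alpha>) (row_sum \<alpha>) = smul (of_nat (card (row_group \<alpha>))) (row_sum \<alpha>)"
proof -
  have "gmult d (row_sum \<alpha>) (row_sum \<alpha>) = (\<Sum>p\<in>row_group \<alpha>. row_sum \<alpha>)"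
    by (subst (2) row_sum_def) (simp add: gmult_sum row_sum_mult_basis)
  then show ?thesis
    by (simp add: poly_mapping_eq_iff fun_eq_iff coef_sum)
qed

lemma col_sum_square: "gmult d (col_sum \<alpha>) (col_sum \<alpha>) = smul (of_nat (card (col_group \<alpha>))) (col_sum \<alpha>)"
proof -
  have "gmult d (col_sum \<alpha>) (col_sum \<alpha>) = (\<Sum>p\<in>col_group \<alpha>. col_sum \<alpha>)"
    by (subst (1) col_sum_def)
      (simp add: act_sum_left act_smul_left col_sum_mult_basis flip: of_int_mult)
  then show ?thesis
    by (simp add: poly_mapping_eq_iff fun_eq_iff coef_sum)
qed

lemma star_row_sum: "star d (row_sum \<alpha>) = row_sum \<alpha>"
  by (simp add: row_sum_def star_sum star_basis row_group_symgroup)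
    (simp add: row_group_eq[OF \<alpha>] sum_set_stab_inv[where f = basis_vec])

lemma star_col_sum: "star d (col_sum \<alpha>) = col_sum \<alpha>"
proof -
  have "star d (col_sum \<alpha>) = (\<Sum>q\<in>col_group \<alpha>. smul (of_int (sign (inv q))) (basis_vec (inv q)))"
    using symgroup_permutation[OF col_group_symgroup]
    by (simp add: col_sum_def star_sum star_smul star_basis col_group_symgroup sign_inverse)
  then show ?thesis
    by (simp add: col_group_eq[OF \<alpha>] col_sum_def sum_set_stab_inv[where f = "\<lambda>q. smul (of_int (sign q)) (basis_vec q)"])
qed

lemma coef_row_sum: "coef (row_sum \<alpha>) g = (if g \<in> row_group \<alpha> then 1 else 0)"
  by (simp add: row_sum_def coef_sum lookup_single when_def finite_row_group)

lemma coef_col_sum: "coef (col_sum \<alpha>) g = (if g \<in> col_group \<alpha> then of_int (sign g) else 0)"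
  by (simp add: col_sum_def coef_sum lookup_single when_def finite_col_group if_distrib[of "(*) _"] cong: if_cong)

end

text \<open>Failure of separation gives two letters in one row of \<alpha> that \<open>inv g\<close>
  sends into one column of \<beta>. Their transposition t lies in the row group, and its conjugate s
  with t g = g s lies in the column group. With a and b the row and column sums, a g b = a t g b = a
  g s b = - a g b.\<close>

lemma row_basis_col_eq_0:
  assumes \<alpha>: "\<alpha> \<in> partitions d" and \<beta>: "\<beta> \<in> partitions d" and g: "g \<in> symgroup d"
    and not_sep: "\<not> separated d \<alpha> \<beta> (inv g)"
  shows "gmult d (row_sum \<alpha>) (gmult d (basis_vec g) (col_sum \<beta>)) = 0"
proof -
  obtain i j x y where xy: "x \<in> tableau_row \<alpha> i" "y \<in> tableau_row \<alpha> i"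
      "inv g x \<in> tableau_col \<beta> j" "inv g y \<in> tableau_col \<beta> j" "x \<noteq> y"
    using assms by (auto simp: separated_def)
  define t where "t = transpose x y"
  define s where "s = transpose (inv g x) (inv g y)"
  have t: "t \<in> row_group \<alpha>"
    unfolding t_def row_group_eq[OF \<alpha>]
    by (rule set_stab_transpose) (use xy tableau_rows_disjoint tableau_row_less[OF \<alpha>] in blast)+
  have s: "s \<in> col_group \<beta>"
    unfolding s_def col_group_eq[OF \<beta>]
    by (rule set_stab_transpose) (use xy tableau_cols_disjoint tableau_col_less[OF \<beta>] in blast)+
  have "inv g x \<noteq> inv g y"
    using g xy(5) by (metis symgroup_inv_apply(2))
  then have sign: "sign s = -1"
    by (simp add: s_def sign_swap_id)
  have tg: "t \<circ> g = g \<circ> s"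
  proof
    fix z
    have "g z = w \<longleftrightarrow> z = inv g w" for w
      using symgroup_inv_apply[OF g] by metis
    note this[of x] this[of y]
    then show "(t \<circ> g) z = (g \<circ> s) z"
      using symgroup_inv_apply(2)[OF g] by (simp add: t_def s_def transpose_def)
  qed
  let ?z = "gmult d (row_sum \<alpha>) (gmult d (basis_vec g) (col_sum \<beta>))"
  have "?z = gmult d (gmult d (row_sum \<alpha>) (basis_vec t)) (gmult d (basis_vec g) (col_sum \<beta>))"
    by (simp add: row_sum_mult_basis[OF \<alpha> t])
  also have "\<dots> = gmult d (row_sum \<alpha>) (gmult d (gmult d (basis_vec t) (basis_vec g)) (col_sum \<beta>))"
    by (simp add: gmult_assoc)
  also have "gmult d (basis_vec t) (basis_vec g) = gmult d (basis_vec g) (basis_vec s)"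
    using g t by (simp add: gmult_basis row_group_symgroup[OF \<alpha>] tg)
  also have "gmult d (gmult d (basis_vec g) (basis_vec s)) (col_sum \<beta>)
      = smul (-1) (gmult d (basis_vec g) (col_sum \<beta>))"
    by (simp add: gmult_assoc col_sum_mult_basis[OF \<beta> s] sign gmult_smul del: free_vs.scale_minus_left)
  finally have *: "?z = smul (-1) ?z"
    unfolding gmult_smul .
  have "z = 0" if "z = smul (-1) z" for z :: "(nat \<Rightarrow> nat) \<Rightarrow>\<^sub>0 complex"
  proof (rule poly_mapping_eqI)
    fix k
    have "coef z k = - coef z k"
      using arg_cong[OF that, of "\<lambda>z. coef z k"] by (simp only: lookup_smul mult_minus1)
    then show "coef z k = coef 0 k" by simp
  qed
  from this[OF *] show ?thesis .
qed

lemma gmult_expand: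
  "gmult d y (gmult d x z) = (\<Sum>g\<in>symgroup d. smul (coef x g) (gmult d y (gmult d (basis_vec g) z)))"
  by (simp add: act_def[of _ _ x] gmult_sum gmult_smul act_basis)

text \<open>Some permutation g in x contributes a nonzero term a g b, and then \<open>inv g\<close>
  is separated.\<close>

lemma row_col_neq_0_dominance:
  assumes \<alpha>: "\<alpha> \<in> partitions d" and \<beta>: "\<beta> \<in> partitions d"
    and "gmult d (row_sum \<alpha>) (gmult d x (col_sum \<beta>)) \<noteq> 0"
  shows "sum \<alpha> {..<i} \<le> sum \<beta> {..<i}"
proof -
  have "gmult d (row_sum \<alpha>) (gmult d x (col_sum \<beta>))
      = (\<Sum>g\<in>symgroup d. smul (coef x g) (gmult d (row_sum \<alpha>) (gmult d (basis_vec g) (col_sum \<beta>))))"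
    by (rule gmult_expand)
  with assms(3) obtain g where g: "g \<in> symgroup d"
      and nz: "gmult d (row_sum \<alpha>) (gmult d (basis_vec g) (col_sum \<beta>)) \<noteq> 0"
    by (metis (no_types, lifting) free_vs.scale_zero_right sum.neutral)
  have "separated d \<alpha> \<beta> (inv g)"
    using row_basis_col_eq_0[OF \<alpha> \<beta> g] nz by metis
  then show ?thesis
    by (rule separated.dominance)
qed

section \<open>Young symmetrizers\<close>

text \<open>For a single permutation g there are two cases: g = p q with p in the row and q in the
  column group, and then a g b is a b up to the sign of q; or separation fails and a g b =
  0.\<close>

lemma row_col_multiple:
  assumes \<alpha>: "\<alpha> \<in> partitions d"
  shows "\<exists>c. gmult d (row_sum \<alpha>) (gmult d x (col_sum \<alpha>)) = smul c (young_symmetrizer \<alpha>)"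
proof -
  have "\<exists>c. gmult d (row_sum \<alpha>) (gmult d (basis_vec g) (col_sum \<alpha>)) = smul c (young_symmetrizer \<alpha>)"
    if g: "g \<in> symgroup d" for g
  proof (cases "separated d \<alpha> \<alpha> (inv g)")
    case True
    then obtain p q where pq: "p \<in> row_group \<alpha>" "q \<in> col_group \<alpha>" "inv (inv g) = p \<circ> q"
      by (rule separated_same_shape)
    then have "basis_vec g = gmult d (basis_vec p) (basis_vec q)"
      using g by (simp add: gmult_basis row_group_symgroup[OF \<alpha>])
    then have "gmult d (row_sum \<alpha>) (gmult d (basis_vec g) (col_sum \<alpha>))
       = gmult d (gmult d (row_sum \<alpha>) (basis_vec p)) (gmult d (basis_vec q) (col_sum \<alpha>))"
      by (simp only: gmult_assoc)
    also have "\<dots> = smul (of_int (sign q)) (young_symmetrizer \<alpha>)"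
      using pq by (simp add: row_sum_mult_basis[OF \<alpha>] col_sum_mult_basis[OF \<alpha>] gmult_smul
          young_symmetrizer_eq[OF \<alpha>])
    finally show ?thesis by blast
  next
    case False
    then show ?thesis
      using row_basis_col_eq_0[OF \<alpha> \<alpha> g] by (intro exI[of _ 0]) simp
  qed
  then obtain c where c: "\<And>g. g \<in> symgroup d \<Longrightarrow>
      gmult d (row_sum \<alpha>) (gmult d (basis_vec g) (col_sum \<alpha>)) = smul (c g) (young_symmetrizer \<alpha>)"
    by metis
  have "gmult d (row_sum \<alpha>) (gmult d x (col_sum \<alpha>))
      = smul (\<Sum>g\<in>symgroup d. coef x g * c g) (young_symmetrizer \<alpha>)"
    by (subst gmult_expand) (simp add: c free_vs.scale_sum_left)
  then show ?thesis by blast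
qed

lemma gmult_smul_left: "gmult d (smul c x) y = smul c (gmult d x y)"
  by (rule act_smul_left)

text \<open>The coefficient at \<open>id\<close> is, up to a factor, the trace of the regular
  representation.\<close>

lemma coef_id_gmult_commute: "coef (gmult d x y) id = coef (gmult d y x) id"
proof -
  have "coef (gmult d x y) id = (\<Sum>g\<in>symgroup d. coef x g * coef y (inv g))"
    by (simp add: coef_gmult)
  also have "\<dots> = (\<Sum>g\<in>symgroup d. coef x (inv g) * coef y g)"
    using sum_symgroup_inv[of "\<lambda>g. coef x (inv g) * coef y g" d] by simp
  also have "\<dots> = coef (gmult d y x) id"
    by (simp add: coef_gmult mult.commute)
  finally show ?thesis .
qed

text \<open>Averaging over conjugates without division by the group order; the values are central
  (\<open>conj_sum_central\<close>).\<close>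

definition conj_sum :: "nat \<Rightarrow> ((nat \<Rightarrow> nat) \<Rightarrow>\<^sub>0 complex) \<Rightarrow> ((nat \<Rightarrow> nat) \<Rightarrow>\<^sub>0 complex)" where
  "conj_sum d x = (\<Sum>g\<in>symgroup d. gmult d (basis_vec g) (gmult d x (basis_vec (inv g))))"

lemma conj_sum_free_on: "conj_sum d x \<in> free_on (symgroup d)"
  unfolding conj_sum_def
  by (intro free_vs.subspace_sum subspace_free_on gmult_free_on basis_free_on symgroup_inv)

lemma conj_sum_smul: "conj_sum d (smul c x) = smul c (conj_sum d x)"
  by (simp add: conj_sum_def gmult_smul_left gmult_smul free_vs.scale_sum_right)

lemma conj_sum_add: "conj_sum d (x + y) = conj_sum d x + conj_sum d y"
  by (simp add: conj_sum_def act_add_left gmult_add sum.distrib)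

lemma conj_sum_zero [simp]: "conj_sum d 0 = 0"
  by (simp add: conj_sum_def)

lemma conj_sum_sum: "conj_sum d (\<Sum>i\<in>I. f i) = (\<Sum>i\<in>I. conj_sum d (f i))"
  by (induction I rule: infinite_finite_induct) (simp_all add: conj_sum_add)

lemma coef_conj_sum_id:
  assumes "x \<in> free_on (symgroup d)"
  shows "coef (conj_sum d x) id = of_nat (card (symgroup d)) * coef x id"
proof -
  have "coef (gmult d (basis_vec g) (gmult d x (basis_vec (inv g)))) id = coef x id"
    if g: "g \<in> symgroup d" for g
  proof -
    have "coef (gmult d (basis_vec g) (gmult d x (basis_vec (inv g)))) id
        = coef (gmult d x (gmult d (basis_vec (inv g)) (basis_vec g))) id"
      by (subst coef_id_gmult_commute) (simp only: gmult_assoc)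
    then show ?thesis
      using g assms by (simp add: gmult_basis gmult_one_right)
  qed
  then show ?thesis
    by (simp add: conj_sum_def coef_sum)
qed

lemma conj_sum_central_basis:
  assumes k: "k \<in> symgroup d"
  shows "gmult d (basis_vec k) (conj_sum d x) = gmult d (conj_sum d x) (basis_vec k)"
proof -
  let ?f = "\<lambda>g. gmult d (basis_vec g) (gmult d x (basis_vec (inv g \<circ> k)))"
  have "gmult d (basis_vec k) (conj_sum d x)
      = (\<Sum>g\<in>symgroup d. gmult d (gmult d (basis_vec k) (basis_vec g)) (gmult d x (basis_vec (inv g))))"
    by (simp add: conj_sum_def gmult_sum gmult_assoc)
  also have "\<dots> = (\<Sum>g\<in>symgroup d. ?f (k \<circ> g))"
    using k by (intro sum.cong refl) (simp add: gmult_basis symgroup_inv_comp[of _ d])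
  also have "\<dots> = (\<Sum>g\<in>symgroup d. ?f g)"
    by (rule sum_symgroup_left[OF k])
  also have "\<dots> = gmult d (conj_sum d x) (basis_vec k)"
    using k by (simp add: conj_sum_def act_sum_left gmult_assoc gmult_basis)
  finally show ?thesis .
qed

lemma conj_sum_central:
  assumes "x \<in> free_on (symgroup d)"
  shows "gmult d x (conj_sum d y) = gmult d (conj_sum d y) x"
proof -
  have x: "x = (\<Sum>g\<in>symgroup d. smul (coef x g) (basis_vec g))"
    using free_on_eq_sum[OF finite_symgroup assms] .
  show ?thesis
    by (subst (1 2) x)
      (simp add: act_sum_left gmult_sum gmult_smul gmult_smul_left conj_sum_central_basis)
qed

text \<open>For a permutation h the products h y and y h are conjugate, and the average does not
  distinguish conjugates; the rest is linearity. It makes the averages of a b and of its adjoint b a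
  agree.\<close>

lemma conj_sum_gmult_commute:
  assumes "x \<in> free_on (symgroup d)"
  shows "conj_sum d (gmult d x y) = conj_sum d (gmult d y x)"
proof -
  have basis: "conj_sum d (gmult d (basis_vec h) y) = conj_sum d (gmult d y (basis_vec h))"
    if h: "h \<in> symgroup d" for h
  proof -
    let ?f = "\<lambda>g. gmult d (basis_vec g) (gmult d y (basis_vec (h \<circ> inv g)))"
    have "conj_sum d (gmult d (basis_vec h) y)
        = (\<Sum>g\<in>symgroup d. gmult d (gmult d (basis_vec g) (basis_vec h)) (gmult d y (basis_vec (inv g))))"
      by (simp only: conj_sum_def gmult_assoc)
    also have "\<dots> = (\<Sum>g\<in>symgroup d. ?f (g \<circ> h))"
      using h by (intro sum.cong refl)
        (simp add: gmult_basis symgroup_inv_comp[of _ d])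
    also have "\<dots> = (\<Sum>g\<in>symgroup d. ?f g)"
      by (rule sum_symgroup_right[OF h])
    also have "\<dots> = conj_sum d (gmult d y (basis_vec h))"
      using h by (simp add: conj_sum_def gmult_assoc gmult_basis)
    finally show ?thesis .
  qed
  have x: "x = (\<Sum>g\<in>symgroup d. smul (coef x g) (basis_vec g))"
    using free_on_eq_sum[OF finite_symgroup assms] .
  show ?thesis
    by (subst (1 2) x)
      (simp add: act_sum_left gmult_sum gmult_smul gmult_smul_left conj_sum_sum conj_sum_smul basis)
qed

lemma star_conj_sum: "star d (conj_sum d x) = conj_sum d (star d x)"
  by (simp add: conj_sum_def star_sum star_gmult star_basis gmult_assoc)

lemma row_col_group_inter:
  assumes \<alpha>: "\<alpha> \<in> partitions d" and p: "p \<in> row_group \<alpha>" "p \<in> col_group \<alpha>"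
  shows "p = id"
proof
  fix x
  have pG: "p \<in> symgroup d"
    using row_group_symgroup[OF \<alpha> p(1)] .
  show "p x = id x"
  proof (cases "x < d")
    case True
    then obtain i j where ij: "j < \<alpha> i" "x = box \<alpha> i j"
      using partition_box_cases[OF \<alpha>] by metis
    obtain i' j' where ij': "j' < \<alpha> i'" "p x = box \<alpha> i' j'"
      using partition_box_cases[OF \<alpha> symgroup_lt[OF pG True]] by metis
    have "p ` tableau_row \<alpha> i = tableau_row \<alpha> i" "p ` tableau_col \<alpha> j = tableau_col \<alpha> j"
      using p by (simp_all add: row_group_def col_group_def)
    moreover have "x \<in> tableau_row \<alpha> i" "x \<in> tableau_col \<alpha> j"
      using ij by (simp_all add: in_tableau_row_box in_tableau_col_box)
    ultimately have "p x \<in> tableau_row \<alpha> i" "p x \<in> tableau_col \<alpha> j"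
      by blast+
    then have "i' = i" "j' = j"
      using ij' by (simp_all add: in_tableau_row_box in_tableau_col_box)
    then show ?thesis using ij ij' by simp
  next
    case False
    then show ?thesis using pG by (simp add: symgroup_def permutes_def)
  qed
qed

text \<open>If p q = \<open>id\<close>, then p lies in both groups and is trivial, since a box is
  determined by its row and its column. So a single pair contributes.\<close>

lemma coef_young_symmetrizer_id:
  assumes \<alpha>: "\<alpha> \<in> partitions d"
  shows "coef (young_symmetrizer \<alpha>) id = 1"
proof -
  have "coef (row_sum \<alpha>) g * coef (col_sum \<alpha>) (inv g) = (if g = id then 1 else 0)"
    if g: "g \<in> symgroup d" for g
  proof (cases "g \<in> row_group \<alpha> \<and> inv g \<in> col_group \<alpha>")
    case True
    then have "inv g \<in> row_group \<alpha>"
      by (simp add: row_group_eq[OF \<alpha>] set_stab_inv)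
    then have "inv g = id"
      using row_col_group_inter[OF \<alpha>] True by blast
    then have "g = id"
      using symgroup_inv_inv[OF g] by simp
    then show ?thesis
      by (simp add: coef_row_sum[OF \<alpha>] coef_col_sum[OF \<alpha>] row_group_eq[OF \<alpha>] col_group_eq[OF \<alpha>])
  next
    case False
    then have "g \<noteq> id"
      by (auto simp: row_group_eq[OF \<alpha>] col_group_eq[OF \<alpha>])
    then show ?thesis
      using False by (auto simp: coef_row_sum[OF \<alpha>] coef_col_sum[OF \<alpha>])
  qed
  then have "coef (young_symmetrizer \<alpha>) id = (\<Sum>g\<in>symgroup d. if g = id then 1 else 0)"
    by (simp add: young_symmetrizer_eq[OF \<alpha>] coef_gmult)
  then show ?thesis by simp
qed

lemma young_neq_0: "\<alpha> \<in> partitions d \<Longrightarrow> young_symmetrizer \<alpha> \<noteq> 0"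
  using coef_young_symmetrizer_id by fastforce

text \<open>The regrouping brings the product into the form a y b, with a from \<alpha> and b from
  \<beta>, to which the results on row and column sums apply.\<close>

lemma young_sandwich:
  assumes \<alpha>: "\<alpha> \<in> partitions d" and \<beta>: "\<beta> \<in> partitions d"
  shows "gmult d (young_symmetrizer \<alpha>) (gmult d x (young_symmetrizer \<beta>))
    = gmult d (row_sum \<alpha>) (gmult d (gmult d (col_sum \<alpha>) (gmult d x (row_sum \<beta>))) (col_sum \<beta>))"
  unfolding young_symmetrizer_eq[OF \<alpha>] young_symmetrizer_eq[OF \<beta>] by (simp only: gmult_assoc)

lemma young_sandwich_same:
  assumes \<alpha>: "\<alpha> \<in> partitions d"
  shows "\<exists>c. gmult d (young_symmetrizer \<alpha>) (gmult d x (young_symmetrizer \<alpha>)) = smul c (young_symmetrizer \<alpha>)"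
  unfolding young_sandwich[OF \<alpha> \<alpha>] by (rule row_col_multiple[OF \<alpha>])

lemma dominance_antisym:
  fixes \<alpha> \<beta> :: "nat \<Rightarrow> nat"
  assumes "\<And>i. sum \<alpha> {..<i} = sum \<beta> {..<i}"
  shows "\<alpha> = \<beta>"
proof
  fix i
  show "\<alpha> i = \<beta> i"
    using assms[of i] assms[of "Suc i"] by simp
qed

text \<open>A nonzero product makes \<beta> dominate \<alpha>. Its adjoint contains the product of
  the row sum of \<beta>, the adjoint of x and the column sum of \<alpha>, which gives the opposite
  dominance, so that \<alpha> = \<beta>.\<close>

lemma young_sandwich_diff:
  assumes \<alpha>: "\<alpha> \<in> partitions d" and \<beta>: "\<beta> \<in> partitions d" and ne: "\<alpha> \<noteq> \<beta>"
  shows "gmult d (young_symmetrizer \<alpha>) (gmult d x (young_symmetrizer \<beta>)) = 0"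
proof (rule ccontr)
  let ?y = "gmult d (young_symmetrizer \<alpha>) (gmult d x (young_symmetrizer \<beta>))"
  assume nz: "?y \<noteq> 0"
  have "sum \<alpha> {..<i} \<le> sum \<beta> {..<i}" for i
    using nz unfolding young_sandwich[OF \<alpha> \<beta>] by (rule row_col_neq_0_dominance[OF \<alpha> \<beta>])
  moreover
  have "gmult d (row_sum \<beta>) (gmult d (star d x) (col_sum \<alpha>)) \<noteq> 0"
  proof
    assume 0: "gmult d (row_sum \<beta>) (gmult d (star d x) (col_sum \<alpha>)) = 0"
    have "star d ?y = gmult d (col_sum \<beta>) (gmult d (gmult d (row_sum \<beta>) (gmult d (star d x) (col_sum \<alpha>))) (row_sum \<alpha>))"
      unfolding young_symmetrizer_eq[OF \<alpha>] young_symmetrizer_eq[OF \<beta>] star_gmult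
        star_row_sum[OF \<alpha>] star_row_sum[OF \<beta>] star_col_sum[OF \<alpha>] star_col_sum[OF \<beta>]
      by (simp only: gmult_assoc)
    then have "star d ?y = 0"
      by (simp only: 0 act_zero_left gmult_zero)
    moreover have "?y \<in> free_on (symgroup d)"
      by (intro gmult_free_on young_symmetrizer_free_on[OF \<beta>])
    ultimately have "?y = 0"
      by (metis star_star star_zero)
    with nz show False by contradiction
  qed
  then have "sum \<beta> {..<i} \<le> sum \<alpha> {..<i}" for i
    by (rule row_col_neq_0_dominance[OF \<beta> \<alpha>])
  ultimately have "\<alpha> = \<beta>"
    by (intro dominance_antisym antisym)
  with ne show False by contradiction
qed

text \<open>With \<open>a\<close> and \<open>b\<close> the row and column sums, \<open>a b a\<close> is self-adjoint and nonzero, hence so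
  is its square, which is a multiple of \<open>a b a b a\<close>.\<close>

lemma young_square_neq_0:
  assumes \<alpha>: "\<alpha> \<in> partitions d"
  shows "gmult d (young_symmetrizer \<alpha>) (young_symmetrizer \<alpha>) \<noteq> 0"
proof
  let ?a = "row_sum \<alpha>" and ?b = "col_sum \<alpha>" and ?Y = "young_symmetrizer \<alpha>"
  let ?R = "of_nat (card (row_group \<alpha>)) :: complex" and ?C = "of_nat (card (col_group \<alpha>)) :: complex"
  define u where "u = gmult d ?Y ?a"
  assume 0: "gmult d ?Y ?Y = 0"
  have sY: "star d ?Y = gmult d ?b ?a"
    by (simp add: young_symmetrizer_eq[OF \<alpha>] star_gmult star_row_sum[OF \<alpha>] star_col_sum[OF \<alpha>])
  have uG: "u \<in> free_on (symgroup d)"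
    unfolding u_def by (intro gmult_free_on row_sum_free_on[OF \<alpha>])
  have su: "star d u = u"
    by (simp add: u_def star_gmult star_row_sum[OF \<alpha>] sY) (simp add: young_symmetrizer_eq[OF \<alpha>] gmult_assoc)
  have "gmult d u u = gmult d ?Y (gmult d (gmult d ?a ?a) (gmult d ?b ?a))"
    by (simp add: u_def young_symmetrizer_eq[OF \<alpha>] gmult_assoc)
  also have "\<dots> = smul ?R (gmult d (gmult d ?Y ?Y) ?a)"
    by (simp add: row_sum_square[OF \<alpha>] gmult_smul_left gmult_smul)
      (simp add: young_symmetrizer_eq[OF \<alpha>] gmult_assoc)
  also have "\<dots> = 0"
    by (simp add: 0)
  finally have "u = 0"
    using gmult_self_adjoint_eq_0D su uG by blast
  \<comment> \<open>This is a b b a, and b b is a multiple of b, so it is a multiple of u = a b a;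
    hence u = 0 makes the norm of \<open>?Y\<close> vanish.\<close>
  have "gmult d ?Y (star d ?Y) = gmult d ?a (gmult d (gmult d ?b ?b) ?a)"
    by (simp add: sY) (simp add: young_symmetrizer_eq[OF \<alpha>] gmult_assoc)
  also have "\<dots> = smul ?C u"
    by (simp add: col_sum_square[OF \<alpha>] gmult_smul_left gmult_smul u_def young_symmetrizer_eq[OF \<alpha>] gmult_assoc)
  also have "\<dots> = 0"
    by (simp add: \<open>u = 0\<close>)
  finally show False
    using gmult_star_eq_0D young_symmetrizer_free_on[OF \<alpha>] young_neq_0[OF \<alpha>] by blast
qed

lemma young_square:
  assumes \<alpha>: "\<alpha> \<in> partitions d"
  obtains h where "h \<noteq> 0" "gmult d (young_symmetrizer \<alpha>) (young_symmetrizer \<alpha>) = smul h (young_symmetrizer \<alpha>)"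
proof -
  obtain h where "gmult d (young_symmetrizer \<alpha>) (gmult d (basis_vec id) (young_symmetrizer \<alpha>)) = smul h (young_symmetrizer \<alpha>)"
    using young_sandwich_same[OF \<alpha>] by blast
  then have h: "gmult d (young_symmetrizer \<alpha>) (young_symmetrizer \<alpha>) = smul h (young_symmetrizer \<alpha>)"
    by simp
  moreover have "h \<noteq> 0"
    using h young_square_neq_0[OF \<alpha>] by auto
  ultimately show ?thesis using that by blast
qed

text \<open>A nonzero multiple of the central idempotent that belongs to
  \<open>T\<^sub>\<alpha>\<close>.\<close>

definition young_central :: "nat \<Rightarrow> (nat \<Rightarrow> nat) \<Rightarrow> ((nat \<Rightarrow> nat) \<Rightarrow>\<^sub>0 complex)" where
  "young_central d \<alpha> = conj_sum d (young_symmetrizer \<alpha>)"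

lemma young_central_neq_0: "\<alpha> \<in> partitions d \<Longrightarrow> young_central d \<alpha> \<noteq> 0"
proof -
  assume \<alpha>: "\<alpha> \<in> partitions d"
  have "coef (young_central d \<alpha>) id = of_nat (card (symgroup d))"
    by (simp add: young_central_def coef_conj_sum_id young_symmetrizer_free_on[OF \<alpha>] coef_young_symmetrizer_id[OF \<alpha>])
  moreover have "card (symgroup d) \<noteq> 0"
    using symgroup_id by (auto simp: card_eq_0_iff)
  ultimately show ?thesis by force
qed

lemma young_central_self_adjoint:
  assumes \<alpha>: "\<alpha> \<in> partitions d"
  shows "star d (young_central d \<alpha>) = young_central d \<alpha>"
proof -
  have "star d (young_symmetrizer \<alpha>) = gmult d (col_sum \<alpha>) (row_sum \<alpha>)"
    by (simp add: young_symmetrizer_eq[OF \<alpha>] star_gmult star_row_sum[OF \<alpha>] star_col_sum[OF \<alpha>])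
  then show ?thesis
    unfolding young_central_def star_conj_sum
    by (simp add: young_symmetrizer_eq[OF \<alpha>] conj_sum_gmult_commute[OF col_sum_free_on[OF \<alpha>]])
qed

lemma young_central_square_neq_0:
  "\<alpha> \<in> partitions d \<Longrightarrow> gmult d (young_central d \<alpha>) (young_central d \<alpha>) \<noteq> 0"
  using gmult_self_adjoint_eq_0D[OF _ young_central_self_adjoint] young_central_neq_0
    conj_sum_free_on[of d "young_symmetrizer \<alpha>"]
  by (auto simp: young_central_def)

text \<open>Every term of the expanded product contains a factor
  \<open>c\<^sub>\<alpha> x c\<^sub>\<beta>\<close>.\<close>

lemma young_central_orthogonal:
  assumes "\<alpha> \<in> partitions d" "\<beta> \<in> partitions d" "\<alpha> \<noteq> \<beta>"
  shows "gmult d (young_central d \<alpha>) (young_central d \<beta>) = 0"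
proof -
  have "gmult d (gmult d (basis_vec g) (gmult d (young_symmetrizer \<alpha>) y))
      (gmult d (basis_vec k) (gmult d (young_symmetrizer \<beta>) z)) = 0" for g y k z
  proof -
    have "gmult d (gmult d (basis_vec g) (gmult d (young_symmetrizer \<alpha>) y))
        (gmult d (basis_vec k) (gmult d (young_symmetrizer \<beta>) z))
      = gmult d (basis_vec g) (gmult d (gmult d (young_symmetrizer \<alpha>)
          (gmult d (gmult d y (basis_vec k)) (young_symmetrizer \<beta>))) z)"
      by (simp only: gmult_assoc)
    then show ?thesis
      by (simp only: young_sandwich_diff[OF assms] act_zero_left gmult_zero)
  qed
  then show ?thesis
    by (simp add: young_central_def conj_sum_def act_sum_left gmult_sum)
qed

text \<open>With z central, a b z = a z b, which is a multiple \<kappa> of a b. Averaging over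
  conjugates gives z z = \<kappa> z, and z z is not 0.\<close>

lemma young_central_scalar:
  assumes \<alpha>: "\<alpha> \<in> partitions d"
  obtains \<kappa> where "\<kappa> \<noteq> 0"
    "gmult d (young_symmetrizer \<alpha>) (young_central d \<alpha>) = smul \<kappa> (young_symmetrizer \<alpha>)"
proof -
  let ?Y = "young_symmetrizer \<alpha>" and ?z = "young_central d \<alpha>"
  have "gmult d ?Y ?z = gmult d (row_sum \<alpha>) (gmult d ?z (col_sum \<alpha>))"
    using conj_sum_central[OF col_sum_free_on[OF \<alpha>]]
    by (simp add: young_central_def young_symmetrizer_eq[OF \<alpha>] gmult_assoc)
  then obtain \<kappa> where \<kappa>: "gmult d ?Y ?z = smul \<kappa> ?Y"
    using row_col_multiple[OF \<alpha>] by metis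
  have "gmult d ?z ?z
      = (\<Sum>g\<in>symgroup d. gmult d (basis_vec g) (gmult d ?Y (gmult d (basis_vec (inv g)) ?z)))"
    by (subst (1) young_central_def) (simp add: conj_sum_def act_sum_left gmult_assoc)
  also have "\<dots> = (\<Sum>g\<in>symgroup d. gmult d (basis_vec g) (gmult d (gmult d ?Y ?z) (basis_vec (inv g))))"
    by (intro sum.cong refl) (simp add: young_central_def conj_sum_central_basis gmult_assoc)
  also have "\<dots> = smul \<kappa> ?z"
    unfolding \<kappa>
    by (simp add: young_central_def conj_sum_def gmult_smul_left gmult_smul free_vs.scale_sum_right)
  finally have "\<kappa> \<noteq> 0"
    using young_central_square_neq_0[OF \<alpha>] by auto
  with \<kappa> show ?thesis using that by blast
qed

section \<open>Conjugacy classes and completeness\<close>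

text \<open>A cycle is a list that p shifts by one place. Fixed points occur as lists of length one,
  so that the lengths form a partition of d.\<close>

definition cycles_of :: "nat \<Rightarrow> (nat \<Rightarrow> nat) \<Rightarrow> nat list list \<Rightarrow> bool" where
  "cycles_of d p css \<longleftrightarrow> distinct (concat css) \<and> set (concat css) = {..<d} \<and>
     (\<forall>c\<in>set css. c \<noteq> [] \<and> map p c = rotate1 c)"

text \<open>The clause on points outside S serves the induction: a new cycle is disjoint from the
  old support and has to be fixed pointwise by p.\<close>

lemma cycle_decomp_lists:
  assumes "cycle_decomp S p"
  shows "(\<forall>x. x \<notin> S \<longrightarrow> p x = x) \<and> (\<exists>css. distinct (concat css) \<and> set (concat css) = S \<and>
     (\<forall>c\<in>set css. c \<noteq> [] \<and> map p c = rotate1 c))"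
  using assms
proof induction
  case empty
  show ?case by (auto intro: exI[of _ "[]"])
next
  case (comp I p cs)
  then obtain css where css: "distinct (concat css)" "set (concat css) = I"
      "\<And>c. c \<in> set css \<Longrightarrow> c \<noteq> [] \<and> map p c = rotate1 c"
    and p: "\<And>x. x \<notin> I \<Longrightarrow> p x = x"
    by blast
  have outside: "cycle_of_list cs x = x" if "x \<notin> set cs" for x
    using that by (rule id_outside_supp)
  have old: "c \<noteq> [] \<and> map (cycle_of_list cs \<circ> p) c = rotate1 c" if c: "c \<in> set css" for c
  proof -
    have "set c \<subseteq> I" using c css(2) by auto
    then have "map (cycle_of_list cs) (rotate1 c) = rotate1 c"
      using comp.hyps(3) by (intro map_idI outside) auto
    then show ?thesis
      using css(3)[OF c] by (metis map_map)
  qed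
  have new: "map (cycle_of_list cs \<circ> p) cs = rotate1 cs"
  proof -
    have "map p cs = cs"
      using comp.hyps(3) by (intro map_idI p) auto
    moreover have "map (cycle_of_list cs) cs = rotate1 cs"
      using cyclic_rotation[OF comp.hyps(2), of 1] by (simp add: rotate_def)
    ultimately show ?thesis
      by (simp only: map_map[symmetric])
  qed
  have "\<exists>css. distinct (concat css) \<and> set (concat css) = set cs \<union> I \<and>
     (\<forall>c\<in>set css. c \<noteq> [] \<and> map (cycle_of_list cs \<circ> p) c = rotate1 c)"
  \<comment> \<open>The inductive predicate also admits an empty cycle, which must not enter the
    list.\<close>
  proof (cases "cs = []")
    case True
    then show ?thesis using css old by (intro exI[of _ css]) auto
  next
    case False
    then show ?thesis using css old new comp.hyps by (intro exI[of _ "cs # css"]) auto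
  qed
  moreover have "(cycle_of_list cs \<circ> p) x = x" if "x \<notin> set cs \<union> I" for x
    using that p outside by simp
  ultimately show ?case by (intro conjI allI impI)
qed

lemma cycles_of_exists:
  assumes "p \<in> symgroup d"
  obtains css where "cycles_of d p css" "sorted_wrt (\<ge>) (map length css)"
proof -
  have "cycle_decomp {..<d} p"
    using assms by (intro cycle_decomposition) (auto simp: symgroup_def)
  from conjunct2[OF cycle_decomp_lists[OF this]]
  obtain css where "distinct (concat css) \<and> set (concat css) = {..<d} \<and>
     (\<forall>c\<in>set css. c \<noteq> [] \<and> map p c = rotate1 c)" ..
  then have css: "distinct (concat css)" "set (concat css) = {..<d}"
     "\<And>c. c \<in> set css \<Longrightarrow> c \<noteq> [] \<and> map p c = rotate1 c"
    by simp_all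
  define css' where "css' = rev (sort_key length css)"
  have set: "set css' = set css"
    by (simp add: css'_def)
  have "[] \<notin> set css" using css(3) by blast
  then have "distinct css"
    using css(1) by (simp add: distinct_concat_iff)
  then have "distinct css'"
    by (simp add: css'_def)
  then have "distinct (concat css')"
    using css(1) \<open>[] \<notin> set css\<close> by (simp add: distinct_concat_iff set)
  moreover have "set (concat css') = {..<d}"
    using css(2) by (simp add: set)
  ultimately have "cycles_of d p css'"
    using css(3) by (simp add: cycles_of_def set)
  moreover have "sorted_wrt (\<ge>) (rev (map length (sort_key length css)))"
    by (simp add: sorted_wrt_rev)
  then have "sorted_wrt (\<ge>) (map length css')"
    by (simp only: css'_def rev_map)
  ultimately show ?thesis by (rule that)
qed

lemma list_symgroup:
  assumes "distinct xs" "set xs = {..<d}"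
  obtains X where "X \<in> symgroup d" "map X [0..<d] = xs"
proof -
  have len: "length xs = d"
    using distinct_card[OF assms(1)] assms(2) by simp
  define X where "X i = (if i < d then xs ! i else i)" for i
  have "bij_betw ((!) xs) {..<d} {..<d}"
    using bij_betw_nth[OF assms(1) refl refl] unfolding len assms(2) .
  then have "bij_betw X {..<d} {..<d}"
    by (rule bij_betw_cong[THEN iffD2, rotated]) (simp add: X_def)
  then have "X permutes {..<d}"
    by (rule bij_imp_permutes) (simp add: X_def)
  moreover have "map X [0..<d] = xs"
    using len by (intro nth_equalityI) (auto simp: X_def)
  ultimately show ?thesis
    using that by (simp add: symgroup_def)
qed

text \<open>Write the two lists of cycles below each other and let k map every entry to the one
  below it; equal lengths make k respect the borders between cycles.\<close>

lemma same_cycle_lengths_conjugate: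
  assumes "p \<in> symgroup d" "p' \<in> symgroup d" "cycles_of d p css" "cycles_of d p' css'"
    and len: "map length css = map length css'"
  obtains k where "k \<in> symgroup d" "k \<circ> p = p' \<circ> k"
proof -
  obtain X where X: "X \<in> symgroup d" "map X [0..<d] = concat css"
    using list_symgroup assms(3) by (metis cycles_of_def)
  obtain X' where X': "X' \<in> symgroup d" "map X' [0..<d] = concat css'"
    using list_symgroup assms(4) by (metis cycles_of_def)
  define k where "k = X' \<circ> inv X"
  have k: "k \<in> symgroup d"
    using X X' by (simp add: k_def)
  have "map k (concat css) = concat css'"
    unfolding X(2)[symmetric] X'(2)[symmetric] using X(1) by (simp add: k_def)
  then have "concat (map (map k) css) = concat css'"
    by (simp add: map_concat)
  moreover have len': "length css = length css'"
    using len by (metis length_map)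
  moreover have "\<forall>(x, y) \<in> set (zip (map (map k) css) css'). length x = length y"
  proof -
    have "length (css ! i) = length (css' ! i)" if "i < length css" for i
      using arg_cong[OF len, of "\<lambda>l. l ! i"] that len' by simp
    then show ?thesis by (auto simp: set_zip)
  qed
  ultimately have css': "map (map k) css = css'"
    by (intro concat_injective) auto
  have "(k \<circ> p) x = (p' \<circ> k) x" for x
  proof (cases "x < d")
    case True
    then obtain c where c: "c \<in> set css" "x \<in> set c"
      using assms(3) by (auto simp: cycles_of_def)
    then have "map k c \<in> set css'"
      using css' by auto
    then have "map p' (map k c) = rotate1 (map k c)"
      using assms(4) unfolding cycles_of_def by blast
    also have "\<dots> = map k (rotate1 c)"
      by (rule rotate1_map)
    also have "\<dots> = map k (map p c)"
      using assms(3) c by (simp add: cycles_of_def)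
    finally show ?thesis
      using c(2) by simp
  next
    case False
    then show ?thesis
      using assms(1,2) k by (simp add: symgroup_def permutes_def)
  qed
  then have "k \<circ> p = p' \<circ> k" by (rule ext)
  with k show ?thesis by (rule that)
qed

section \<open>Cycle types and conjugacy classes\<close>

definition part_of :: "nat list \<Rightarrow> nat \<Rightarrow> nat" where
  "part_of L i = (if i < length L then L ! i else 0)"

lemma part_of_support:
  assumes "0 \<notin> set L"
  shows "{i. part_of L i \<noteq> 0} = {..<length L}"
proof -
  have "L ! i \<noteq> 0" if "i < length L" for i
    using nth_mem[OF that] assms by metis
  then show ?thesis
    by (auto simp: part_of_def)
qed

lemma part_of_partitions:
  assumes "0 \<notin> set L" "sorted_wrt (\<ge>) L"
  shows "part_of L \<in> partitions (sum_list L)"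
proof -
  have "antimono (part_of L)"
  proof (rule antimonoI)
    fix i j :: nat assume "i \<le> j"
    then show "part_of L j \<le> part_of L i"
      using assms(2) by (cases "i = j") (auto simp: part_of_def sorted_wrt_iff_nth_less)
  qed
  moreover have "partition_size (part_of L) = sum_list L"
    unfolding partition_size_def part_of_support[OF assms(1)]
    by (simp add: sum_list_sum_nth part_of_def atLeast0LessThan)
  moreover have "finite {i. part_of L i \<noteq> 0}"
    by (simp only: part_of_support[OF assms(1)] finite_lessThan)
  ultimately show ?thesis
    by (simp add: partitions_def)
qed

lemma part_of_inject:
  assumes "0 \<notin> set L" "0 \<notin> set L'" "part_of L = part_of L'"
  shows "L = L'"
proof (rule nth_equalityI)
  have "{..<length L} = {..<length L'}"
    unfolding part_of_support[OF assms(1), symmetric] part_of_support[OF assms(2), symmetric] assms(3) ..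
  then show len: "length L = length L'" by simp
  show "L ! i = L' ! i" if "i < length L" for i
    using fun_cong[OF assms(3), of i] that len by (simp add: part_of_def)
qed

definition conj_class :: "nat \<Rightarrow> (nat \<Rightarrow> nat) \<Rightarrow> (nat \<Rightarrow> nat) set" where
  "conj_class d g = (\<lambda>k. k \<circ> g \<circ> inv k) ` symgroup d"

lemma conj_class_self: "g \<in> conj_class d g"
  unfolding conj_class_def by (rule image_eqI[of _ _ id]) simp_all

lemma conj_class_mono:
  assumes "k \<in> symgroup d" "g \<in> symgroup d"
  shows "conj_class d (k \<circ> g \<circ> inv k) \<subseteq> conj_class d g"
proof
  fix x assume "x \<in> conj_class d (k \<circ> g \<circ> inv k)"
  then obtain l where l: "l \<in> symgroup d" "x = l \<circ> (k \<circ> g \<circ> inv k) \<circ> inv l"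
    by (auto simp: conj_class_def)
  then have "x = (l \<circ> k) \<circ> g \<circ> inv (l \<circ> k)"
    using assms by (simp add: symgroup_inv_comp[of _ d] comp_assoc)
  then show "x \<in> conj_class d g"
    unfolding conj_class_def using l(1) assms(1) by (intro image_eqI[of _ _ "l \<circ> k"]) auto
qed

lemma conj_class_conj:
  assumes "k \<in> symgroup d" "g \<in> symgroup d"
  shows "conj_class d (k \<circ> g \<circ> inv k) = conj_class d g"
proof
  have "inv k \<circ> (k \<circ> g \<circ> inv k) \<circ> inv (inv k) = g"
    using assms by (simp add: comp_assoc)
  then show "conj_class d g \<subseteq> conj_class d (k \<circ> g \<circ> inv k)"
    using conj_class_mono[of "inv k" d "k \<circ> g \<circ> inv k"] assms by simp
qed (rule conj_class_mono[OF assms])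

text \<open>Permutations of the same cycle type are conjugate, so mapping a partition to the class
  of a permutation of that type reaches every class.\<close>

lemma card_conj_classes: "card (conj_class d ` symgroup d) \<le> card (partitions d)"
proof -
  have "\<exists>\<alpha>. \<alpha> \<in> partitions d \<and> (\<exists>css. cycles_of d g css \<and> \<alpha> = part_of (map length css))"
    if g: "g \<in> symgroup d" for g
  proof -
    obtain css where css: "cycles_of d g css" "sorted_wrt (\<ge>) (map length css)"
      using cycles_of_exists[OF g] .
    have "sum_list (map length css) = length (concat css)"
      by (simp add: length_concat)
    also have "\<dots> = d"
      using css(1) distinct_card[of "concat css"] by (simp add: cycles_of_def)
    finally have "sum_list (map length css) = d" .
    moreover have "0 \<notin> set (map length css)"
      using css(1) by (auto simp: cycles_of_def)
    ultimately show ?thesis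
      using part_of_partitions css by metis
  qed
  then obtain t where t: "\<And>g. g \<in> symgroup d \<Longrightarrow> t g \<in> partitions d \<and>
      (\<exists>css. cycles_of d g css \<and> t g = part_of (map length css))"
    by metis
  have same: "conj_class d g = conj_class d g'"
    if g: "g \<in> symgroup d" "g' \<in> symgroup d" "t g = t g'" for g g'
  proof -
    obtain css css' where css: "cycles_of d g css" "cycles_of d g' css'"
        "part_of (map length css) = part_of (map length css')"
      using t[OF g(1)] t[OF g(2)] g(3) by metis
    then have "map length css = map length css'"
      by (intro part_of_inject) (auto simp: cycles_of_def)
    then obtain k where k: "k \<in> symgroup d" "k \<circ> g = g' \<circ> k"
      using same_cycle_lengths_conjugate[OF g(1,2) css(1,2)] by metis
    then have "k \<circ> g \<circ> inv k = g'" by simp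
    then show ?thesis using conj_class_conj[OF k(1) g(1)] by simp
  qed
  \<comment> \<open>A representative exists for the partitions of the form \<open>t g\<close>, and
    these already account for every class.\<close>
  define F where "F \<alpha> = conj_class d (SOME g. g \<in> symgroup d \<and> t g = \<alpha>)" for \<alpha>
  have "F (t g) = conj_class d g" if g: "g \<in> symgroup d" for g
  proof -
    have "(SOME g'. g' \<in> symgroup d \<and> t g' = t g) \<in> symgroup d \<and> t (SOME g'. g' \<in> symgroup d \<and> t g' = t g) = t g"
      by (rule someI[of _ g]) (simp add: g)
    then show ?thesis unfolding F_def using same g by metis
  qed
  then have "conj_class d ` symgroup d \<subseteq> F ` partitions d"
    using t by (metis image_subsetI imageI)
  then have "card (conj_class d ` symgroup d) \<le> card (F ` partitions d)"
    by (intro card_mono finite_imageI finite_partitions)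
  also have "\<dots> \<le> card (partitions d)"
    by (rule card_image_le[OF finite_partitions])
  finally show ?thesis .
qed

lemma class_function_span:
  assumes x: "x \<in> free_on (symgroup d)"
    and inv: "\<And>k g. k \<in> symgroup d \<Longrightarrow> g \<in> symgroup d \<Longrightarrow> coef x (k \<circ> g \<circ> inv k) = coef x g"
  shows "x \<in> free_vs.span ((\<lambda>K. of_fun K (\<lambda>_. 1)) ` conj_class d ` symgroup d)"
proof -
  let ?C = "conj_class d ` symgroup d"
  define v where "v K = coef x (SOME g. g \<in> K)" for K
  have fin: "finite K" if "K \<in> ?C" for K
    using that by (auto simp: conj_class_def)
  have v: "v K = coef x g" if K: "K \<in> ?C" and gK: "g \<in> K" for K g
  proof -
    obtain g0 where g0: "K = conj_class d g0" "g0 \<in> symgroup d"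
      using K by (rule imageE)
    have "coef x g' = coef x g0" if g': "g' \<in> K" for g'
    proof -
      obtain k where k: "g' = k \<circ> g0 \<circ> inv k" "k \<in> symgroup d"
        using g' unfolding g0(1) conj_class_def by (rule imageE)
      show ?thesis unfolding k(1) by (rule inv[OF k(2) g0(2)])
    qed
    moreover have "(SOME g. g \<in> K) \<in> K" by (rule someI[of "\<lambda>g. g \<in> K"], rule gK)
    ultimately show ?thesis
      using gK by (simp only: v_def)
  qed
  have "x = (\<Sum>K\<in>?C. smul (v K) (of_fun K (\<lambda>_. 1)))"
  proof (rule poly_mapping_eqI)
    fix g
    have "coef (\<Sum>K\<in>?C. smul (v K) (of_fun K (\<lambda>_. 1))) g = (\<Sum>K\<in>?C. if K = conj_class d g then coef x g else 0)"
      unfolding coef_sum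
    proof (intro sum.cong refl)
      fix K assume K: "K \<in> ?C"
      have "g \<in> K \<longleftrightarrow> K = conj_class d g"
      proof
        assume "g \<in> K"
        then obtain g0 k where "g0 \<in> symgroup d" "k \<in> symgroup d" "K = conj_class d g0" "g = k \<circ> g0 \<circ> inv k"
          using K unfolding conj_class_def by (metis (no_types, lifting) imageE)
        then show "K = conj_class d g"
          using conj_class_conj by metis
      qed (simp only: conj_class_self)
      then show "coef (smul (v K) (of_fun K (\<lambda>_. 1))) g = (if K = conj_class d g then coef x g else 0)"
        using fin[OF K] v[OF K] by auto
    qed
    also have "\<dots> = coef x g"
    proof (cases "g \<in> symgroup d")
      case False
      then show ?thesis using x by (simp add: in_free_on_iff)
    qed simp
    finally show "coef x g = coef (\<Sum>K\<in>?C. smul (v K) (of_fun K (\<lambda>_. 1))) g" by simp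
  qed
  also have "\<dots> \<in> free_vs.span ((\<lambda>K. of_fun K (\<lambda>_. 1)) ` ?C)"
    by (intro free_vs.span_sum free_vs.span_scale free_vs.span_base imageI)
  finally show ?thesis .
qed

lemma coef_conj_sum_conj:
  assumes k: "k \<in> symgroup d" and g: "g \<in> symgroup d"
  shows "coef (conj_sum d x) (k \<circ> g \<circ> inv k) = coef (conj_sum d x) g"
proof -
  let ?z = "conj_sum d x"
  have "coef ?z g = coef (gmult d (basis_vec k) ?z) (k \<circ> g)"
    using k by (simp add: act_basis coef_left_action)
  also have "\<dots> = coef (gmult d ?z (basis_vec k)) (k \<circ> g)"
    by (simp only: conj_sum_central_basis[OF k])
  also have "\<dots> = (\<Sum>h\<in>symgroup d. if h = k then coef ?z (k \<circ> g \<circ> inv h) else 0)"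
    unfolding coef_gmult'[OF symgroup_comp[OF k g]]
    by (intro sum.cong) (auto simp: lookup_single when_def)
  also have "\<dots> = coef ?z (k \<circ> g \<circ> inv k)"
    using k by simp
  finally show ?thesis by simp
qed

text \<open>The central elements of the Young symmetrizers are orthogonal and as many as there are
  conjugacy classes, hence a basis of the centre. This is the completeness of the \<open>T\<^sub>\<alpha>\<close>.\<close>

theorem one_eq_sum_young_central:
  obtains a where "basis_vec id = (\<Sum>\<alpha>\<in>partitions d. smul (a \<alpha>) (young_central d \<alpha>))"
proof -
  let ?z = "young_central d" and ?P = "partitions d"
  let ?E = "(\<lambda>K. of_fun K (\<lambda>_. 1 :: complex)) ` conj_class d ` symgroup d"
  have inj: "inj_on ?z ?P"
    by (rule inj_onI) (metis young_central_orthogonal young_central_square_neq_0)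
  have indep: "free_vs.independent (?z ` ?P)"
  proof (rule free_vs.independent_if_scalars_zero)
    show "finite (?z ` ?P)" by (simp add: finite_partitions)
    fix f x assume 0: "(\<Sum>x\<in>?z ` ?P. smul (f x) x) = 0" and "x \<in> ?z ` ?P"
    then obtain \<beta> where \<beta>: "\<beta> \<in> ?P" "x = ?z \<beta>" by blast
    have "(\<Sum>\<alpha>\<in>?P. smul (f (?z \<alpha>)) (?z \<alpha>)) = 0"
      using 0 by (simp add: sum.reindex[OF inj])
    then have "gmult d (?z \<beta>) (\<Sum>\<alpha>\<in>?P. smul (f (?z \<alpha>)) (?z \<alpha>)) = 0"
      by (simp only: gmult_zero)
    moreover have "gmult d (?z \<beta>) (\<Sum>\<alpha>\<in>?P. smul (f (?z \<alpha>)) (?z \<alpha>))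
        = (\<Sum>\<alpha>\<in>?P. if \<alpha> = \<beta> then smul (f (?z \<beta>)) (gmult d (?z \<beta>) (?z \<beta>)) else 0)"
      using young_central_orthogonal[OF \<beta>(1)]
      unfolding gmult_sum by (intro sum.cong refl) (auto simp: gmult_smul)
    ultimately have "smul (f (?z \<beta>)) (gmult d (?z \<beta>) (?z \<beta>)) = 0"
      using \<beta>(1) by (simp add: finite_partitions)
    then show "f x = 0"
      using young_central_square_neq_0[OF \<beta>(1)] \<beta>(2) by simp
  qed
  have in_E: "?z \<alpha> \<in> free_vs.span ?E" for \<alpha>
    unfolding young_central_def
    by (rule class_function_span) (simp_all add: conj_sum_free_on coef_conj_sum_conj)
  have "coef (basis_vec id) (k \<circ> g \<circ> inv k) = coef (basis_vec id) g"
    if "k \<in> symgroup d" "g \<in> symgroup d" for k g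
  proof -
    have "k \<circ> g \<circ> inv k = id \<longleftrightarrow> g = id"
    proof
      assume "k \<circ> g \<circ> inv k = id"
      then have "inv k \<circ> (k \<circ> g \<circ> inv k) \<circ> k = id"
        using that by simp
      then show "g = id" using that by (simp add: comp_assoc)
    qed (use that in simp)
    then show ?thesis by (auto simp: lookup_single when_def)
  qed
  then have one_E: "basis_vec id \<in> free_vs.span ?E"
    by (intro class_function_span) auto
  have "basis_vec id \<in> free_vs.span (?z ` ?P)"
  proof (rule ccontr)
    \<comment> \<open>Together with the unit there would be more independent class functions than
      partitions, hence more than conjugacy classes.\<close>
    assume no: "\<not> ?thesis"
    then have "free_vs.independent (insert (basis_vec id) (?z ` ?P))"
      using indep by (simp add: free_vs.independent_insert)
    then have "card (insert (basis_vec id) (?z ` ?P)) \<le> card ?E"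
      using in_E one_E by (intro conjunct2[OF free_vs.independent_span_bound]) auto
    also have "\<dots> \<le> card (conj_class d ` symgroup d)"
      by (rule card_image_le) simp
    also have "\<dots> \<le> card ?P"
      by (rule card_conj_classes)
    finally have "card (insert (basis_vec id) (?z ` ?P)) \<le> card ?P" .
    moreover have "basis_vec id \<notin> ?z ` ?P"
      using no by (rule contrapos_nn) (rule free_vs.span_base)
    ultimately show False
      by (simp add: finite_partitions card_image[OF inj])
  qed
  then obtain u where "basis_vec id = (\<Sum>v\<in>?z ` ?P. smul (u v) v)"
    unfolding free_vs.span_finite[OF finite_imageI[OF finite_partitions]] by (rule rangeE)
  also have "\<dots> = (\<Sum>\<alpha>\<in>?P. smul (u (?z \<alpha>)) (?z \<alpha>))"
    by (simp add: sum.reindex[OF inj])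
  finally show ?thesis by (rule that)
qed

section \<open>Multiplicities of Specht modules\<close>

lemma independent_sum_eq_0D:
  assumes ind: "free_vs.independent B" and I: "finite I" "inj_on m I" "m ` I \<subseteq> B"
    and sum: "(\<Sum>i\<in>I. smul (c i) (m i)) = 0" and i: "i \<in> I"
  shows "c i = 0"
proof -
  let ?u = "\<lambda>x. c (the_inv_into I m x)"
  have "(\<Sum>x\<in>m ` I. smul (?u x) x) = 0"
    using sum by (simp add: sum.reindex[OF I(2)] the_inv_into_f_f[OF I(2)])
  moreover have "free_vs.independent (m ` I)"
    using free_vs.independent_mono[OF ind I(3)] .
  ultimately have "?u (m i) = 0"
    using I(1) i unfolding free_vs.independent_explicit_finite_subsets
    by (elim allE[of _ "m ` I"] impE[OF _ subset_refl] impE[OF _ finite_imageI] allE[of _ ?u]) blast+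
  then show ?thesis
    using i by (simp add: the_inv_into_f_f[OF I(2)])
qed

lemma independentI_inj:
  assumes I: "finite I" "inj_on m I"
    and zero: "\<And>c i. (\<Sum>i\<in>I. smul (c i) (m i)) = 0 \<Longrightarrow> i \<in> I \<Longrightarrow> c i = 0"
  shows "free_vs.independent (m ` I)"
proof (rule free_vs.independent_if_scalars_zero)
  show "finite (m ` I)" using I(1) by simp
  fix f x assume sum: "(\<Sum>x\<in>m ` I. smul (f x) x) = 0" and "x \<in> m ` I"
  then obtain i where i: "i \<in> I" "x = m i" by blast
  have "(\<Sum>i\<in>I. smul (f (m i)) (m i)) = 0"
    using sum by (simp add: sum.reindex[OF I(2)])
  from zero[OF this i(1)] show "f x = 0" by (simp add: i(2))
qed

lemma independent_free_on_finite:
  assumes "free_vs.independent B" "B \<subseteq> free_on S" "finite S"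
  shows "finite B"
proof -
  have "free_on S \<subseteq> free_vs.span (basis_vec ` S)"
  proof
    fix x assume "x \<in> free_on S"
    then have "x = (\<Sum>a\<in>S. smul (coef x a) (basis_vec a))"
      by (rule free_on_eq_sum[OF assms(3)])
    also have "\<dots> \<in> free_vs.span (basis_vec ` S)"
      by (intro free_vs.span_sum free_vs.span_scale free_vs.span_base imageI)
    finally show "x \<in> free_vs.span (basis_vec ` S)" .
  qed
  then have "B \<subseteq> free_vs.span (basis_vec ` S)"
    using assms(2) by (rule order_trans[rotated])
  from free_vs.independent_span_bound[OF _ assms(1) this] assms(3)
  show ?thesis by simp
qed

text \<open>Classically d! divided by the dimension of \<open>T\<^sub>\<alpha>\<close>.\<close>

definition young_scalar :: "nat \<Rightarrow> (nat \<Rightarrow> nat) \<Rightarrow> complex" where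
  "young_scalar d \<alpha> = (SOME h. h \<noteq> 0 \<and>
     gmult d (young_symmetrizer \<alpha>) (young_symmetrizer \<alpha>) = smul h (young_symmetrizer \<alpha>))"

text \<open>A multiple of a matrix coefficient of \<open>T\<^sub>\<alpha>\<close>; it governs how
  \<open>c\<^sub>\<alpha>\<close> acts on translates of its own eigenvectors
  (\<open>young_act_cyclic_same\<close>).\<close>

definition young_form :: "nat \<Rightarrow> (nat \<Rightarrow> nat) \<Rightarrow> ((nat \<Rightarrow> nat) \<Rightarrow>\<^sub>0 complex) \<Rightarrow> complex" where
  "young_form d \<alpha> x = (SOME c.
     gmult d (young_symmetrizer \<alpha>) (gmult d x (young_symmetrizer \<alpha>)) = smul c (young_symmetrizer \<alpha>))"

lemma young_scalar:
  assumes "\<alpha> \<in> partitions d"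
  shows young_scalar_neq_0: "young_scalar d \<alpha> \<noteq> 0"
    and young_scalar_eq: "gmult d (young_symmetrizer \<alpha>) (young_symmetrizer \<alpha>)
      = smul (young_scalar d \<alpha>) (young_symmetrizer \<alpha>)"
proof -
  have "\<exists>h. h \<noteq> 0 \<and> gmult d (young_symmetrizer \<alpha>) (young_symmetrizer \<alpha>) = smul h (young_symmetrizer \<alpha>)"
    using young_square[OF assms] by metis
  note * = someI_ex[OF this, folded young_scalar_def]
  from * show "young_scalar d \<alpha> \<noteq> 0"
    "gmult d (young_symmetrizer \<alpha>) (young_symmetrizer \<alpha>) = smul (young_scalar d \<alpha>) (young_symmetrizer \<alpha>)"
    by (rule conjunct1, rule conjunct2)
qed

lemma young_form_eq:
  assumes "\<alpha> \<in> partitions d"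
  shows "gmult d (young_symmetrizer \<alpha>) (gmult d x (young_symmetrizer \<alpha>)) = smul (young_form d \<alpha> x) (young_symmetrizer \<alpha>)"
  unfolding young_form_def by (rule someI_ex[OF young_sandwich_same[OF assms]])

text \<open>The range may run over all x because \<open>gmult\<close> sees only the coefficients of
  x on the symmetric group.\<close>

lemma irrep_eq:
  assumes "\<alpha> \<in> partitions d"
  shows "irrep \<alpha> = range (\<lambda>x. gmult d x (young_symmetrizer \<alpha>))"
proof -
  have eq: "group_algebra_mult x y = gmult d x y" if "x \<in> free_on (symgroup d)" for x y
    using that unfolding group_algebra_mult_def act_def left_action_def
    by (intro lin_ext_eq_sum) (auto simp: free_on_def)
  show ?thesis
  proof
    show "irrep \<alpha> \<subseteq> range (\<lambda>x. gmult d x (young_symmetrizer \<alpha>))"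
      unfolding irrep_def partition_size_partitions[OF assms] by (auto simp: eq)
    show "range (\<lambda>x. gmult d x (young_symmetrizer \<alpha>)) \<subseteq> irrep \<alpha>"
    proof clarify
      fix x
      let ?x = "of_fun (symgroup d) (coef x)"
      have "gmult d x (young_symmetrizer \<alpha>) = gmult d ?x (young_symmetrizer \<alpha>)"
        by (intro act_cong) simp
      then show "gmult d x (young_symmetrizer \<alpha>) \<in> irrep \<alpha>"
        unfolding irrep_def partition_size_partitions[OF assms] by (simp add: eq)
    qed
  qed
qed

lemma irrep_young_mem:
  assumes "\<alpha> \<in> partitions d" shows "young_symmetrizer \<alpha> \<in> irrep \<alpha>"
  unfolding irrep_eq[OF assms] using sym_rep.cyclic_mem[OF sym_rep_left_action] .

lemma irrep_free_on:
  assumes "\<alpha> \<in> partitions d" shows "irrep \<alpha> \<subseteq> free_on (symgroup d)"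
  unfolding irrep_eq[OF assms]
  by (auto intro: gmult_free_on young_symmetrizer_free_on[OF assms])

lemma subspace_irrep:
  assumes "\<alpha> \<in> partitions d" shows "free_vs.subspace (irrep \<alpha>)"
  unfolding irrep_eq[OF assms]
  by (rule free_pair.linear_subspace_image[OF lin_act_left free_vs.subspace_UNIV])

context sym_rep
begin

abbreviation young_act :: "(nat \<Rightarrow> nat) \<Rightarrow> ('a \<Rightarrow>\<^sub>0 complex) \<Rightarrow> ('a \<Rightarrow>\<^sub>0 complex)" where
  "young_act \<alpha> \<equiv> act d \<rho> (young_symmetrizer \<alpha>)"

abbreviation cyclic :: "('a \<Rightarrow>\<^sub>0 complex) \<Rightarrow> ('a \<Rightarrow>\<^sub>0 complex) set" where
  "cyclic m \<equiv> range (\<lambda>x. act d \<rho> x m)"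

text \<open>For a partition of d these vectors form the image of \<open>c\<^sub>\<alpha>\<close>,
  because \<open>c\<^sub>\<alpha>\<close> divided by its scalar is idempotent
  (\<open>young_act_image\<close>). Every nonzero one generates a copy of
  \<open>T\<^sub>\<alpha>\<close>.\<close>

definition young_eigen :: "(nat \<Rightarrow> nat) \<Rightarrow> ('a \<Rightarrow>\<^sub>0 complex) \<Rightarrow> bool" where
  "young_eigen \<alpha> m \<longleftrightarrow> young_act \<alpha> m = smul (young_scalar d \<alpha>) m"

lemma young_eigen_young_act: "\<alpha> \<in> partitions d \<Longrightarrow> young_eigen \<alpha> (young_act \<alpha> m)"
  by (simp add: young_eigen_def act_assoc young_scalar_eq act_smul_left)

lemma young_eigen_eq:
  assumes "\<alpha> \<in> partitions d" "young_eigen \<alpha> m"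
  shows "m = smul (inverse (young_scalar d \<alpha>)) (young_act \<alpha> m)"
  using assms(2) young_scalar_neq_0[OF assms(1)] by (simp add: young_eigen_def)

text \<open>Since m is a multiple of \<open>c\<^sub>\<alpha> m\<close>, the sandwich
  \<open>c\<^sub>\<alpha> x c\<^sub>\<alpha>\<close> appears. For two different partitions the same
  substitution gives 0.\<close>

lemma young_act_cyclic_same:
  assumes \<alpha>: "\<alpha> \<in> partitions d" and m: "young_eigen \<alpha> m"
  shows "young_act \<alpha> (act d \<rho> x m) = smul (young_form d \<alpha> x) m"
proof -
  have "young_act \<alpha> (act d \<rho> x m)
      = smul (inverse (young_scalar d \<alpha>)) (young_act \<alpha> (act d \<rho> x (young_act \<alpha> m)))"
    by (subst (1) young_eigen_eq[OF \<alpha> m]) (simp only: act_smul)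
  also have "young_act \<alpha> (act d \<rho> x (young_act \<alpha> m)) = smul (young_form d \<alpha> x) (young_act \<alpha> m)"
    by (simp add: act_assoc young_form_eq[OF \<alpha>] gmult_assoc act_smul_left)
  also have "smul (inverse (young_scalar d \<alpha>)) (smul (young_form d \<alpha> x) (young_act \<alpha> m))
      = smul (young_form d \<alpha> x) (smul (inverse (young_scalar d \<alpha>)) (young_act \<alpha> m))"
    by (rule free_vs.scale_left_commute)
  also have "\<dots> = smul (young_form d \<alpha> x) m"
    by (simp only: young_eigen_eq[OF \<alpha> m, symmetric])
  finally show ?thesis .
qed

lemma young_act_cyclic_diff:
  assumes \<alpha>: "\<alpha> \<in> partitions d" and \<beta>: "\<beta> \<in> partitions d" and ne: "\<alpha> \<noteq> \<beta>" and m: "young_eigen \<beta> m"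
  shows "young_act \<alpha> (act d \<rho> x m) = 0"
proof -
  have "young_act \<alpha> (act d \<rho> x m)
      = smul (inverse (young_scalar d \<beta>)) (young_act \<alpha> (act d \<rho> x (young_act \<beta> m)))"
    by (subst (1) young_eigen_eq[OF \<beta> m]) (simp only: act_smul)
  also have "young_act \<alpha> (act d \<rho> x (young_act \<beta> m)) = 0"
    by (simp add: act_assoc young_sandwich_diff[OF \<alpha> \<beta> ne] gmult_assoc)
  finally show ?thesis by simp
qed

lemma act_young_central:
  "act d \<rho> (young_central d \<alpha>) m = (\<Sum>g\<in>symgroup d. \<rho> g (young_act \<alpha> (\<rho> (inv g) m)))"
  unfolding young_central_def conj_sum_def act_sum_left
proof (intro sum.cong refl)
  fix g assume g: "g \<in> symgroup d"
  have "act d \<rho> (gmult d (basis_vec g) (gmult d (young_symmetrizer \<alpha>) (basis_vec (inv g)))) m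
      = act d \<rho> (basis_vec g) (young_act \<alpha> (act d \<rho> (basis_vec (inv g)) m))"
    by (simp only: act_assoc)
  then show "act d \<rho> (gmult d (basis_vec g) (gmult d (young_symmetrizer \<alpha>) (basis_vec (inv g)))) m
      = \<rho> g (young_act \<alpha> (\<rho> (inv g) m))"
    by (simp only: act_basis[OF g] act_basis[OF symgroup_inv[OF g]])
qed

text \<open>The expansion of the unit in the averaged Young symmetrizers, applied to m. The
  coefficients do not depend on m, so one expansion serves all values of an equivariant map at
  once.\<close>

lemma decompose:
  "\<exists>a. \<forall>m. m = (\<Sum>\<alpha>\<in>partitions d. smul (a \<alpha>) (\<Sum>g\<in>symgroup d. \<rho> g (young_act \<alpha> (\<rho> (inv g) m))))"
proof -
  obtain a where a: "basis_vec id = (\<Sum>\<alpha>\<in>partitions d. smul (a \<alpha>) (young_central d \<alpha>))"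
    by (rule one_eq_sum_young_central)
  have "m = (\<Sum>\<alpha>\<in>partitions d. smul (a \<alpha>) (\<Sum>g\<in>symgroup d. \<rho> g (young_act \<alpha> (\<rho> (inv g) m))))" for m
  proof -
    have "m = act d \<rho> (basis_vec id) m"
      by (simp only: act_one)
    also have "\<dots> = (\<Sum>\<alpha>\<in>partitions d. smul (a \<alpha>) (act d \<rho> (young_central d \<alpha>) m))"
      unfolding a by (simp only: act_sum_left act_smul_left)
    finally show ?thesis
      by (simp only: act_young_central)
  qed
  then show ?thesis by (intro exI allI)
qed

text \<open>All terms of \<open>decompose\<close> vanish. This test yields irreducibility,
  injectivity and the directness of sums below.\<close>

lemma eq_0_if_young_act_eq_0:
  assumes "\<And>\<alpha> x. \<alpha> \<in> partitions d \<Longrightarrow> young_act \<alpha> (act d \<rho> x m) = 0"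
  shows "m = 0"
proof -
  obtain a where a: "\<forall>m. m = (\<Sum>\<alpha>\<in>partitions d. smul (a \<alpha>) (\<Sum>g\<in>symgroup d. \<rho> g (young_act \<alpha> (\<rho> (inv g) m))))"
    using decompose ..
  have "\<rho> g (young_act \<alpha> (\<rho> (inv g) m)) = 0" if "g \<in> symgroup d" "\<alpha> \<in> partitions d" for g \<alpha>
    using assms[OF that(2), of "basis_vec (inv g)"] that(1) free_pair.linear_0[OF lin_rep]
    by (simp add: act_basis)
  then have "(\<Sum>\<alpha>\<in>partitions d. smul (a \<alpha>) (\<Sum>g\<in>symgroup d. \<rho> g (young_act \<alpha> (\<rho> (inv g) m)))) = 0"
    by (intro sum.neutral ballI) simp
  then show ?thesis
    by (subst spec[OF a, of m])
qed

lemma cyclic_subset: "subrep d \<rho> U \<Longrightarrow> m \<in> U \<Longrightarrow> cyclic m \<subseteq> U"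
  using subrep_act by blast

text \<open>A nonzero u in U survives some \<open>c\<^sub>\<beta> x\<close>. As u lies in the cyclic
  module of an eigenvector of \<open>c\<^sub>\<alpha>\<close>, this forces \<beta> = \<alpha>, and
  the result is a nonzero multiple of m, which therefore lies in U.\<close>

lemma cyclic_irreducible:
  assumes \<alpha>: "\<alpha> \<in> partitions d" and m: "young_eigen \<alpha> m" "m \<noteq> 0"
  shows "irreducible_rep d \<rho> (cyclic m)"
  unfolding irreducible_rep_def
proof (intro conjI allI impI)
  show "subrep d \<rho> (cyclic m)" by (rule subrep_cyclic)
  show "cyclic m \<noteq> {0}" using cyclic_mem[of m] m(2) by auto
  fix U assume U: "subrep d \<rho> U \<and> U \<subseteq> cyclic m"
  then have sub: "free_vs.subspace U" by (simp add: subrep_def)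
  show "U = {0} \<or> U = cyclic m"
  proof (cases "U \<subseteq> {0}")
    case True
    then show ?thesis using free_vs.subspace_0[OF sub] by blast
  next
    case False
    then obtain u where u: "u \<in> U" "u \<noteq> 0" by blast
    then obtain y where y: "u = act d \<rho> y m" using U by blast
    obtain \<beta> x where \<beta>: "\<beta> \<in> partitions d" and nz: "young_act \<beta> (act d \<rho> x u) \<noteq> 0"
      using eq_0_if_young_act_eq_0 u(2) by metis
    have eq: "young_act \<beta> (act d \<rho> x u) = young_act \<beta> (act d \<rho> (gmult d x y) m)"
      by (simp only: y act_assoc)
    then have "\<beta> = \<alpha>"
      using young_act_cyclic_diff[OF \<beta> \<alpha> _ m(1)] nz by metis
    then have t: "young_act \<beta> (act d \<rho> x u) = smul (young_form d \<alpha> (gmult d x y)) m"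
      unfolding eq using young_act_cyclic_same[OF \<alpha> m(1)] by simp
    let ?t = "young_form d \<alpha> (gmult d x y)"
    have "?t \<noteq> 0" using nz t by auto
    then have "m = smul (inverse ?t) (young_act \<beta> (act d \<rho> x u))"
      by (simp add: t)
    also have "\<dots> \<in> U"
      using U u(1) by (intro free_vs.subspace_scale[OF sub] subrep_act) auto
    finally have "m \<in> U" .
    then show ?thesis using cyclic_subset U by blast
  qed
qed

text \<open>The isomorphism sends x to x m. It is onto because \<open>x c\<^sub>\<alpha> m\<close>
  is a nonzero multiple of x m. It is injective because an element u of the left ideal with u m = 0
  is killed by every \<open>c\<^sub>\<beta> w\<close>.\<close>

lemma iso_cyclic:
  assumes \<alpha>: "\<alpha> \<in> partitions d" and m: "young_eigen \<alpha> m" "m \<noteq> 0"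
  shows "iso_rep d left_action (irrep \<alpha>) \<rho> (cyclic m)"
  unfolding iso_rep_def
proof (intro exI conjI ballI)
  let ?\<phi> = "\<lambda>x. act d \<rho> x m" and ?h = "young_scalar d \<alpha>"
  show "lin ?\<phi>" by (rule lin_act_left)
  have \<phi>: "?\<phi> (gmult d x (young_symmetrizer \<alpha>)) = smul ?h (?\<phi> x)" for x
    using m(1) by (simp add: act_assoc[symmetric] young_eigen_def act_smul)
  have "u = 0" if u: "u \<in> irrep \<alpha>" and 0: "?\<phi> u = 0" for u
  proof (rule sym_rep.eq_0_if_young_act_eq_0[OF sym_rep_left_action])
    fix \<beta> w assume \<beta>: "\<beta> \<in> partitions d"
    obtain x where x: "u = gmult d x (young_symmetrizer \<alpha>)"
      using u irrep_eq[OF \<alpha>] by blast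
    have *: "gmult d (young_symmetrizer \<beta>) (gmult d w u)
        = gmult d (young_symmetrizer \<beta>) (gmult d (gmult d w x) (young_symmetrizer \<alpha>))"
      by (simp only: x gmult_assoc)
    show "gmult d (young_symmetrizer \<beta>) (gmult d w u) = 0"
    proof (cases "\<beta> = \<alpha>")
      case True
      have "?\<phi> x = 0"
        using 0 young_scalar_neq_0[OF \<alpha>] unfolding x \<phi> by simp
      then have "young_act \<alpha> (act d \<rho> (gmult d w x) m) = 0"
        by (simp only: act_assoc[symmetric] act_zero)
      then have "young_form d \<alpha> (gmult d w x) = 0"
        using young_act_cyclic_same[OF \<alpha> m(1)] m(2) by simp
      with * show ?thesis
        unfolding True young_form_eq[OF \<alpha>] by simp
    next
      case False
      show ?thesis
        by (simp only: * young_sandwich_diff[OF \<beta> \<alpha> False])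
    qed
  qed
  then have "inj_on ?\<phi> (irrep \<alpha>)"
    using free_pair.linear_inj_on_iff_eq_0[OF lin_act_left subspace_irrep[OF \<alpha>]] by blast
  moreover have "?\<phi> ` irrep \<alpha> = cyclic m"
  proof
    show "cyclic m \<subseteq> ?\<phi> ` irrep \<alpha>"
    proof clarify
      fix x
      have "act d \<rho> x m = ?\<phi> (gmult d (smul (inverse ?h) x) (young_symmetrizer \<alpha>))"
        unfolding \<phi> using young_scalar_neq_0[OF \<alpha>] by (simp add: act_smul_left)
      then show "act d \<rho> x m \<in> ?\<phi> ` irrep \<alpha>"
        unfolding irrep_eq[OF \<alpha>] by blast
    qed
  qed auto
  ultimately show "bij_betw ?\<phi> (irrep \<alpha>) (cyclic m)"
    by (simp add: bij_betw_def)
  show "?\<phi> (left_action g u) = \<rho> g (?\<phi> u)" if "g \<in> symgroup d" for g u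
    using that act_assoc[of "basis_vec g" u m] by (simp add: act_basis)
qed

lemma irreducible_cyclic:
  assumes "irreducible_rep d \<rho> P" "m \<in> P" "m \<noteq> 0"
  shows "cyclic m = P"
proof -
  have "cyclic m \<subseteq> P"
    using assms by (intro cyclic_subset) (simp_all add: irreducible_rep_def)
  moreover have "cyclic m \<noteq> {0}"
    using cyclic_mem[of m] assms(3) by auto
  ultimately show ?thesis
    using assms(1) subrep_cyclic unfolding irreducible_rep_def by metis
qed

text \<open>An isomorphism carries \<open>c\<^sub>\<alpha>\<close>, an eigenvector in its own left
  ideal, to an eigenvector in P; conversely a nonzero eigenvector generates P.\<close>

lemma iso_irrep_iff:
  assumes \<alpha>: "\<alpha> \<in> partitions d" and P: "irreducible_rep d \<rho> P"
  shows "iso_rep d left_action (irrep \<alpha>) \<rho> P \<longleftrightarrow> (\<exists>m\<in>P. m \<noteq> 0 \<and> young_eigen \<alpha> m)"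
proof
  assume "iso_rep d left_action (irrep \<alpha>) \<rho> P"
  then obtain \<phi> where lin: "lin \<phi>" and bij: "bij_betw \<phi> (irrep \<alpha>) P"
    and equiv: "\<And>g u. g \<in> symgroup d \<Longrightarrow> u \<in> irrep \<alpha> \<Longrightarrow> \<phi> (left_action g u) = \<rho> g (\<phi> u)"
    unfolding iso_rep_def by blast
  let ?Y = "young_symmetrizer \<alpha>"
  have Y: "?Y \<in> irrep \<alpha>" by (rule irrep_young_mem[OF \<alpha>])
  have "young_act \<alpha> (\<phi> ?Y) = \<phi> (gmult d ?Y ?Y)"
    by (simp add: act_def free_pair.linear_sum[OF lin] free_pair.linear_scale[OF lin] equiv Y)
  also have "\<dots> = smul (young_scalar d \<alpha>) (\<phi> ?Y)"
    by (simp only: young_scalar_eq[OF \<alpha>] free_pair.linear_scale[OF lin])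
  finally have "young_eigen \<alpha> (\<phi> ?Y)"
    by (simp only: young_eigen_def)
  moreover have "\<phi> ?Y \<in> P"
    using bij Y by (rule bij_betw_apply)
  moreover have "\<phi> ?Y \<noteq> 0"
  proof
    assume "\<phi> ?Y = 0"
    then have "?Y = 0"
      using bij Y free_vs.subspace_0[OF subspace_irrep[OF \<alpha>]] free_pair.linear_0[OF lin]
      by (metis bij_betw_imp_inj_on inj_on_eq_iff)
    then show False using young_neq_0[OF \<alpha>] by contradiction
  qed
  ultimately show "\<exists>m\<in>P. m \<noteq> 0 \<and> young_eigen \<alpha> m" by blast
next
  assume "\<exists>m\<in>P. m \<noteq> 0 \<and> young_eigen \<alpha> m"
  then obtain m where "m \<in> P" "m \<noteq> 0" "young_eigen \<alpha> m" by blast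
  then show "iso_rep d left_action (irrep \<alpha>) \<rho> P"
    using iso_cyclic[OF \<alpha>, of m] irreducible_cyclic[OF P, of m] by simp
qed

lemma young_act_image:
  assumes \<alpha>: "\<alpha> \<in> partitions d" and M: "subrep d \<rho> M"
  shows "young_act \<alpha> ` M = {m \<in> M. young_eigen \<alpha> m}"
proof
  show "young_act \<alpha> ` M \<subseteq> {m \<in> M. young_eigen \<alpha> m}"
    using young_eigen_young_act[OF \<alpha>] subrep_act[OF M] by blast
  show "{m \<in> M. young_eigen \<alpha> m} \<subseteq> young_act \<alpha> ` M"
  proof clarify
    fix m assume m: "m \<in> M" "young_eigen \<alpha> m"
    have "m = young_act \<alpha> (smul (inverse (young_scalar d \<alpha>)) m)"
      by (subst (1) young_eigen_eq[OF \<alpha> m(2)]) (simp only: act_smul)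
    moreover have "smul (inverse (young_scalar d \<alpha>)) m \<in> M"
      using M m(1) by (simp add: subrep_def free_vs.subspace_scale)
    ultimately show "m \<in> young_act \<alpha> ` M" by (rule image_eqI)
  qed
qed

text \<open>A summand isomorphic to \<open>T\<^sub>\<alpha>\<close> is mapped by
  \<open>c\<^sub>\<alpha>\<close> onto a line, every other summand to 0. One eigenvector for each
  such line gives a basis of the image, whose size does not depend on D.\<close>

lemma card_iso_components:
  assumes \<alpha>: "\<alpha> \<in> partitions d" and M: "subrep d \<rho> M" and D: "irreducible_decomposition d \<rho> M D"
  shows "card {P \<in> D. iso_rep d left_action (irrep \<alpha>) \<rho> P} = free_vs.dim (young_act \<alpha> ` M)"
proof -
  let ?D = "{P \<in> D. iso_rep d left_action (irrep \<alpha>) \<rho> P}"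
  have fin: "finite D" and irr: "\<And>P. P \<in> D \<Longrightarrow> irreducible_rep d \<rho> P" and span: "free_vs.span (\<Union>D) = M"
    and dir: "\<And>f P. (\<forall>P\<in>D. f P \<in> P) \<Longrightarrow> (\<Sum>P\<in>D. f P) = 0 \<Longrightarrow> P \<in> D \<Longrightarrow> f P = 0"
    using D unfolding irreducible_decomposition_def by blast+
  have sub: "free_vs.subspace P" if "P \<in> D" for P
    using irr[OF that] by (simp add: irreducible_rep_def subrep_def)
  have "\<forall>P\<in>?D. \<exists>m. m \<in> P \<and> m \<noteq> 0 \<and> young_eigen \<alpha> m"
    using iso_irrep_iff[OF \<alpha> irr] by blast
  then obtain m where m: "\<And>P. P \<in> ?D \<Longrightarrow> m P \<in> P \<and> m P \<noteq> 0 \<and> young_eigen \<alpha> (m P)"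
    by metis
  have zero: "c P = 0" if 0: "(\<Sum>P\<in>?D. smul (c P) (m P)) = 0" and P: "P \<in> ?D" for c P
  proof -
    define f where "f P = (if P \<in> ?D then smul (c P) (m P) else 0)" for P
    have "(\<Sum>P\<in>D. f P) = (\<Sum>P\<in>?D. f P)"
      using fin by (intro sum.mono_neutral_right) (auto simp: f_def)
    also have "\<dots> = (\<Sum>P\<in>?D. smul (c P) (m P))"
      by (intro sum.cong refl) (simp add: f_def)
    finally have "(\<Sum>P\<in>D. f P) = 0" using 0 by simp
    moreover have "\<forall>P\<in>D. f P \<in> P"
      using m sub by (simp add: f_def free_vs.subspace_scale free_vs.subspace_0)
    ultimately have "f P = 0"
      using P by (auto intro: dir[of f P])
    then show ?thesis using P m[OF P] by (simp add: f_def)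
  qed
  have inj: "inj_on m ?D"
  proof (rule inj_onI, rule ccontr)
    fix P Q assume PQ: "P \<in> ?D" "Q \<in> ?D" "m P = m Q" "P \<noteq> Q"
    define c where "c R = (if R = P then 1 else if R = Q then -1 else 0 :: complex)" for R
    have "(\<Sum>R\<in>?D. smul (c R) (m R)) = (\<Sum>R\<in>{P, Q}. smul (c R) (m R))"
      using PQ fin by (intro sum.mono_neutral_right) (auto simp: c_def)
    also have "\<dots> = 0"
      using PQ by (simp add: c_def)
    finally have "c P = 0" by (rule zero[OF _ PQ(1)])
    then show False by (simp add: c_def)
  qed
  have finD: "finite ?D" using fin by simp
  have ind: "free_vs.independent (m ` ?D)"
    using finD inj zero by (rule independentI_inj)
  have "m ` ?D \<subseteq> young_act \<alpha> ` M"
    unfolding young_act_image[OF \<alpha> M] using m span free_vs.span_base by blast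
  moreover have "young_act \<alpha> ` M \<subseteq> free_vs.span (m ` ?D)"
  proof -
    have "young_act \<alpha> x \<in> free_vs.span (m ` ?D)" if P: "P \<in> D" and x: "x \<in> P" for x P
    proof (cases "P \<in> ?D")
      case True
      then have "cyclic (m P) = P"
        using irreducible_cyclic[OF irr[OF P]] m by blast
      then obtain y where "x = act d \<rho> y (m P)" using x by blast
      then have "young_act \<alpha> x = smul (young_form d \<alpha> y) (m P)"
        using young_act_cyclic_same[OF \<alpha>] m[OF True] by simp
      then show ?thesis
        using True by (simp add: free_vs.span_scale free_vs.span_base)
    next
      case False
      then have "\<not> (\<exists>m\<in>P. m \<noteq> 0 \<and> young_eigen \<alpha> m)"
        using iso_irrep_iff[OF \<alpha> irr[OF P]] P by blast
      moreover have "young_act \<alpha> x \<in> P"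
        using irr[OF P] x by (intro subrep_act) (simp_all add: irreducible_rep_def)
      ultimately have "young_act \<alpha> x = 0"
        using young_eigen_young_act[OF \<alpha>] by metis
      then show ?thesis by (simp add: free_vs.span_zero)
    qed
    then have "young_act \<alpha> ` (\<Union>D) \<subseteq> free_vs.span (m ` ?D)" by blast
    then have "free_vs.span (young_act \<alpha> ` (\<Union>D)) \<subseteq> free_vs.span (m ` ?D)"
      by (rule free_vs.span_minimal) (rule free_vs.subspace_span)
    then show ?thesis
      by (simp only: free_pair.linear_span_image[OF lin_act] span)
  qed
  ultimately have "free_vs.dim (young_act \<alpha> ` M) = card (m ` ?D)"
    by (intro free_vs.dim_unique[OF _ _ ind]) auto
  then show ?thesis
    by (simp only: card_image[OF inj])
qed

lemma eigen_basis:
  assumes \<alpha>: "\<alpha> \<in> partitions d" and M: "subrep d \<rho> M" "M \<subseteq> free_on S" "finite S"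
  obtains B where "finite B" "B \<subseteq> young_act \<alpha> ` M" "free_vs.independent B"
    "young_act \<alpha> ` M \<subseteq> free_vs.span B" "card B = free_vs.dim (young_act \<alpha> ` M)"
proof -
  obtain B where B: "B \<subseteq> young_act \<alpha> ` M" "free_vs.independent B"
    "young_act \<alpha> ` M \<subseteq> free_vs.span B" "card B = free_vs.dim (young_act \<alpha> ` M)"
    by (rule free_vs.basis_exists)
  have "B \<subseteq> free_on S"
    using B(1) M(2) unfolding young_act_image[OF \<alpha> M(1)] by blast
  then have "finite B"
    using independent_free_on_finite[OF B(2)] M(3) by blast
  then show ?thesis using B by (rule that)
qed

text \<open>The summands are written down explicitly: for every \<alpha>, each vector of a basis of
  the image of \<open>c\<^sub>\<alpha>\<close> in M generates one of them. They span M by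
  \<open>decompose\<close>.\<close>

lemma irreducible_decomposition_exists:
  assumes M: "subrep d \<rho> M" "M \<subseteq> free_on S" "finite S"
  shows "\<exists>D. irreducible_decomposition d \<rho> M D"
proof -
  have "\<forall>\<alpha>\<in>partitions d. \<exists>B. finite B \<and> B \<subseteq> young_act \<alpha> ` M \<and> free_vs.independent B \<and>
      young_act \<alpha> ` M \<subseteq> free_vs.span B"
    using eigen_basis[OF _ M] by metis
  then obtain B where B: "\<And>\<alpha>. \<alpha> \<in> partitions d \<Longrightarrow> finite (B \<alpha>) \<and> B \<alpha> \<subseteq> young_act \<alpha> ` M \<and>
      free_vs.independent (B \<alpha>) \<and> young_act \<alpha> ` M \<subseteq> free_vs.span (B \<alpha>)"
    by metis
  have eigen: "m \<in> M \<and> young_eigen \<alpha> m \<and> m \<noteq> 0" if "\<alpha> \<in> partitions d" "m \<in> B \<alpha>" for \<alpha> m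
  proof -
    have "m \<in> {m \<in> M. young_eigen \<alpha> m}"
      using B[OF that(1)] that(2) unfolding young_act_image[OF that(1) M(1)] by blast
    moreover have "m \<noteq> 0"
      using B[OF that(1)] that(2) free_vs.dependent_zero by metis
    ultimately show ?thesis by simp
  qed
  define D where "D = (\<Union>\<alpha>\<in>partitions d. cyclic ` B \<alpha>)"
  have Dex: "\<exists>\<alpha> m. \<alpha> \<in> partitions d \<and> m \<in> B \<alpha> \<and> P = cyclic m" if "P \<in> D" for P
    using that by (auto simp: D_def)
  have Dsub: "P \<subseteq> M" if P: "P \<in> D" for P
  proof -
    obtain \<alpha> m where *: "\<alpha> \<in> partitions d" "m \<in> B \<alpha>" "P = cyclic m"
      using Dex[OF P] by blast
    show ?thesis unfolding *(3) using eigen[OF *(1,2)] by (intro cyclic_subset M(1)) simp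
  qed
  have "finite D"
    using B by (simp add: D_def finite_partitions)
  moreover have "irreducible_rep d \<rho> P" if P: "P \<in> D" for P
  proof -
    obtain \<alpha> m where *: "\<alpha> \<in> partitions d" "m \<in> B \<alpha>" "P = cyclic m"
      using Dex[OF P] by blast
    show ?thesis unfolding *(3) using eigen[OF *(1,2)] by (intro cyclic_irreducible[OF *(1)]) simp_all
  qed
  moreover have "free_vs.span (\<Union>D) = M"
  proof
    show "free_vs.span (\<Union>D) \<subseteq> M"
      using Dsub M(1) by (intro free_vs.span_minimal) (auto simp: subrep_def)
    have gen: "\<rho> g y \<in> free_vs.span (\<Union>D)"
      if g: "g \<in> symgroup d" and \<alpha>: "\<alpha> \<in> partitions d" and y: "y \<in> young_act \<alpha> ` M" for g \<alpha> y
    proof -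
      have "\<rho> g ` B \<alpha> \<subseteq> \<Union>D"
      proof clarify
        fix m assume "m \<in> B \<alpha>"
        then have "cyclic m \<in> D" using \<alpha> by (auto simp: D_def)
        moreover have "\<rho> g m \<in> cyclic m"
          using g by (metis act_basis rangeI)
        ultimately show "\<rho> g m \<in> \<Union>D" by blast
      qed
      then have "free_vs.span (\<rho> g ` B \<alpha>) \<subseteq> free_vs.span (\<Union>D)"
        by (rule free_vs.span_mono)
      then have "\<rho> g ` free_vs.span (B \<alpha>) \<subseteq> free_vs.span (\<Union>D)"
        by (simp only: free_pair.linear_span_image[OF lin_rep[OF g]])
      then show ?thesis
        using B[OF \<alpha>] y by blast
    qed
    show "M \<subseteq> free_vs.span (\<Union>D)"
    proof
      fix x assume x: "x \<in> M"
      obtain a where a: "\<forall>m. m = (\<Sum>\<alpha>\<in>partitions d. smul (a \<alpha>) (\<Sum>g\<in>symgroup d. \<rho> g (young_act \<alpha> (\<rho> (inv g) m))))"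
        using decompose ..
      have "\<rho> (inv g) x \<in> M" if "g \<in> symgroup d" for g
        using that M(1) x by (simp add: subrep_def)
      then have "young_act \<alpha> (\<rho> (inv g) x) \<in> young_act \<alpha> ` M" if "g \<in> symgroup d" for g \<alpha>
        using that by blast
      then have "(\<Sum>\<alpha>\<in>partitions d. smul (a \<alpha>) (\<Sum>g\<in>symgroup d. \<rho> g (young_act \<alpha> (\<rho> (inv g) x))))
          \<in> free_vs.span (\<Union>D)"
        by (intro free_vs.span_sum free_vs.span_scale gen)
      then show "x \<in> free_vs.span (\<Union>D)" by (subst spec[OF a, of x])
    qed
  qed
  \<comment> \<open>Apply \<open>c\<^sub>\<beta> x\<close> to the vanishing sum. Terms of another
    type drop out, the others become multiples of distinct vectors of the basis
    \<open>B \<beta>\<close>, so each of them is 0.\<close>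
  moreover have "f Q = 0" if f: "\<forall>P\<in>D. f P \<in> P" and sum0: "(\<Sum>P\<in>D. f P) = 0" and Q: "Q \<in> D" for f Q
  proof (rule eq_0_if_young_act_eq_0)
    fix \<beta> x assume \<beta>: "\<beta> \<in> partitions d"
    have "\<exists>\<alpha> m y. \<alpha> \<in> partitions d \<and> m \<in> B \<alpha> \<and> P = cyclic m \<and> f P = act d \<rho> y m" if P: "P \<in> D" for P
    proof -
      obtain \<alpha> m where *: "\<alpha> \<in> partitions d" "m \<in> B \<alpha>" "P = cyclic m"
        using Dex[OF P] by blast
      moreover have "f P \<in> cyclic m"
        using f P *(3) by simp
      ultimately show ?thesis by blast
    qed
    then have "\<forall>P. \<exists>\<alpha> m y. P \<in> D \<longrightarrow> \<alpha> \<in> partitions d \<and> m \<in> B \<alpha> \<and> P = cyclic m \<and> f P = act d \<rho> y m"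
      by blast
    then obtain al m y where am: "\<And>P. P \<in> D \<Longrightarrow> al P \<in> partitions d \<and> m P \<in> B (al P) \<and> P = cyclic (m P) \<and>
        f P = act d \<rho> (y P) (m P)"
      unfolding choice_iff by blast
    let ?D = "{P \<in> D. al P = \<beta>}"
    define c where "c P = young_form d \<beta> (gmult d x (y P))" for P
    have in_D: "young_act \<beta> (act d \<rho> x (f P)) = smul (c P) (m P)" if "P \<in> ?D" for P
      using that am[of P] young_act_cyclic_same[OF \<beta>, of "m P"] eigen[of \<beta> "m P"]
      by (simp add: act_assoc[of x] c_def)
    have not_in_D: "young_act \<beta> (act d \<rho> x (f P)) = 0" if "P \<in> D" "al P \<noteq> \<beta>" for P
      using that am[of P] young_act_cyclic_diff[OF \<beta>, of "al P" "m P"] eigen[of "al P" "m P"]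
      by (simp add: act_assoc[of x])
    have "0 = young_act \<beta> (act d \<rho> x (\<Sum>P\<in>D. f P))"
      by (simp only: sum0 act_zero)
    also have "\<dots> = (\<Sum>P\<in>D. young_act \<beta> (act d \<rho> x (f P)))"
      by (simp only: act_sum)
    also have "\<dots> = (\<Sum>P\<in>?D. young_act \<beta> (act d \<rho> x (f P)))"
      using \<open>finite D\<close> not_in_D by (intro sum.mono_neutral_right) auto
    also have "\<dots> = (\<Sum>P\<in>?D. smul (c P) (m P))"
      by (intro sum.cong refl in_D)
    finally have 0: "(\<Sum>P\<in>?D. smul (c P) (m P)) = 0" by simp
    show "young_act \<beta> (act d \<rho> x (f Q)) = 0"
    proof (cases "al Q = \<beta>")
      case True
      have "inj_on m ?D"
      proof (rule inj_onI)
        fix P P' assume P: "P \<in> ?D" "P' \<in> ?D" and eq: "m P = m P'"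
        have "P = cyclic (m P)" using am[of P] P(1) by simp
        also have "\<dots> = cyclic (m P')" by (simp only: eq)
        also have "\<dots> = P'" using am[of P'] P(2) by simp
        finally show "P = P'" .
      qed
      moreover have "m ` ?D \<subseteq> B \<beta>"
        using am by auto
      moreover have "free_vs.independent (B \<beta>)" "finite ?D" "Q \<in> ?D"
        using B[OF \<beta>] \<open>finite D\<close> Q True by simp_all
      ultimately have "c Q = 0"
        using independent_sum_eq_0D[OF _ _ _ _ 0] by simp
      then show ?thesis
        using in_D[of Q] Q True by simp
    qed (use not_in_D[OF Q] in simp)
  qed
  ultimately have "irreducible_decomposition d \<rho> M D"
    unfolding irreducible_decomposition_def by blast
  then show ?thesis by blast
qed

text \<open>The description by \<open>THE\<close> is proper here: a decomposition exists, and its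
  count is a dimension that does not mention the decomposition.\<close>

theorem rep_multiplicity_eq_dim:
  assumes "\<alpha> \<in> partitions d" "subrep d \<rho> M" "M \<subseteq> free_on S" "finite S"
  shows "rep_multiplicity d left_action (irrep \<alpha>) \<rho> M = free_vs.dim (young_act \<alpha> ` M)"
  unfolding rep_multiplicity_def
proof (rule the_equality)
  obtain D where "irreducible_decomposition d \<rho> M D"
    using irreducible_decomposition_exists[OF assms(2-4)] by blast
  then show "\<exists>D. irreducible_decomposition d \<rho> M D \<and>
      free_vs.dim (young_act \<alpha> ` M) = card {P \<in> D. iso_rep d left_action (irrep \<alpha>) \<rho> P}"
    using card_iso_components[OF assms(1,2)] by metis
  show "r = free_vs.dim (young_act \<alpha> ` M)"
    if "\<exists>D. irreducible_decomposition d \<rho> M D \<and> r = card {P \<in> D. iso_rep d left_action (irrep \<alpha>) \<rho> P}" for r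
    using that card_iso_components[OF assms(1,2)] by metis
qed

end

section \<open>Schur functors and equivariant maps\<close>

lemma dim_eq_card_index:
  assumes I: "finite I" and sub: "m ` I \<subseteq> V" and span: "V \<subseteq> free_vs.span (m ` I)"
    and zero: "\<And>c i. (\<Sum>i\<in>I. smul (c i) (m i)) = 0 \<Longrightarrow> i \<in> I \<Longrightarrow> c i = 0"
  shows "free_vs.dim V = card I"
proof -
  have inj: "inj_on m I"
  proof (rule inj_onI, rule ccontr)
    fix p q assume pq: "p \<in> I" "q \<in> I" "m p = m q" "p \<noteq> q"
    define c where "c r = (if r = p then 1 else if r = q then -1 else 0 :: complex)" for r
    have "(\<Sum>r\<in>I. smul (c r) (m r)) = (\<Sum>r\<in>{p, q}. smul (c r) (m r))"
      using pq I by (intro sum.mono_neutral_right) (auto simp: c_def)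
    also have "\<dots> = 0"
      using pq by (simp add: c_def)
    finally have "c p = 0" by (rule zero[OF _ pq(1)])
    then show False by (simp add: c_def)
  qed
  have "free_vs.independent (m ` I)"
    using I inj zero by (rule independentI_inj)
  then have "free_vs.dim V = card (m ` I)"
    using sub span by (intro free_vs.dim_unique) auto
  then show ?thesis
    by (simp only: card_image[OF inj])
qed

section \<open>Words and the right action of the group algebra\<close>

abbreviation words :: "nat \<Rightarrow> nat \<Rightarrow> (nat \<Rightarrow> nat) set" where
  "words d m \<equiv> {..<d} \<rightarrow>\<^sub>E {..<m}"

lemma finite_words [simp]: "finite (words d m)"
  by (simp add: finite_PiE)

lemma words_comp:
  assumes "u \<in> words d m" "g \<in> symgroup d"
  shows "u \<circ> g \<in> words d m"
proof (rule PiE_I)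
  fix x assume "x \<in> {..<d}"
  then show "(u \<circ> g) x \<in> {..<m}"
    using assms(1) symgroup_lt[OF assms(2)] by auto
next
  fix x assume "x \<notin> {..<d}"
  then show "(u \<circ> g) x = undefined"
    using assms by (auto simp: symgroup_def permutes_def)
qed

lemma coef_right_mult:
  assumes "x \<in> free_on (symgroup d)"
  shows "coef (right_mult v x) u = (\<Sum>k\<in>symgroup d. coef x k * coef v (u \<circ> inv k))"
proof -
  have "right_mult v x = (\<Sum>k\<in>symgroup d. smul (coef x k) (lin_ext (\<lambda>w. basis_vec (w \<circ> k)) v))"
    using assms unfolding right_mult_def by (intro lin_ext_eq_sum) (auto simp: free_on_def)
  moreover have "coef (lin_ext (\<lambda>w. basis_vec (w \<circ> k)) v) u = coef v (u \<circ> inv k)" if "k \<in> symgroup d" for k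
    using that by (subst coef_lin_ext_basis[where f' = "\<lambda>w. w \<circ> inv k"]) simp_all
  ultimately show ?thesis
    by (simp add: coef_sum)
qed

lemma right_mult_smul_right:
  assumes "x \<in> free_on (symgroup d)"
  shows "right_mult v (smul c x) = smul c (right_mult v x)"
proof -
  have "smul c x \<in> free_on (symgroup d)"
    using assms by (simp add: in_free_on_iff)
  then show ?thesis
    by (intro poly_mapping_eqI) (simp add: coef_right_mult[of _ d] assms sum_distrib_left mult.assoc)
qed

lemma right_mult_assoc:
  assumes x: "x \<in> free_on (symgroup d)" and y: "y \<in> free_on (symgroup d)"
  shows "right_mult (right_mult v x) y = right_mult v (gmult d x y)"
proof (rule poly_mapping_eqI)
  fix u
  have "coef (right_mult v (gmult d x y)) u
      = (\<Sum>j\<in>symgroup d. \<Sum>l\<in>symgroup d. coef x l * coef y (inv l \<circ> j) * coef v (u \<circ> inv j))"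
    by (simp add: coef_right_mult[OF gmult_free_on[OF y]] coef_gmult sum_distrib_right)
  also have "\<dots> = (\<Sum>l\<in>symgroup d. \<Sum>j\<in>symgroup d. coef x l * coef y (inv l \<circ> j) * coef v (u \<circ> inv j))"
    by (rule sum.swap)
  also have "\<dots> = (\<Sum>l\<in>symgroup d. \<Sum>k\<in>symgroup d. coef x l * coef y k * coef v (u \<circ> inv k \<circ> inv l))"
  proof (rule sum.cong[OF refl])
    fix l assume l: "l \<in> symgroup d"
    have "(\<Sum>j\<in>symgroup d. coef x l * coef y (inv l \<circ> j) * coef v (u \<circ> inv j))
        = (\<Sum>k\<in>symgroup d. coef x l * coef y (inv l \<circ> (l \<circ> k)) * coef v (u \<circ> inv (l \<circ> k)))"
      by (rule sum_symgroup_left[OF l, symmetric])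
    also have "\<dots> = (\<Sum>k\<in>symgroup d. coef x l * coef y k * coef v (u \<circ> inv k \<circ> inv l))"
      using l by (intro sum.cong refl) (simp add: symgroup_inv_comp[of _ d] o_assoc)
    finally show "(\<Sum>j\<in>symgroup d. coef x l * coef y (inv l \<circ> j) * coef v (u \<circ> inv j))
        = (\<Sum>k\<in>symgroup d. coef x l * coef y k * coef v (u \<circ> inv k \<circ> inv l))" .
  qed
  also have "\<dots> = (\<Sum>k\<in>symgroup d. \<Sum>l\<in>symgroup d. coef x l * coef y k * coef v (u \<circ> inv k \<circ> inv l))"
    by (rule sum.swap)
  also have "\<dots> = coef (right_mult (right_mult v x) y) u"
    by (simp add: coef_right_mult[OF x] coef_right_mult[OF y] sum_distrib_left mult.assoc mult.left_commute)
  finally show "coef (right_mult (right_mult v x) y) u = coef (right_mult v (gmult d x y)) u" by simp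
qed

lemma right_mult_free_on:
  assumes "x \<in> free_on (symgroup d)" "v \<in> free_on (words d m)"
  shows "right_mult v x \<in> free_on (words d m)"
  unfolding in_free_on_iff coef_right_mult[OF assms(1)]
proof (intro allI impI sum.neutral ballI)
  fix u k assume u: "u \<notin> words d m" and k: "k \<in> symgroup d"
  have "u \<circ> inv k \<notin> words d m"
  proof
    assume "u \<circ> inv k \<in> words d m"
    then have "u \<circ> inv k \<circ> k \<in> words d m" using k by (rule words_comp)
    then show False using u k by simp
  qed
  then show "coef x k * coef v (u \<circ> inv k) = 0"
    using assms(2) by (simp add: in_free_on_iff)
qed

lemma schur_functor_eq:
  "\<alpha> \<in> partitions d \<Longrightarrow> schur_functor \<alpha> m = (\<lambda>v. right_mult v (young_symmetrizer \<alpha>)) ` free_on (words d m)"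
  by (simp add: schur_functor_def tensor_power_def partition_size_partitions)

lemma schur_functor_free_on: "\<alpha> \<in> partitions d \<Longrightarrow> schur_functor \<alpha> m \<subseteq> free_on (words d m)"
  unfolding schur_functor_eq using right_mult_free_on[OF young_symmetrizer_free_on] by blast

text \<open>The sum is, up to a nonzero factor, the action of the central element of the Young symmetrizer.\<close>

lemma schur_functor_twist:
  assumes \<alpha>: "\<alpha> \<in> partitions d"
  shows "\<exists>\<kappa>. \<kappa> \<noteq> 0 \<and> (\<forall>s\<in>schur_functor \<alpha> m. \<forall>u.
       (\<Sum>g\<in>symgroup d. young_form d \<alpha> (basis_vec g) * coef s (u \<circ> g)) = \<kappa> * coef s u)"
proof -
  let ?Y = "young_symmetrizer \<alpha>"
  have YG: "?Y \<in> free_on (symgroup d)" by (rule young_symmetrizer_free_on[OF \<alpha>])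
  obtain \<kappa> where \<kappa>: "\<kappa> \<noteq> 0" "gmult d ?Y (young_central d \<alpha>) = smul \<kappa> ?Y"
    by (rule young_central_scalar[OF \<alpha>])
  \<comment> \<open>Chosen so that \<open>c\<^sub>\<alpha> t\<close> is the sum of
    \<open>c\<^sub>\<alpha> g c\<^sub>\<alpha> (inv g)\<close> over all g, that is,
    \<open>c\<^sub>\<alpha>\<close> times its own average.\<close>
  define t where "t = (\<Sum>g\<in>symgroup d. smul (young_form d \<alpha> (basis_vec g)) (basis_vec (inv g)))"
  have tG: "t \<in> free_on (symgroup d)"
    unfolding t_def by (intro free_vs.subspace_sum free_vs.subspace_scale subspace_free_on basis_free_on symgroup_inv)
  have coef_t: "coef t k = young_form d \<alpha> (basis_vec (inv k))" if k: "k \<in> symgroup d" for k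
  proof -
    have "coef t k = (\<Sum>g\<in>symgroup d. if g = inv k then young_form d \<alpha> (basis_vec g) else 0)"
      unfolding t_def coef_sum
    proof (intro sum.cong refl)
      fix g assume "g \<in> symgroup d"
      then have "inv g = k \<longleftrightarrow> g = inv k" using k by auto
      then show "coef (smul (young_form d \<alpha> (basis_vec g)) (basis_vec (inv g))) k
          = (if g = inv k then young_form d \<alpha> (basis_vec g) else 0)"
        by (simp add: lookup_single when_def)
    qed
    then show ?thesis using k by simp
  qed
  have "gmult d ?Y t = (\<Sum>g\<in>symgroup d. gmult d (smul (young_form d \<alpha> (basis_vec g)) ?Y) (basis_vec (inv g)))"
    by (simp add: t_def gmult_sum gmult_smul gmult_smul_left)
  also have "\<dots> = (\<Sum>g\<in>symgroup d. gmult d (gmult d ?Y (gmult d (basis_vec g) ?Y)) (basis_vec (inv g)))"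
    by (simp only: young_form_eq[OF \<alpha>])
  also have "\<dots> = gmult d ?Y (young_central d \<alpha>)"
    by (simp only: young_central_def conj_sum_def gmult_sum gmult_assoc)
  finally have Yt: "gmult d ?Y t = smul \<kappa> ?Y"
    using \<kappa>(2) by simp
  have "(\<Sum>g\<in>symgroup d. young_form d \<alpha> (basis_vec g) * coef s (u \<circ> g)) = \<kappa> * coef s u"
    if s: "s \<in> schur_functor \<alpha> m" for s u
  proof -
    obtain v where v: "s = right_mult v ?Y"
      using s unfolding schur_functor_eq[OF \<alpha>] by blast
    have "(\<Sum>g\<in>symgroup d. young_form d \<alpha> (basis_vec g) * coef s (u \<circ> g))
        = (\<Sum>k\<in>symgroup d. young_form d \<alpha> (basis_vec (inv k)) * coef s (u \<circ> inv k))"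
      by (rule sum_symgroup_inv[symmetric])
    also have "\<dots> = coef (right_mult s t) u"
      by (simp add: coef_right_mult[OF tG] coef_t)
    also have "right_mult s t = smul \<kappa> s"
      unfolding v right_mult_assoc[OF YG tG] Yt by (rule right_mult_smul_right[OF YG])
    finally show ?thesis unfolding lookup_smul .
  qed
  with \<kappa>(1) show ?thesis by (intro exI[of _ \<kappa>] conjI ballI allI)
qed

definition slice :: "('b \<times> 'a \<Rightarrow>\<^sub>0 complex) \<Rightarrow> 'b \<Rightarrow> ('a \<Rightarrow>\<^sub>0 complex)" where
  "slice F u = Poly_Mapping.map_key (Pair u) F"

lemma coef_slice [simp]: "coef (slice F u) x = coef F (u, x)"
  by (simp add: slice_def map_key.rep_eq inj_on_def)

lemma lin_slice: "lin (\<lambda>F. slice F u)"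
  by (rule linI; rule poly_mapping_eqI) (simp_all add: lookup_add)

definition glue :: "'b set \<Rightarrow> ('b \<Rightarrow> ('a \<Rightarrow>\<^sub>0 complex)) \<Rightarrow> ('b \<times> 'a \<Rightarrow>\<^sub>0 complex)" where
  "glue S f = (\<Sum>u\<in>S. tensor (basis_vec u) (f u))"

lemma coef_glue: "finite S \<Longrightarrow> coef (glue S f) (u, x) = (if u \<in> S then coef (f u) x else 0)"
  by (simp add: glue_def coef_sum coef_tensor lookup_single when_def if_distrib[of "\<lambda>c. c * _"] cong: if_cong)

lemma slice_glue: "finite S \<Longrightarrow> u \<in> S \<Longrightarrow> slice (glue S f) u = f u"
  by (rule poly_mapping_eqI) (simp add: coef_glue)

context sym_rep
begin

text \<open>A map from words to vectors is encoded as a vector with basis the pairs of a word and a basis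
  element; \<open>slice F u\<close> is its value at \<open>u\<close>.\<close>

definition equivariant_maps :: "nat \<Rightarrow> ('a \<Rightarrow>\<^sub>0 complex) set \<Rightarrow> ((nat \<Rightarrow> nat) \<times> 'a \<Rightarrow>\<^sub>0 complex) set" where
  "equivariant_maps m M = {F. F \<in> free_on (words d m \<times> UNIV) \<and>
     (\<forall>u\<in>words d m. slice F u \<in> M \<and> (\<forall>g\<in>symgroup d. slice F (u \<circ> inv g) = \<rho> g (slice F u)))}"

text \<open>The map sending u to s(u) x, summed over the group to become equivariant.\<close>

definition conv :: "((nat \<Rightarrow> nat) \<Rightarrow>\<^sub>0 complex) \<Rightarrow> ('a \<Rightarrow>\<^sub>0 complex) \<Rightarrow> (nat \<Rightarrow> nat) \<Rightarrow> ('a \<Rightarrow>\<^sub>0 complex)" where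
  "conv s x u = (\<Sum>g\<in>symgroup d. smul (coef s (u \<circ> g)) (\<rho> g x))"

lemma conv_equivariant:
  assumes k: "k \<in> symgroup d"
  shows "conv s x (u \<circ> inv k) = \<rho> k (conv s x u)"
proof -
  have "conv s x (u \<circ> inv k) = (\<Sum>g\<in>symgroup d. smul (coef s (u \<circ> inv k \<circ> (k \<circ> g))) (\<rho> (k \<circ> g) x))"
    unfolding conv_def by (rule sum_symgroup_left[OF k, symmetric])
  also have "\<dots> = (\<Sum>g\<in>symgroup d. smul (coef s (u \<circ> g)) (\<rho> k (\<rho> g x)))"
    using k by (intro sum.cong refl) (simp add: rep_comp comp_assoc)
  also have "\<dots> = \<rho> k (conv s x u)"
    by (simp only: conv_def free_pair.linear_sum[OF lin_rep[OF k]] free_pair.linear_scale[OF lin_rep[OF k]])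
  finally show ?thesis .
qed

text \<open>The construction is balanced: group algebra elements pass from x to s. So an x in the
  image of \<open>c\<^sub>\<alpha>\<close> may be paired with an s in the Schur functor of
  \<alpha>.\<close>

lemma conv_act:
  assumes y: "y \<in> free_on (symgroup d)"
  shows "conv s (act d \<rho> y x) u = conv (right_mult s y) x u"
proof -
  have "conv s (act d \<rho> y x) u
      = (\<Sum>g\<in>symgroup d. \<Sum>k\<in>symgroup d. smul (coef y k * coef s (u \<circ> g)) (\<rho> (g \<circ> k) x))"
    unfolding conv_def
  proof (rule sum.cong[OF refl])
    fix g assume g: "g \<in> symgroup d"
    show "smul (coef s (u \<circ> g)) (\<rho> g (act d \<rho> y x))
        = (\<Sum>k\<in>symgroup d. smul (coef y k * coef s (u \<circ> g)) (\<rho> (g \<circ> k) x))"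
      using g by (simp add: act_def free_pair.linear_sum[OF lin_rep] free_pair.linear_scale[OF lin_rep]
          rep_comp free_vs.scale_sum_right mult.commute)
  qed
  also have "\<dots> = (\<Sum>k\<in>symgroup d. \<Sum>g\<in>symgroup d. smul (coef y k * coef s (u \<circ> g)) (\<rho> (g \<circ> k) x))"
    by (rule sum.swap)
  also have "\<dots> = (\<Sum>k\<in>symgroup d. \<Sum>j\<in>symgroup d. smul (coef y k * coef s (u \<circ> j \<circ> inv k)) (\<rho> j x))"
  proof (rule sum.cong[OF refl])
    fix k assume k: "k \<in> symgroup d"
    have "(\<Sum>g\<in>symgroup d. smul (coef y k * coef s (u \<circ> g)) (\<rho> (g \<circ> k) x))
        = (\<Sum>j\<in>symgroup d. smul (coef y k * coef s (u \<circ> (j \<circ> inv k))) (\<rho> (j \<circ> inv k \<circ> k) x))"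
      using sum_symgroup_right[OF symgroup_inv[OF k], of "\<lambda>g. smul (coef y k * coef s (u \<circ> g)) (\<rho> (g \<circ> k) x)"]
      by simp
    then show "(\<Sum>g\<in>symgroup d. smul (coef y k * coef s (u \<circ> g)) (\<rho> (g \<circ> k) x))
        = (\<Sum>j\<in>symgroup d. smul (coef y k * coef s (u \<circ> j \<circ> inv k)) (\<rho> j x))"
      using k by (simp add: comp_assoc)
  qed
  also have "\<dots> = (\<Sum>j\<in>symgroup d. \<Sum>k\<in>symgroup d. smul (coef y k * coef s (u \<circ> j \<circ> inv k)) (\<rho> j x))"
    by (rule sum.swap)
  also have "\<dots> = conv (right_mult s y) x u"
    by (simp add: conv_def coef_right_mult[OF y] free_vs.scale_sum_left)
  finally show ?thesis .
qed

definition conv_map :: "nat \<Rightarrow> ((nat \<Rightarrow> nat) \<Rightarrow>\<^sub>0 complex) \<Rightarrow> ('a \<Rightarrow>\<^sub>0 complex) \<Rightarrow> ((nat \<Rightarrow> nat) \<times> 'a \<Rightarrow>\<^sub>0 complex)" where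
  "conv_map m s x = glue (words d m) (conv s x)"

lemma slice_conv_map: "u \<in> words d m \<Longrightarrow> slice (conv_map m s x) u = conv s x u"
  by (simp add: conv_map_def slice_glue)

lemma lin_conv_map: "lin (\<lambda>s. conv_map m s x)"
  by (rule linI; rule poly_mapping_eqI)
    (auto simp: conv_map_def coef_glue conv_def lookup_add coef_sum sum.distrib algebra_simps sum_distrib_left)

lemma conv_map_smul_right: "conv_map m s (smul c x) = smul c (conv_map m s x)"
  by (rule poly_mapping_eqI)
    (auto simp: conv_map_def coef_glue conv_def coef_sum sum_distrib_left algebra_simps
      free_pair.linear_scale[OF lin_rep])

lemma conv_map_equivariant:
  assumes M: "subrep d \<rho> M" and x: "x \<in> M"
  shows "conv_map m s x \<in> equivariant_maps m M"
  unfolding equivariant_maps_def mem_Collect_eq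
proof (intro conjI ballI)
  show "conv_map m s x \<in> free_on (words d m \<times> UNIV)"
    by (auto simp: in_free_on_iff conv_map_def coef_glue)
  fix u assume u: "u \<in> words d m"
  show "slice (conv_map m s x) u \<in> M"
    unfolding slice_conv_map[OF u] conv_def
    using M x by (intro free_vs.subspace_sum free_vs.subspace_scale) (auto simp: subrep_def)
  fix g assume g: "g \<in> symgroup d"
  show "slice (conv_map m s x) (u \<circ> inv g) = \<rho> g (slice (conv_map m s x) u)"
    unfolding slice_conv_map[OF u] slice_conv_map[OF words_comp[OF u symgroup_inv[OF g]]]
    by (rule conv_equivariant[OF g])
qed

lemma young_act_conv_same:
  assumes \<alpha>: "\<alpha> \<in> partitions d" and x: "young_eigen \<alpha> x"
  shows "young_act \<alpha> (conv s x u) = smul (\<Sum>g\<in>symgroup d. young_form d \<alpha> (basis_vec g) * coef s (u \<circ> g)) x"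
proof -
  have "young_act \<alpha> (conv s x u) = (\<Sum>g\<in>symgroup d. smul (coef s (u \<circ> g)) (young_act \<alpha> (act d \<rho> (basis_vec g) x)))"
    unfolding conv_def act_sum act_smul by (intro sum.cong refl) (simp only: act_basis)
  then show ?thesis
    by (simp add: young_act_cyclic_same[OF \<alpha> x] free_vs.scale_sum_left mult.commute)
qed

lemma young_act_conv_diff:
  assumes "\<alpha> \<in> partitions d" "\<beta> \<in> partitions d" "\<alpha> \<noteq> \<beta>" "young_eigen \<beta> x"
  shows "young_act \<alpha> (conv s x u) = 0"
proof -
  have "young_act \<alpha> (conv s x u) = (\<Sum>g\<in>symgroup d. smul (coef s (u \<circ> g)) (young_act \<alpha> (act d \<rho> (basis_vec g) x)))"
    unfolding conv_def act_sum act_smul by (intro sum.cong refl) (simp only: act_basis)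
  then show ?thesis
    by (simp add: young_act_cyclic_diff[OF assms])
qed

text \<open>A basis consists of the \<open>conv_map m s x\<close> where, for each \<alpha>, s runs
  through a basis of the Schur functor and x through a basis of the image of
  \<open>c\<^sub>\<alpha>\<close> in M.\<close>

theorem dim_equivariant_maps:
  assumes M: "subrep d \<rho> M" "M \<subseteq> free_on S" "finite S"
  shows "free_vs.dim (equivariant_maps m M)
    = (\<Sum>\<alpha>\<in>partitions d. free_vs.dim (young_act \<alpha> ` M) * free_vs.dim (schur_functor \<alpha> m))"
proof -
  let ?P = "partitions d"
  have "\<exists>B. finite B \<and> B \<subseteq> young_act \<alpha> ` M \<and> free_vs.independent B \<and>
      young_act \<alpha> ` M \<subseteq> free_vs.span B \<and> card B = free_vs.dim (young_act \<alpha> ` M)" if \<alpha>: "\<alpha> \<in> ?P" for \<alpha>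
    by (rule eigen_basis[OF \<alpha> M]) blast
  then have "\<forall>\<alpha>\<in>?P. \<exists>B. finite B \<and> B \<subseteq> young_act \<alpha> ` M \<and> free_vs.independent B \<and>
      young_act \<alpha> ` M \<subseteq> free_vs.span B \<and> card B = free_vs.dim (young_act \<alpha> ` M)" ..
  from bchoice[OF this] obtain B where B: "\<forall>\<alpha>\<in>?P. finite (B \<alpha>) \<and> B \<alpha> \<subseteq> young_act \<alpha> ` M \<and> free_vs.independent (B \<alpha>) \<and>
      young_act \<alpha> ` M \<subseteq> free_vs.span (B \<alpha>) \<and> card (B \<alpha>) = free_vs.dim (young_act \<alpha> ` M)" ..
  have "\<exists>C. finite C \<and> C \<subseteq> schur_functor \<alpha> m \<and> free_vs.independent C \<and>
      schur_functor \<alpha> m \<subseteq> free_vs.span C \<and> card C = free_vs.dim (schur_functor \<alpha> m)" if \<alpha>: "\<alpha> \<in> ?P" for \<alpha>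
  proof -
    obtain C where C: "C \<subseteq> schur_functor \<alpha> m" "free_vs.independent C"
      "schur_functor \<alpha> m \<subseteq> free_vs.span C" "card C = free_vs.dim (schur_functor \<alpha> m)"
      by (rule free_vs.basis_exists)
    have "finite C"
      using C(1) schur_functor_free_on[OF \<alpha>] by (intro independent_free_on_finite[OF C(2) _ finite_words]) auto
    then show ?thesis using C by blast
  qed
  then have "\<forall>\<alpha>\<in>?P. \<exists>C. finite C \<and> C \<subseteq> schur_functor \<alpha> m \<and> free_vs.independent C \<and>
      schur_functor \<alpha> m \<subseteq> free_vs.span C \<and> card C = free_vs.dim (schur_functor \<alpha> m)" ..
  from bchoice[OF this] obtain C where C: "\<forall>\<alpha>\<in>?P. finite (C \<alpha>) \<and> C \<alpha> \<subseteq> schur_functor \<alpha> m \<and> free_vs.independent (C \<alpha>) \<and>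
      schur_functor \<alpha> m \<subseteq> free_vs.span (C \<alpha>) \<and> card (C \<alpha>) = free_vs.dim (schur_functor \<alpha> m)" ..
  have eigen: "x \<in> M" "young_eigen \<alpha> x" if "\<alpha> \<in> ?P" "x \<in> B \<alpha>" for \<alpha> x
  proof -
    have "x \<in> {x \<in> M. young_eigen \<alpha> x}"
      using B that unfolding young_act_image[OF that(1) M(1), symmetric] by blast
    then show "x \<in> M" "young_eigen \<alpha> x" by simp_all
  qed
  let ?I = "SIGMA \<alpha>:?P. C \<alpha> \<times> B \<alpha>"
  let ?e = "\<lambda>(\<alpha>, s, x). conv_map m s x"
  have "free_vs.dim (equivariant_maps m M) = card ?I"
  proof (rule dim_eq_card_index[of _ ?e])
    show "finite ?I"
      using B C by (intro finite_SigmaI finite_partitions finite_cartesian_product) auto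
    show "?e ` ?I \<subseteq> equivariant_maps m M"
      using eigen(1) by (auto intro!: conv_map_equivariant[OF M(1)])
  next
    fix c i assume sum0: "(\<Sum>i\<in>?I. smul (c i) (?e i)) = 0" and "i \<in> ?I"
    then obtain \<beta> s0 x0 where i: "i = (\<beta>, s0, x0)" and \<beta>: "\<beta> \<in> ?P" and s0: "s0 \<in> C \<beta>" and x0: "x0 \<in> B \<beta>"
      by auto
    obtain \<kappa> where \<kappa>: "\<kappa> \<noteq> 0" "\<And>s u. s \<in> schur_functor \<beta> m \<Longrightarrow>
        (\<Sum>g\<in>symgroup d. young_form d \<beta> (basis_vec g) * coef s (u \<circ> g)) = \<kappa> * coef s u"
      using schur_functor_twist[OF \<beta>, of m] by (elim exE conjE) blast
    \<comment> \<open>Evaluating at u and applying \<open>c\<^sub>\<beta>\<close> leaves the terms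
      of type \<beta>, where each \<open>conv s x u\<close> becomes \<kappa> s(u) x. Independence of
      the x gives this claim, and independence of the s the vanishing of all coefficients.\<close>
    have "(\<Sum>s\<in>C \<beta>. c (\<beta>, s, x0) * coef s u) = 0" if u: "u \<in> words d m" for u
    proof -
      have sum0': "(\<Sum>\<alpha>\<in>?P. \<Sum>s\<in>C \<alpha>. \<Sum>x\<in>B \<alpha>. smul (c (\<alpha>, s, x)) (conv_map m s x)) = 0"
        using B C sum0 by (simp add: sum.Sigma finite_partitions split_def)
      have "0 = young_act \<beta> (slice (\<Sum>\<alpha>\<in>?P. \<Sum>s\<in>C \<alpha>. \<Sum>x\<in>B \<alpha>. smul (c (\<alpha>, s, x)) (conv_map m s x)) u)"
        by (simp only: sum0' free_pair.linear_0[OF lin_slice] act_zero)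
      also have "\<dots> = (\<Sum>\<alpha>\<in>?P. \<Sum>s\<in>C \<alpha>. \<Sum>x\<in>B \<alpha>. smul (c (\<alpha>, s, x)) (young_act \<beta> (conv s x u)))"
        by (simp only: free_pair.linear_sum[OF lin_slice] free_pair.linear_scale[OF lin_slice] act_sum act_smul
            slice_conv_map[OF u])
      also have "\<dots> = (\<Sum>\<alpha>\<in>?P. if \<alpha> = \<beta> then \<Sum>s\<in>C \<beta>. \<Sum>x\<in>B \<beta>. smul (c (\<beta>, s, x)) (young_act \<beta> (conv s x u)) else 0)"
        using young_act_conv_diff[OF \<beta>] eigen(2)
        by (intro sum.cong refl) (auto intro!: sum.neutral)
      also have "\<dots> = (\<Sum>s\<in>C \<beta>. \<Sum>x\<in>B \<beta>. smul (c (\<beta>, s, x)) (young_act \<beta> (conv s x u)))"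
        using \<beta> by (simp add: finite_partitions)
      also have "\<dots> = (\<Sum>s\<in>C \<beta>. \<Sum>x\<in>B \<beta>. smul (\<kappa> * (c (\<beta>, s, x) * coef s u)) x)"
      proof (intro sum.cong refl)
        fix s x assume "s \<in> C \<beta>" "x \<in> B \<beta>"
        then show "smul (c (\<beta>, s, x)) (young_act \<beta> (conv s x u)) = smul (\<kappa> * (c (\<beta>, s, x) * coef s u)) x"
          using C \<beta> by (simp add: young_act_conv_same[OF \<beta> eigen(2)[OF \<beta>]] \<kappa>(2) subset_iff mult.left_commute)
      qed
      also have "\<dots> = (\<Sum>x\<in>B \<beta>. smul (\<Sum>s\<in>C \<beta>. \<kappa> * (c (\<beta>, s, x) * coef s u)) x)"
        by (subst sum.swap) (simp only: free_vs.scale_sum_left)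
      finally have "(\<Sum>x\<in>B \<beta>. smul (\<Sum>s\<in>C \<beta>. \<kappa> * (c (\<beta>, s, x) * coef s u)) x) = 0" by simp
      then have "(\<Sum>s\<in>C \<beta>. \<kappa> * (c (\<beta>, s, x0) * coef s u)) = 0"
        using B \<beta> x0 by (intro independent_sum_eq_0D[of "B \<beta>" "B \<beta>" "\<lambda>x. x"]) auto
      then show ?thesis
        using \<kappa>(1) by (simp add: sum_distrib_left[symmetric])
    qed
    moreover have "coef s u = 0" if "s \<in> C \<beta>" "u \<notin> words d m" for s u
      using that C \<beta> schur_functor_free_on[OF \<beta>, of m] by (auto simp: in_free_on_iff subset_iff)
    ultimately have "(\<Sum>s\<in>C \<beta>. c (\<beta>, s, x0) * coef s u) = 0" for u
      by (cases "u \<in> words d m") simp_all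
    then have "(\<Sum>s\<in>C \<beta>. smul (c (\<beta>, s, x0)) s) = 0"
      by (intro poly_mapping_eqI) (simp add: coef_sum)
    then show "c i = 0"
      unfolding i using C \<beta> s0 by (intro independent_sum_eq_0D[of "C \<beta>" "C \<beta>" "\<lambda>x. x" "\<lambda>s. c (\<beta>, s, x0)"]) auto
  next
    let ?span = "free_vs.span (?e ` ?I)"
    \<comment> \<open>As x is an eigenvector, s may be replaced by \<open>s c\<^sub>\<alpha>\<close>
      at the cost of a nonzero factor, which brings it into the Schur functor.\<close>
    have gen: "conv_map m s x \<in> ?span" if \<alpha>: "\<alpha> \<in> ?P" and s: "s \<in> free_on (words d m)" and x: "x \<in> B \<alpha>" for \<alpha> s x
    proof -
      let ?Y = "young_symmetrizer \<alpha>" and ?h = "inverse (young_scalar d \<alpha>)"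
      have "conv_map m s x = conv_map m s (smul ?h (young_act \<alpha> x))"
        by (subst (1) young_eigen_eq[OF \<alpha> eigen(2)[OF \<alpha> x]]) (rule refl)
      also have "\<dots> = smul ?h (conv_map m (right_mult s ?Y) x)"
        unfolding conv_map_smul_right
        by (simp only: conv_map_def glue_def conv_act[OF young_symmetrizer_free_on[OF \<alpha>]])
      finally have eq: "conv_map m s x = smul ?h (conv_map m (right_mult s ?Y) x)" .
      have "(\<lambda>s. conv_map m s x) ` C \<alpha> \<subseteq> ?e ` ?I"
        using \<alpha> x by force
      then have "free_vs.span ((\<lambda>s. conv_map m s x) ` C \<alpha>) \<subseteq> ?span"
        by (rule free_vs.span_mono)
      then have "(\<lambda>s. conv_map m s x) ` free_vs.span (C \<alpha>) \<subseteq> ?span"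
        by (simp only: free_pair.linear_span_image[OF lin_conv_map])
      moreover have "right_mult s ?Y \<in> free_vs.span (C \<alpha>)"
        using C \<alpha> s schur_functor_eq[OF \<alpha>, of m] by blast
      ultimately have "conv_map m (right_mult s ?Y) x \<in> ?span" by blast
      then show ?thesis
        unfolding eq by (rule free_vs.span_scale)
    qed
    show "equivariant_maps m M \<subseteq> ?span"
    proof
      fix F assume F: "F \<in> equivariant_maps m M"
      obtain a where a: "\<forall>x. x = (\<Sum>\<alpha>\<in>?P. smul (a \<alpha>) (\<Sum>g\<in>symgroup d. \<rho> g (young_act \<alpha> (\<rho> (inv g) x))))"
        using decompose ..
      have "\<exists>r. young_act \<alpha> (slice F u) = (\<Sum>x\<in>B \<alpha>. smul (r x) x)" if \<alpha>: "\<alpha> \<in> ?P" and u: "u \<in> words d m" for \<alpha> u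
      proof -
        have "slice F u \<in> M"
          using u F by (simp add: equivariant_maps_def)
        then have "young_act \<alpha> (slice F u) \<in> young_act \<alpha> ` M"
          by (rule imageI)
        then have "young_act \<alpha> (slice F u) \<in> free_vs.span (B \<alpha>)"
          using B \<alpha> by blast
        moreover have "finite (B \<alpha>)" using B \<alpha> by blast
        ultimately show ?thesis
          by (auto simp: free_vs.span_finite)
      qed
      then have "\<forall>\<alpha> u. \<exists>r. \<alpha> \<in> ?P \<longrightarrow> u \<in> words d m \<longrightarrow> young_act \<alpha> (slice F u) = (\<Sum>x\<in>B \<alpha>. smul (r x) x)"
        by blast
      then obtain r where r: "\<And>\<alpha> u. \<alpha> \<in> ?P \<Longrightarrow> u \<in> words d m \<Longrightarrow> young_act \<alpha> (slice F u) = (\<Sum>x\<in>B \<alpha>. smul (r \<alpha> u x) x)"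
        unfolding choice_iff by blast
      \<comment> \<open>The coordinates of \<open>c\<^sub>\<alpha>\<close> F(u) in the basis
        \<open>B \<alpha>\<close>, as functions of u. Equivariance of F turns
        \<open>decompose\<close>, applied to F(u), into a combination of the maps built from
        them.\<close>
      define s where "s \<alpha> x = of_fun (words d m) (\<lambda>u. r \<alpha> u x)" for \<alpha> x
      have slice_F: "slice F u = (\<Sum>\<alpha>\<in>?P. smul (a \<alpha>) (\<Sum>x\<in>B \<alpha>. conv (s \<alpha> x) x u))" if u: "u \<in> words d m" for u
      proof -
        have "(\<Sum>g\<in>symgroup d. \<rho> g (young_act \<alpha> (\<rho> (inv g) (slice F u)))) = (\<Sum>x\<in>B \<alpha>. conv (s \<alpha> x) x u)"
          if \<alpha>: "\<alpha> \<in> ?P" for \<alpha>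
        proof -
          have "\<rho> g (young_act \<alpha> (\<rho> (inv g) (slice F u))) = (\<Sum>x\<in>B \<alpha>. smul (coef (s \<alpha> x) (u \<circ> g)) (\<rho> g x))"
            if g: "g \<in> symgroup d" for g
          proof -
            have ug: "u \<circ> g \<in> words d m" by (rule words_comp[OF u g])
            have "slice F (u \<circ> inv (inv g)) = \<rho> (inv g) (slice F u)"
              using F u symgroup_inv[OF g] unfolding equivariant_maps_def by blast
            then have "\<rho> (inv g) (slice F u) = slice F (u \<circ> g)"
              using g by simp
            then show ?thesis
              using ug by (simp add: r[OF \<alpha> ug] free_pair.linear_sum[OF lin_rep[OF g]]
                  free_pair.linear_scale[OF lin_rep[OF g]] s_def)
          qed
          then have "(\<Sum>g\<in>symgroup d. \<rho> g (young_act \<alpha> (\<rho> (inv g) (slice F u))))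
              = (\<Sum>g\<in>symgroup d. \<Sum>x\<in>B \<alpha>. smul (coef (s \<alpha> x) (u \<circ> g)) (\<rho> g x))"
            by (rule sum.cong[OF refl])
          also have "\<dots> = (\<Sum>x\<in>B \<alpha>. conv (s \<alpha> x) x u)"
            unfolding conv_def by (rule sum.swap)
          finally show ?thesis .
        qed
        then show ?thesis
          by (subst spec[OF a, of "slice F u"]) (intro sum.cong refl arg_cong2[where f = smul])
      qed
      have "F = (\<Sum>\<alpha>\<in>?P. smul (a \<alpha>) (\<Sum>x\<in>B \<alpha>. conv_map m (s \<alpha> x) x))"
      proof (rule poly_mapping_eqI)
        fix p
        show "coef F p = coef (\<Sum>\<alpha>\<in>?P. smul (a \<alpha>) (\<Sum>x\<in>B \<alpha>. conv_map m (s \<alpha> x) x)) p"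
        proof (cases p)
          case (Pair u y)
          show ?thesis
          proof (cases "u \<in> words d m")
            case True
            have "coef F p = coef (slice F u) y" by (simp add: Pair)
            then show ?thesis
              using True by (simp add: slice_F[OF True] Pair conv_map_def coef_glue coef_sum)
          next
            case False
            then show ?thesis
              using F by (simp add: equivariant_maps_def in_free_on_iff Pair coef_sum conv_map_def coef_glue)
          qed
        qed
      qed
      also have "\<dots> \<in> ?span"
        by (intro free_vs.span_sum free_vs.span_scale gen) (simp_all add: s_def)
      finally show "F \<in> ?span" .
    qed
  qed
  also have "card ?I = (\<Sum>\<alpha>\<in>?P. card (C \<alpha> \<times> B \<alpha>))"
    using B C by (intro card_SigmaI finite_partitions) auto
  also have "\<dots> = (\<Sum>\<alpha>\<in>?P. free_vs.dim (young_act \<alpha> ` M) * free_vs.dim (schur_functor \<alpha> m))"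
    using B C by (intro sum.cong refl) (simp add: card_cartesian_product)
  finally show ?thesis .
qed

end

section \<open>Products of determinants\<close>

text \<open>Extracting the multilinear part: evaluate at the partial sums of the unit vectors at
  \<open>c 0, \<dots>, c (d - 1)\<close> and use inclusion and exclusion.\<close>

lemma polarization:
  fixes F :: "(nat \<Rightarrow> 'v) \<Rightarrow> complex"
  assumes J: "finite J"
    and zero: "\<And>y. (\<Sum>c\<in>{..<d} \<rightarrow>\<^sub>E J. F c * (\<Prod>i<d. y (c i))) = 0"
    and c: "c \<in> {..<d} \<rightarrow>\<^sub>E J"
  shows "(\<Sum>g\<in>symgroup d. F (c \<circ> g)) = 0"
proof -
  define U where "U = {..<d}"
  define rf where "rf f = restrict (c \<circ> f) U" for f
  have finU: "finite U" by (simp add: U_def)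
  have rf: "rf f \<in> U \<rightarrow>\<^sub>E J" if "f \<in> U \<rightarrow>\<^sub>E S" "S \<subseteq> U" for f S
    using that c by (auto simp: rf_def U_def PiE_iff)
  have H: "(\<Sum>f\<in>U \<rightarrow>\<^sub>E S. F (rf f)) = 0" if S: "S \<subseteq> U" for S
  proof -
    have finS: "finite S" using S finU finite_subset by blast
    \<comment> \<open>The sum of the unit vectors at \<open>c j\<close> for j in S. Expanding the
      product at this y gives one term for each map f into S, at the word
      \<open>rf f\<close>.\<close>
    define y where "y v = (\<Sum>j\<in>S. if c j = v then 1 else 0 :: complex)" for v
    have "(\<Prod>i<d. y (c' i)) = (\<Sum>f\<in>U \<rightarrow>\<^sub>E S. if c' = rf f then 1 else 0)"
      if c': "c' \<in> U \<rightarrow>\<^sub>E J" for c'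
    proof -
      have "(\<Prod>i<d. y (c' i)) = (\<Sum>f\<in>U \<rightarrow>\<^sub>E S. \<Prod>i\<in>U. if c (f i) = c' i then 1 else 0)"
        unfolding y_def U_def[symmetric] by (rule prod_sum_PiE) (simp_all add: finU finS)
      also have "\<dots> = (\<Sum>f\<in>U \<rightarrow>\<^sub>E S. if c' = rf f then 1 else 0)"
      proof (rule sum.cong[OF refl])
        fix f assume "f \<in> U \<rightarrow>\<^sub>E S"
        have "c' = rf f \<longleftrightarrow> (\<forall>i\<in>U. c (f i) = c' i)"
        proof
          assume "\<forall>i\<in>U. c (f i) = c' i"
          then show "c' = rf f"
            using c' by (intro PiE_ext[OF c' rf[OF \<open>f \<in> U \<rightarrow>\<^sub>E S\<close> S]]) (simp add: rf_def)
        qed (simp add: rf_def)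
        then show "(\<Prod>i\<in>U. if c (f i) = c' i then 1 else 0) = (if c' = rf f then 1 else 0 :: complex)"
          using finU by (auto intro: prod.neutral simp: prod_zero_iff)
      qed
      finally show ?thesis .
    qed
    then have "0 = (\<Sum>c'\<in>U \<rightarrow>\<^sub>E J. F c' * (\<Sum>f\<in>U \<rightarrow>\<^sub>E S. if c' = rf f then 1 else 0))"
      using zero[of y] by (simp add: U_def)
    also have "\<dots> = (\<Sum>f\<in>U \<rightarrow>\<^sub>E S. \<Sum>c'\<in>U \<rightarrow>\<^sub>E J. if c' = rf f then F c' else 0)"
      by (subst sum.swap) (simp add: sum_distrib_left if_distrib[of "\<lambda>z. _ * z"] cong: if_cong)
    also have "\<dots> = (\<Sum>f\<in>U \<rightarrow>\<^sub>E S. F (rf f))"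
      using rf[OF _ S] finU J by (intro sum.cong refl) (simp add: finite_PiE)
    finally show ?thesis by simp
  qed
  \<comment> \<open>With these alternating signs, summation over S keeps only the maps f that are
    onto, and these are the permutations.\<close>
  define sg where "sg S = (-1 :: complex) ^ card (U - S)" for S
  have incl_excl: "(\<Sum>S\<in>Pow U. if f \<in> U \<rightarrow>\<^sub>E S then sg S else 0) = (if f ` U = U then 1 else 0)"
    if f: "f \<in> U \<rightarrow>\<^sub>E U" for f
  proof -
    have "(\<Sum>S\<in>Pow U. if f \<in> U \<rightarrow>\<^sub>E S then sg S else 0)
        = (\<Sum>S\<in>Pow U. (\<Prod>x\<in>S. 1) * (\<Prod>x\<in>U - S. if x \<in> f ` U then 0 else -1))"
    proof (rule sum.cong[OF refl])
      fix S assume S: "S \<in> Pow U"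
      have "f \<in> U \<rightarrow>\<^sub>E S \<longleftrightarrow> (\<forall>x\<in>U - S. x \<notin> f ` U)"
        using f by (auto simp: PiE_iff)
      then show "(if f \<in> U \<rightarrow>\<^sub>E S then sg S else 0)
          = (\<Prod>x\<in>S. 1) * (\<Prod>x\<in>U - S. if x \<in> f ` U then 0 else -1)"
        using finU by (auto simp: sg_def prod_zero_iff)
    qed
    also have "\<dots> = (\<Prod>x\<in>U. 1 + (if x \<in> f ` U then 0 else -1))"
      by (rule prod_add[OF finU, symmetric])
    also have "\<dots> = (if f ` U = U then 1 else 0)"
    proof (cases "f ` U = U")
      case True
      then show ?thesis by simp
    next
      case False
      then obtain x where "x \<in> U" "x \<notin> f ` U"
        using f by (auto simp: PiE_iff)
      then have "(\<Prod>x\<in>U. 1 + (if x \<in> f ` U then 0 else -1 :: complex)) = 0"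
        by (intro prod_zero[OF finU]) auto
      then show ?thesis using False by simp
    qed
    finally show ?thesis .
  qed
  have "0 = (\<Sum>S\<in>Pow U. sg S * (\<Sum>f\<in>U \<rightarrow>\<^sub>E S. F (rf f)))"
    using H by simp
  also have "\<dots> = (\<Sum>S\<in>Pow U. \<Sum>f\<in>U \<rightarrow>\<^sub>E U. F (rf f) * (if f \<in> U \<rightarrow>\<^sub>E S then sg S else 0))"
  proof (rule sum.cong[OF refl])
    fix S assume S: "S \<in> Pow U"
    then have "U \<rightarrow>\<^sub>E S \<subseteq> U \<rightarrow>\<^sub>E U" by (auto simp: PiE_iff)
    then have "(\<Sum>f\<in>U \<rightarrow>\<^sub>E U. F (rf f) * (if f \<in> U \<rightarrow>\<^sub>E S then sg S else 0)) = (\<Sum>f\<in>U \<rightarrow>\<^sub>E S. F (rf f) * sg S)"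
      using finU by (intro sum.mono_neutral_cong_right) (auto intro: finite_PiE)
    then show "sg S * (\<Sum>f\<in>U \<rightarrow>\<^sub>E S. F (rf f)) = (\<Sum>f\<in>U \<rightarrow>\<^sub>E U. F (rf f) * (if f \<in> U \<rightarrow>\<^sub>E S then sg S else 0))"
      by (simp add: sum_distrib_left mult.commute)
  qed
  also have "\<dots> = (\<Sum>f\<in>U \<rightarrow>\<^sub>E U. F (rf f) * (\<Sum>S\<in>Pow U. if f \<in> U \<rightarrow>\<^sub>E S then sg S else 0))"
    by (subst sum.swap) (simp only: sum_distrib_left)
  also have "\<dots> = (\<Sum>f\<in>U \<rightarrow>\<^sub>E U. if f ` U = U then F (rf f) else 0)"
    by (intro sum.cong refl) (simp add: incl_excl)
  also have "\<dots> = (\<Sum>f\<in>{f \<in> U \<rightarrow>\<^sub>E U. f ` U = U}. F (rf f))"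
    using finU by (simp add: sum.inter_filter finite_PiE)
  also have "\<dots> = (\<Sum>g\<in>symgroup d. F (c \<circ> g))"
  proof (rule sum.reindex_bij_witness[of _ "\<lambda>g. restrict g U" "\<lambda>f x. if x \<in> U then f x else x"])
    fix f assume f: "f \<in> {f \<in> U \<rightarrow>\<^sub>E U. f ` U = U}"
    let ?g = "\<lambda>x. if x \<in> U then f x else x"
    show "restrict ?g U = f"
      using f by (auto simp: fun_eq_iff PiE_iff extensional_def restrict_def)
    have "inj_on f U"
      using f finU by (intro eq_card_imp_inj_on) auto
    then have "bij_betw f U U"
      using f by (simp add: bij_betw_def)
    then have "bij_betw ?g U U"
      by (rule bij_betw_cong[THEN iffD2, rotated]) simp
    then show "?g \<in> symgroup d"
      unfolding symgroup_def U_def[symmetric] mem_Collect_eq by (rule bij_imp_permutes) simp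
    have "c \<circ> ?g = rf f"
      using c by (auto simp: fun_eq_iff rf_def restrict_def PiE_iff extensional_def U_def)
    then show "F (c \<circ> ?g) = F (rf f)" by simp
  next
    fix g assume g: "g \<in> symgroup d"
    then have gp: "g permutes U" by (simp add: symgroup_def U_def)
    show "restrict g U \<in> {f \<in> U \<rightarrow>\<^sub>E U. f ` U = U}"
      using permutes_image[OF gp] permutes_in_image[OF gp] by auto
    show "(\<lambda>x. if x \<in> U then restrict g U x else x) = g"
      using gp by (auto simp: fun_eq_iff permutes_def)
  qed
  finally show ?thesis by simp
qed

section \<open>The product of determinants as a tensor\<close>

lemma prod_boxes: "(\<Prod>x<k * n. f x) = (\<Prod>j<k. \<Prod>i<n. f (i * k + j))" for k n :: nat
proof -
  have "(\<Prod>x<k * n. f x) = (\<Prod>i<n. prod f {i * k..<i * k + k})"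
    by (simp add: prod.nat_group mult.commute)
  also have "\<dots> = (\<Prod>i<n. \<Prod>j<k. f (i * k + j))"
    by (simp add: prod.atLeastLessThan_shift_0[of f "_ * k"] atLeast0LessThan)
  also have "\<dots> = (\<Prod>j<k. \<Prod>i<n. f (i * k + j))"
    by (rule prod.swap)
  finally show ?thesis .
qed

lemma box_index_less: "i < n \<Longrightarrow> j < k \<Longrightarrow> i * k + j < k * n" for i j k n :: nat
proof -
  assume "i < n" "j < k"
  then have "i * k + j < Suc i * k" by simp
  also have "\<dots> \<le> n * k" using \<open>i < n\<close> by (intro mult_le_mono1) simp
  finally show ?thesis by (simp add: mult.commute)
qed

definition perm_families :: "nat \<Rightarrow> nat \<Rightarrow> (nat \<Rightarrow> nat \<Rightarrow> nat) set" where
  "perm_families n k = {..<k} \<rightarrow>\<^sub>E {p. p permutes {..<n}}"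

text \<open>Position x is the box in row \<open>x div k\<close> and column \<open>x mod k\<close> of
  the rectangle, so these are the words all of whose columns are permutations.\<close>

definition family_word :: "nat \<Rightarrow> nat \<Rightarrow> (nat \<Rightarrow> nat \<Rightarrow> nat) \<Rightarrow> nat \<Rightarrow> nat" where
  "family_word n k \<sigma> = (\<lambda>x\<in>{..<k * n}. \<sigma> (x mod k) (x div k))"

text \<open>The product of the determinants of the columns of a word; column \<open>j\<close> consists of the
  positions \<open>i * k + j\<close> and is read as an \<open>n\<close>-tuple of basis vectors of \<open>\<complex>\<^sup>n\<close>.\<close>

definition det_tensor :: "nat \<Rightarrow> nat \<Rightarrow> (nat \<Rightarrow> nat) \<Rightarrow> int" where
  "det_tensor n k w = (\<Sum>\<sigma>\<in>perm_families n k. (\<Prod>j<k. sign (\<sigma> j)) * (if w = family_word n k \<sigma> then 1 else 0))"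

lemma family_word_words: "\<sigma> \<in> perm_families n k \<Longrightarrow> family_word n k \<sigma> \<in> words (k * n) n"
proof -
  assume \<sigma>: "\<sigma> \<in> perm_families n k"
  have "\<sigma> (x mod k) (x div k) < n" if "x < k * n" for x
  proof -
    have k: "k > 0" using that by (cases k) auto
    then have "\<sigma> (x mod k) permutes {..<n}"
      using \<sigma> by (auto simp: perm_families_def PiE_iff)
    moreover have "x div k < n"
      using that k by (simp add: less_mult_imp_div_less mult.commute)
    ultimately show ?thesis
      using permutes_in_image by fastforce
  qed
  then show ?thesis
    by (auto simp: family_word_def)
qed

text \<open>The Leibniz formula for each column, multiplied out. With the unit matrix for A it gives
  the product formula for \<open>det_tensor\<close>, with a transpose the relative
  invariance.\<close>

lemma det_tensor_mult:
  assumes A: "A \<in> carrier_mat n n"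
  shows "(\<Sum>w'\<in>words (k * n) n. of_int (det_tensor n k w') * (\<Prod>x<k * n. A $$ (w' x, w x)))
    = (\<Prod>j<k. det (mat n n (\<lambda>(i, a). A $$ (a, w (i * k + j)))) :: complex)"
proof -
  let ?S = "\<lambda>\<sigma>. of_int (\<Prod>j<k. sign (\<sigma> j)) :: complex"
  let ?Pr = "\<lambda>w'. \<Prod>x<k * n. A $$ (w' x, w x)"
  have "(\<Sum>w'\<in>words (k * n) n. of_int (det_tensor n k w') * ?Pr w')
      = (\<Sum>w'\<in>words (k * n) n. \<Sum>\<sigma>\<in>perm_families n k. if w' = family_word n k \<sigma> then ?S \<sigma> * ?Pr w' else 0)"
  proof (rule sum.cong[OF refl])
    fix w'
    have "of_int (det_tensor n k w') = (\<Sum>\<sigma>\<in>perm_families n k. ?S \<sigma> * (if w' = family_word n k \<sigma> then 1 else 0))"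
      unfolding det_tensor_def of_int_sum by (rule sum.cong) simp_all
    then have "of_int (det_tensor n k w') * ?Pr w'
        = (\<Sum>\<sigma>\<in>perm_families n k. ?S \<sigma> * (if w' = family_word n k \<sigma> then 1 else 0) * ?Pr w')"
      by (simp only: sum_distrib_right)
    also have "\<dots> = (\<Sum>\<sigma>\<in>perm_families n k. if w' = family_word n k \<sigma> then ?S \<sigma> * ?Pr w' else 0)"
      by (rule sum.cong) simp_all
    finally show "of_int (det_tensor n k w') * ?Pr w'
        = (\<Sum>\<sigma>\<in>perm_families n k. if w' = family_word n k \<sigma> then ?S \<sigma> * ?Pr w' else 0)" .
  qed
  also have "\<dots> = (\<Sum>\<sigma>\<in>perm_families n k. \<Sum>w'\<in>words (k * n) n. if w' = family_word n k \<sigma> then ?S \<sigma> * ?Pr w' else 0)"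
    by (rule sum.swap)
  also have "\<dots> = (\<Sum>\<sigma>\<in>perm_families n k. ?S \<sigma> * ?Pr (family_word n k \<sigma>))"
    by (intro sum.cong refl) (simp add: family_word_words)
  also have "\<dots> = (\<Sum>\<sigma>\<in>perm_families n k. \<Prod>j<k. of_int (sign (\<sigma> j)) * (\<Prod>i<n. A $$ (\<sigma> j i, w (i * k + j))))"
  proof (rule sum.cong[OF refl])
    fix \<sigma> assume "\<sigma> \<in> perm_families n k"
    have "?Pr (family_word n k \<sigma>) = (\<Prod>j<k. \<Prod>i<n. A $$ (\<sigma> j i, w (i * k + j)))"
      unfolding prod_boxes by (intro prod.cong refl) (simp add: family_word_def box_index_less)
    then show "?S \<sigma> * ?Pr (family_word n k \<sigma>)
        = (\<Prod>j<k. of_int (sign (\<sigma> j)) * (\<Prod>i<n. A $$ (\<sigma> j i, w (i * k + j))))"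
      by (simp add: prod.distrib)
  qed
  also have "\<dots> = (\<Prod>j<k. \<Sum>p | p permutes {..<n}. of_int (sign p) * (\<Prod>i<n. A $$ (p i, w (i * k + j))))"
    unfolding perm_families_def by (rule prod_sum_PiE[symmetric]) (simp_all add: finite_permutations)
  also have "\<dots> = (\<Prod>j<k. det (mat n n (\<lambda>(i, a). A $$ (a, w (i * k + j)))))"
  proof (intro prod.cong refl)
    fix j
    have "det (mat n n (\<lambda>(i, a). A $$ (a, w (i * k + j))))
        = (\<Sum>p | p permutes {..<n}. of_int (sign p) * (\<Prod>i<n. mat n n (\<lambda>(i, a). A $$ (a, w (i * k + j))) $$ (i, p i)))"
      by (subst det_def'[of _ n]) (simp_all add: atLeast0LessThan)
    also have "\<dots> = (\<Sum>p | p permutes {..<n}. of_int (sign p) * (\<Prod>i<n. A $$ (p i, w (i * k + j))))"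
    proof (intro sum.cong refl arg_cong2[where f = "(*)"] prod.cong)
      fix p i assume "p \<in> {p. p permutes {..<n}}" "i \<in> {..<n}"
      then have "p i < n" using permutes_in_image by fastforce
      then show "mat n n (\<lambda>(i, a). A $$ (a, w (i * k + j))) $$ (i, p i) = A $$ (p i, w (i * k + j))"
        using \<open>i \<in> {..<n}\<close> by simp
    qed
    finally show "(\<Sum>p | p permutes {..<n}. of_int (sign p) * (\<Prod>i<n. A $$ (p i, w (i * k + j))))
        = det (mat n n (\<lambda>(i, a). A $$ (a, w (i * k + j))))" by simp
  qed
  finally show ?thesis .
qed

definition column_mat :: "nat \<Rightarrow> nat \<Rightarrow> (nat \<Rightarrow> nat) \<Rightarrow> nat \<Rightarrow> complex mat" where
  "column_mat n k w j = mat n n (\<lambda>(i, b). if w (i * k + j) = b then 1 else 0)"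

lemma column_mat_carrier [simp]: "column_mat n k w j \<in> carrier_mat n n"
  by (simp add: column_mat_def)

lemma words_less: "w \<in> words d n \<Longrightarrow> x < d \<Longrightarrow> w x < n"
  by auto

lemma det_tensor_eq_prod:
  assumes w: "w \<in> words (k * n) n"
  shows "of_int (det_tensor n k w) = (\<Prod>j<k. det (column_mat n k w j))"
proof -
  have "(\<Prod>x<k * n. (1\<^sub>m n :: complex mat) $$ (w' x, w x)) = (if w' = w then 1 else 0)"
    if w': "w' \<in> words (k * n) n" for w'
  proof (cases "w' = w")
    case True
    then show ?thesis using words_less[OF w] by simp
  next
    case False
    then obtain x where x: "x < k * n" "w' x \<noteq> w x"
      using PiE_ext[OF w' w] by blast
    then have "(1\<^sub>m n :: complex mat) $$ (w' x, w x) = 0"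
      using words_less[OF w] words_less[OF w'] by simp
    then show ?thesis
      using False x by (auto intro!: prod_zero)
  qed
  then have "of_int (det_tensor n k w)
      = (\<Sum>w'\<in>words (k * n) n. of_int (det_tensor n k w') * (\<Prod>x<k * n. (1\<^sub>m n :: complex mat) $$ (w' x, w x)))"
    using w by (simp add: if_distrib[of "\<lambda>z. _ * z"] cong: if_cong)
  also have "\<dots> = (\<Prod>j<k. det (mat n n (\<lambda>(i, a). (1\<^sub>m n :: complex mat) $$ (a, w (i * k + j)))))"
    by (rule det_tensor_mult) simp
  also have "\<dots> = (\<Prod>j<k. det (column_mat n k w j))"
  proof (intro prod.cong refl arg_cong[of _ _ det])
    fix j assume "j \<in> {..<k}"
    then show "mat n n (\<lambda>(i, a). (1\<^sub>m n :: complex mat) $$ (a, w (i * k + j))) = column_mat n k w j"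
      unfolding column_mat_def using words_less[OF w] box_index_less[of _ n j k]
      by (intro cong_mat) auto
  qed
  finally show ?thesis .
qed

text \<open>The action of A replaces each \<open>column_mat n k w j\<close> by its product with A,
  so each of the k determinants gains the factor \<open>det A\<close>.\<close>

lemma det_tensor_semi_invariant:
  assumes A: "A \<in> carrier_mat n n" and w: "w \<in> words (k * n) n"
  shows "(\<Sum>w'\<in>words (k * n) n. of_int (det_tensor n k w') * (\<Prod>x<k * n. A $$ (w x, w' x)))
    = det A ^ k * (of_int (det_tensor n k w) :: complex)"
proof -
  let ?T = "transpose_mat A"
  have T: "?T \<in> carrier_mat n n" using A by simp
  have "(\<Sum>w'\<in>words (k * n) n. of_int (det_tensor n k w') * (\<Prod>x<k * n. A $$ (w x, w' x)))
      = (\<Sum>w'\<in>words (k * n) n. of_int (det_tensor n k w') * (\<Prod>x<k * n. ?T $$ (w' x, w x)))"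
    using A words_less[OF w] words_less by (intro sum.cong refl arg_cong2[where f = "(*)"] prod.cong) auto
  also have "\<dots> = (\<Prod>j<k. det (mat n n (\<lambda>(i, a). ?T $$ (a, w (i * k + j)))))"
    by (rule det_tensor_mult[OF T])
  also have "\<dots> = (\<Prod>j<k. det A * det (column_mat n k w j))"
  proof (intro prod.cong refl)
    fix j assume "j \<in> {..<k}"
    then have wj: "w (i * k + j) < n" if "i < n" for i
      using that by (intro words_less[OF w] box_index_less) auto
    have "mat n n (\<lambda>(i, a). ?T $$ (a, w (i * k + j))) = column_mat n k w j * A"
    proof (rule eq_matI)
      fix i a assume ia: "i < dim_row (column_mat n k w j * A)" "a < dim_col (column_mat n k w j * A)"
      then have ia': "i < n" "a < n" using A by (simp_all add: column_mat_def)
      have "(column_mat n k w j * A) $$ (i, a) = (\<Sum>b = 0..<n. if w (i * k + j) = b then A $$ (b, a) else 0)"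
        using ia' A by (simp add: column_mat_def scalar_prod_def if_distrib[of "\<lambda>z. z * _"] cong: if_cong)
      also have "\<dots> = A $$ (w (i * k + j), a)"
        using wj[OF ia'(1)] by simp
      finally show "mat n n (\<lambda>(i, a). ?T $$ (a, w (i * k + j))) $$ (i, a) = (column_mat n k w j * A) $$ (i, a)"
        using ia' A wj[OF ia'(1)] by simp
    qed (use A in \<open>simp_all add: column_mat_def\<close>)
    then show "det (mat n n (\<lambda>(i, a). ?T $$ (a, w (i * k + j)))) = det A * det (column_mat n k w j)"
      using det_mult[OF column_mat_carrier A] by simp
  qed
  also have "\<dots> = det A ^ k * of_int (det_tensor n k w)"
    by (simp add: prod.distrib det_tensor_eq_prod[OF w])
  finally show ?thesis .
qed

text \<open>The word with letter i throughout row i of the rectangle. It is the diagonal term of all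
  the determinants, is fixed by the row group, and its translates are the words along which
  invariants are read off later.\<close>

definition row_word :: "nat \<Rightarrow> nat \<Rightarrow> nat \<Rightarrow> nat" where
  "row_word n k = (\<lambda>x\<in>{..<k * n}. x div k)"

lemma row_word_words: "row_word n k \<in> words (k * n) n"
  by (auto simp: row_word_def less_mult_imp_div_less mult.commute)

lemma det_tensor_row_word: "det_tensor n k (row_word n k) = 1"
proof -
  have "column_mat n k (row_word n k) j = 1\<^sub>m n" if "j < k" for j
    unfolding column_mat_def
    by (rule eq_matI) (use that in \<open>auto simp: row_word_def box_index_less\<close>)
  then have "of_int (det_tensor n k (row_word n k)) = (1 :: complex)"
    by (simp add: det_tensor_eq_prod[OF row_word_words])
  then show ?thesis by (metis of_int_eq_1_iff)
qed

lemma det_tensor_transpose: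
  assumes w: "w \<in> words (k * n) n" and i: "i1 < n" "i2 < n" "i1 \<noteq> i2" and j: "j < k"
  shows "det_tensor n k (w \<circ> transpose (i1 * k + j) (i2 * k + j)) = - det_tensor n k w"
proof -
  let ?t = "transpose (i1 * k + j) (i2 * k + j)"
  have "?t \<in> symgroup (k * n)"
    using box_index_less[OF i(1) j] box_index_less[OF i(2) j]
    by (auto simp: symgroup_def intro: permutes_swap_id)
  then have wt: "w \<circ> ?t \<in> words (k * n) n"
    by (rule words_comp[OF w])
  have eq_iff: "i * k + j' = i' * k + j'' \<longleftrightarrow> i = i' \<and> j' = j''" if "j' < k" "j'' < k" for i i' j' j''
  proof
    assume eq: "i * k + j' = i' * k + j''"
    have "(i * k + j') div k = i" "(i' * k + j'') div k = i'"
      using that by auto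
    then have "i = i'" using eq by simp
    then show "i = i' \<and> j' = j''" using eq by simp
  qed simp
  have same: "det (column_mat n k (w \<circ> ?t) j') = det (column_mat n k w j')" if "j' < k" "j' \<noteq> j" for j'
  proof -
    have "?t (i * k + j') = i * k + j'" for i
      using that j by (intro transpose_apply_other) (simp_all add: eq_iff)
    then show ?thesis by (simp add: column_mat_def)
  qed
  have swap: "det (column_mat n k (w \<circ> ?t) j) = - det (column_mat n k w j)"
  proof -
    let ?p = "transpose i1 i2"
    have p: "?p permutes {0..<n}"
      using i by (auto intro: permutes_swap_id)
    have "?t (i * k + j) = ?p i * k + j" for i
      using j by (simp add: transpose_def eq_iff)
    then have "column_mat n k (w \<circ> ?t) j = mat n n (\<lambda>(i, b). column_mat n k w j $$ (?p i, b))"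
      using permutes_in_image[OF p] by (intro eq_matI) (auto simp: column_mat_def)
    then have "det (column_mat n k (w \<circ> ?t) j) = of_int (sign ?p) * det (column_mat n k w j)"
      using det_permute_rows[OF column_mat_carrier p] by simp
    then show ?thesis using i(3) by (simp add: sign_swap_id)
  qed
  have "of_int (det_tensor n k (w \<circ> ?t)) = (of_int (- det_tensor n k w) :: complex)"
    unfolding det_tensor_eq_prod[OF wt] of_int_minus det_tensor_eq_prod[OF w]
    using j same swap by (simp add: prod.remove[of "{..<k}" j])
  then show ?thesis by (simp only: of_int_eq_iff)
qed

section \<open>The rectangular tableau\<close>

lemma sum_rect_partition: "sum (rect_partition k n) {..<i} = min i n * k"
  by (induction i) (auto simp: rect_partition_def min_def)

lemma rect_partition_partitions: "rect_partition k n \<in> partitions (k * n)"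
proof -
  have sub: "{i. rect_partition k n i \<noteq> 0} \<subseteq> {..<n}"
    by (auto simp: rect_partition_def split: if_splits)
  then have "partition_size (rect_partition k n) = sum (rect_partition k n) {..<n}"
    unfolding partition_size_def by (intro sum.mono_neutral_left) auto
  then show ?thesis
    using finite_subset[OF sub] by (simp add: partitions_def sum_rect_partition antimono_def rect_partition_def)
qed

lemma rect_tableau_col:
  assumes "x \<in> tableau_col (rect_partition k n) j"
  obtains i where "i < n" "j < k" "x = i * k + j"
  using assms by (auto simp: tableau_col_box box_def sum_rect_partition rect_partition_def split: if_splits)

lemma rect_box: "i < n \<Longrightarrow> box (rect_partition k n) i j = i * k + j"
  by (simp add: box_def sum_rect_partition)

text \<open>By induction on the number of points moved by \<open>q\<close>, splitting off transpositions within a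
  column.\<close>

lemma det_tensor_col_group:
  assumes "q \<in> col_group (rect_partition k n)" "w \<in> words (k * n) n"
  shows "det_tensor n k (w \<circ> q) = sign q * det_tensor n k w"
  using assms
proof (induction "card {x. q x \<noteq> x}" arbitrary: q w rule: less_induct)
  case less
  let ?\<alpha> = "rect_partition k n"
  note \<alpha> = rect_partition_partitions[of k n]
  have q: "q \<in> symgroup (k * n)" by (rule col_group_symgroup[OF \<alpha> less.prems(1)])
  show ?case
  proof (cases "q = id")
    case False
    then obtain x where x: "q x \<noteq> x" by (auto simp: fun_eq_iff)
    then have "x < k * n"
      using q by (auto simp: symgroup_def permutes_def)
    then obtain i j where ij: "j < ?\<alpha> i" "x = box ?\<alpha> i j"
      by (rule partition_box_cases[OF \<alpha>])
    then have xc: "x \<in> tableau_col ?\<alpha> j" by (simp add: in_tableau_col_box)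
    have "q ` tableau_col ?\<alpha> j = tableau_col ?\<alpha> j"
      using less.prems(1) by (simp add: col_group_def)
    then have yc: "q x \<in> tableau_col ?\<alpha> j" using xc by blast
    obtain i1 where i1: "i1 < n" "j < k" "x = i1 * k + j"
      using xc by (rule rect_tableau_col)
    obtain i2 where i2: "i2 < n" "q x = i2 * k + j"
      using yc by (rule rect_tableau_col)
    define t where "t = transpose x (q x)"
    have t: "t \<in> col_group ?\<alpha>"
      unfolding t_def col_group_eq[OF \<alpha>]
    proof (rule set_stab_transpose)
      show "x \<in> tableau_col ?\<alpha> j' \<longleftrightarrow> q x \<in> tableau_col ?\<alpha> j'" for j'
        using xc yc tableau_cols_disjoint by metis
    qed (use \<open>x < k * n\<close> symgroup_lt[OF q] in auto)
    have t': "t \<in> symgroup (k * n)" by (rule col_group_symgroup[OF \<alpha> t])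
    define q' where "q' = t \<circ> q"
    have q': "q' \<in> col_group ?\<alpha>"
      using t less.prems(1) unfolding q'_def col_group_eq[OF \<alpha>] by (rule set_stab_comp)
    have tt: "t \<circ> t = id" by (simp add: t_def)
    have q_eq: "q = t \<circ> q'"
      by (simp add: q'_def o_assoc tt)
    have fin: "finite {x. q x \<noteq> x}"
    proof (rule finite_subset)
      show "{x. q x \<noteq> x} \<subseteq> {..<k * n}"
        using q by (auto simp: symgroup_def permutes_def)
    qed simp
    have "{z. q' z \<noteq> z} \<subset> {z. q z \<noteq> z}"
    proof
      show "{z. q' z \<noteq> z} \<subseteq> {z. q z \<noteq> z}"
      proof clarify
        fix z assume "q' z \<noteq> z" and qz: "q z = z"
        then have "t z \<noteq> z" by (simp add: q'_def)
        then have "z = x \<or> z = q x" by (auto simp: t_def transpose_def split: if_splits)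
        then have "z = x"
          using qz symgroup_inv_apply(1)[OF q] by metis
        then show False using x qz by simp
      qed
      have "q' x = x" by (simp add: q'_def t_def)
      then show "{z. q' z \<noteq> z} \<noteq> {z. q z \<noteq> z}" using x by blast
    qed
    then have "card {z. q' z \<noteq> z} < card {z. q z \<noteq> z}"
      by (rule psubset_card_mono[OF fin])
    from less.hyps[OF this q' words_comp[OF less.prems(2) t']]
    have "det_tensor n k (w \<circ> q) = sign q' * det_tensor n k (w \<circ> t)"
      by (simp add: q_eq o_assoc)
    also have "i1 \<noteq> i2" using x i1 i2 by auto
    then have "det_tensor n k (w \<circ> t) = - det_tensor n k w"
      using det_tensor_transpose[OF less.prems(2) i1(1) i2(1) _ i1(2)] by (simp add: t_def i1(3)[symmetric] i2(2)[symmetric])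
    also have "sign q' = - sign q"
      using symgroup_permutation[OF t'] symgroup_permutation[OF q] x
      by (simp add: q'_def sign_compose) (simp add: t_def sign_swap_id)
    finally show ?thesis by (simp only: minus_mult_minus)
  qed simp
qed

section \<open>The first fundamental theorem for \<open>SL\<^sub>n\<close>\<close>

definition sl_invariant :: "nat \<Rightarrow> nat \<Rightarrow> ((nat \<Rightarrow> nat) \<Rightarrow> complex) \<Rightarrow> bool" where
  "sl_invariant n d x \<longleftrightarrow> (\<forall>A\<in>special_linear n. \<forall>w\<in>words d n.
     (\<Sum>w'\<in>words d n. x w' * (\<Prod>i<d. A $$ (w i, w' i))) = x w)"

lemma sum_words_comp:
  assumes g: "g \<in> symgroup d"
  shows "(\<Sum>w\<in>words d n. f (w \<circ> g)) = (\<Sum>w\<in>words d n. f w)"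
  by (rule sum.reindex_bij_witness[of _ "\<lambda>w. w \<circ> inv g" "\<lambda>w. w \<circ> g"])
    (use g words_comp[OF _ g] words_comp[OF _ symgroup_inv[OF g]] in simp_all)

lemma prod_symgroup:
  assumes g: "g \<in> symgroup d"
  shows "(\<Prod>i<d. f (g i)) = (\<Prod>i<d. f i)"
  using prod.permute[of g "{..<d}" f] g by (simp add: symgroup_def o_def)

lemma sl_invariant_comp:
  assumes x: "sl_invariant n d x" and g: "g \<in> symgroup d"
  shows "sl_invariant n d (\<lambda>w. x (w \<circ> g))"
  unfolding sl_invariant_def
proof (intro ballI)
  fix A w assume A: "A \<in> special_linear n" and w: "w \<in> words d n"
  have "(\<Sum>w'\<in>words d n. x (w' \<circ> g) * (\<Prod>i<d. A $$ (w i, w' i)))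
      = (\<Sum>w'\<in>words d n. x (w' \<circ> g) * (\<Prod>i<d. A $$ ((w \<circ> g) i, (w' \<circ> g) i)))"
    using prod_symgroup[OF g, of "\<lambda>i. A $$ (w i, _ i)"]
    by (intro sum.cong refl arg_cong2[where f = "(*)"]) (simp add: prod_symgroup[OF g, of "\<lambda>i. A $$ (w i, _ i)"])
  also have "\<dots> = (\<Sum>w'\<in>words d n. x w' * (\<Prod>i<d. A $$ ((w \<circ> g) i, w' i)))"
    by (rule sum_words_comp[OF g])
  also have "\<dots> = x (w \<circ> g)"
    using x A words_comp[OF w g] unfolding sl_invariant_def by blast
  finally show "(\<Sum>w'\<in>words d n. x (w' \<circ> g) * (\<Prod>i<d. A $$ (w i, w' i))) = x (w \<circ> g)" .
qed

lemma sl_invariant_sum: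
  assumes "\<And>i. i \<in> I \<Longrightarrow> sl_invariant n d (x i)"
  shows "sl_invariant n d (\<lambda>w. \<Sum>i\<in>I. c i * x i w)"
  unfolding sl_invariant_def
proof (intro ballI)
  fix A w assume A: "A \<in> special_linear n" and w: "w \<in> words d n"
  have "(\<Sum>w'\<in>words d n. (\<Sum>i\<in>I. c i * x i w') * (\<Prod>i<d. A $$ (w i, w' i)))
      = (\<Sum>i\<in>I. c i * (\<Sum>w'\<in>words d n. x i w' * (\<Prod>i<d. A $$ (w i, w' i))))"
    unfolding sum_distrib_right sum_distrib_left by (subst sum.swap) (simp only: mult.assoc)
  also have "\<dots> = (\<Sum>i\<in>I. c i * x i w)"
    using assms A w unfolding sl_invariant_def by (intro sum.cong refl) simp
  finally show "(\<Sum>w'\<in>words d n. (\<Sum>i\<in>I. c i * x i w') * (\<Prod>i<d. A $$ (w i, w' i))) = (\<Sum>i\<in>I. c i * x i w)" .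
qed

lemma complex_nth_root_exists:
  assumes "n \<ge> 1"
  shows "\<exists>t :: complex. t ^ n = z"
proof -
  have "(rcis (root n (cmod z)) (Arg z / n)) ^ n = rcis (cmod z) (Arg z)"
    using assms by (simp add: DeMoivre2 real_root_pow_pos2)
  then show ?thesis by (auto simp: rcis_cmod_Arg)
qed

text \<open>An invariant of \<open>SL\<^sub>n\<close> is a relative invariant of \<open>GL\<^sub>n\<close> by scaling, and by continuity the
  identity extends to singular matrices.\<close>

lemma sl_invariant_semi_invariant:
  assumes n: "n \<ge> 1" and x: "sl_invariant n (k * n) x"
    and A: "A \<in> carrier_mat n n" and w: "w \<in> words (k * n) n"
  shows "(\<Sum>w'\<in>words (k * n) n. x w' * (\<Prod>i<k * n. A $$ (w i, w' i))) = det A ^ k * x w"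
proof -
  let ?W = "words (k * n) n"
  have regular: "(\<Sum>w'\<in>?W. x w' * (\<Prod>i<k * n. A $$ (w i, w' i))) = det A ^ k * x w"
    if A: "A \<in> carrier_mat n n" and nz: "det A \<noteq> 0" for A
  proof -
    \<comment> \<open>Dividing A by an n-th root of its determinant puts it into the special linear
      group; this is where \<open>n \<ge> 1\<close> enters.\<close>
    obtain t where t: "t ^ n = det A"
      using complex_nth_root_exists[OF n] by metis
    then have t0: "t \<noteq> 0" using nz n by (auto simp: power_0_left)
    let ?B = "inverse t \<cdot>\<^sub>m A"
    have "det ?B = 1"
      using A t nz by (simp add: power_inverse)
    then have "?B \<in> special_linear n"
      using A by (simp add: special_linear_def)
    then have "x w = (\<Sum>w'\<in>?W. x w' * (\<Prod>i<k * n. ?B $$ (w i, w' i)))"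
      using x w by (simp add: sl_invariant_def)
    also have "\<dots> = (\<Sum>w'\<in>?W. x w' * (inverse t ^ (k * n) * (\<Prod>i<k * n. A $$ (w i, w' i))))"
    proof (rule sum.cong[OF refl])
      fix w' assume w': "w' \<in> ?W"
      have "(\<Prod>i<k * n. ?B $$ (w i, w' i)) = (\<Prod>i<k * n. inverse t * A $$ (w i, w' i))"
        using A words_less[OF w] words_less[OF w'] by (intro prod.cong refl) auto
      then show "x w' * (\<Prod>i<k * n. ?B $$ (w i, w' i))
          = x w' * (inverse t ^ (k * n) * (\<Prod>i<k * n. A $$ (w i, w' i)))"
        by (simp add: prod.distrib)
    qed
    also have "\<dots> = inverse t ^ (k * n) * (\<Sum>w'\<in>?W. x w' * (\<Prod>i<k * n. A $$ (w i, w' i)))"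
      by (simp add: sum_distrib_left mult.left_commute)
    finally have e1: "t ^ (k * n) * x w = t ^ (k * n) * inverse t ^ (k * n) * (\<Sum>w'\<in>?W. x w' * (\<Prod>i<k * n. A $$ (w i, w' i)))"
      by (simp add: mult.assoc)
    have e2: "t ^ (k * n) * inverse t ^ (k * n) = 1"
      using t0 by (simp add: power_mult_distrib[symmetric])
    have e3: "t ^ (k * n) = det A ^ k"
      using t by (metis mult.commute power_mult)
    show ?thesis using e1 unfolding e2 unfolding e3 by simp
  qed
  \<comment> \<open>The entries of A - c 1. The function f below is the defect of the identity for
    this matrix, with the determinant expanded so that continuity in c is visible; it vanishes
    unless c is an eigenvalue of A.\<close>
  define e where "e c i j = A $$ (i, j) + (- c) * (if i = j then 1 else 0)" for c :: complex and i j
  define f where "f c = (\<Sum>w'\<in>?W. x w' * (\<Prod>i<k * n. e c (w i) (w' i)))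
      - (\<Sum>p\<in>{p. p permutes {0..<n}}. of_int (sign p) * (\<Prod>i=0..<n. e c i (p i))) ^ k * x w" for c
  have entry: "char_matrix A c $$ (i, j) = e c i j" if "i < n" "j < n" for c i j
    using that A by (simp add: char_matrix_def e_def)
  have f: "f c = (\<Sum>w'\<in>?W. x w' * (\<Prod>i<k * n. char_matrix A c $$ (w i, w' i))) - det (char_matrix A c) ^ k * x w" for c
  proof -
    have "(\<Prod>i<k * n. char_matrix A c $$ (w i, w' i)) = (\<Prod>i<k * n. e c (w i) (w' i))" if w': "w' \<in> ?W" for w'
      using words_less[OF w] words_less[OF w'] by (intro prod.cong refl entry) auto
    moreover have "det (char_matrix A c) = (\<Sum>p\<in>{p. p permutes {0..<n}}. of_int (sign p) * (\<Prod>i=0..<n. e c i (p i)))"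
    proof -
      have "(\<Prod>i=0..<n. char_matrix A c $$ (i, p i)) = (\<Prod>i=0..<n. e c i (p i))" if "p permutes {0..<n}" for p
        using permutes_in_image[OF that] by (intro prod.cong refl entry) auto
      then show ?thesis
        unfolding det_def'[OF char_matrix_closed[OF A]] by (intro sum.cong refl) simp
    qed
    ultimately show ?thesis by (simp add: f_def)
  qed
  let ?K = "{c. det (char_matrix A c) = 0}"
  have "char_poly A \<noteq> 0"
    using degree_monic_char_poly[OF A] by auto
  then have "finite {c. poly (char_poly A) c = 0}"
    by (rule poly_roots_finite)
  then have finK: "finite ?K"
    using eigenvalue_root_char_poly[OF A] eigenvalue_det[OF A] by simp
  have f0: "f c = 0" if "c \<notin> ?K" for c
    unfolding f using regular[OF char_matrix_closed[OF A]] that by simp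
  have "isCont f 0"
    unfolding f_def e_def by (intro continuous_intros)
  then have lim: "(f \<longlongrightarrow> f 0) (at 0)"
    by (simp add: isCont_def)
  have "eventually (\<lambda>c. \<forall>z\<in>?K. c \<noteq> z) (at 0)"
    by (rule eventually_ball_finite[OF finK]) (simp add: eventually_neq_at_within)
  then have "eventually (\<lambda>c. f c = 0) (at 0)"
    by (rule eventually_mono) (rule f0, blast)
  then have "(f \<longlongrightarrow> 0) (at 0)"
    by (rule tendsto_eventually)
  then have "f 0 = 0"
    by (rule tendsto_unique[OF at_neq_bot lim])
  moreover have "char_matrix A 0 = A"
    using A by (intro eq_matI) (auto simp: char_matrix_def)
  ultimately show ?thesis
    using f[of 0] by simp
qed

lemma det_tensor_sl_invariant: "sl_invariant n (k * n) (\<lambda>w. of_int (det_tensor n k w))"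
  by (simp add: sl_invariant_def special_linear_def det_tensor_semi_invariant)

text \<open>The factor left over in the first fundamental theorem: the inner products of
  \<open>det_tensor\<close> with its translates, summed over the stabilizer of
  \<open>row_word\<close>.\<close>

definition first_fund_const :: "nat \<Rightarrow> nat \<Rightarrow> int" where
  "first_fund_const n k = (\<Sum>g\<in>symgroup (k * n). if row_word n k \<circ> g = row_word n k
     then \<Sum>u\<in>words (k * n) n. det_tensor n k u * det_tensor n k (u \<circ> g) else 0)"

text \<open>Let R be the stabilizer of \<open>row_word\<close>. The constant times the order of R is
  the sum over all words u of the squares of the sums of \<open>det_tensor n k (u \<circ> g)\<close>
  over g in R. At u = \<open>row_word\<close> the inner sum is the order of R, hence not 0.\<close>

lemma first_fund_const_pos: "first_fund_const n k > 0"
proof -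
  let ?d = "k * n" and ?r = "row_word n k" and ?D = "det_tensor n k"
  let ?W = "words ?d n"
  let ?R = "{g \<in> symgroup ?d. ?r \<circ> g = ?r}"
  define N where "N h = (\<Sum>u\<in>?W. ?D u * ?D (u \<circ> h))" for h
  have const: "first_fund_const n k = (\<Sum>h\<in>?R. N h)"
    by (simp add: first_fund_const_def N_def sum.inter_filter)
  have finR: "finite ?R" by simp
  have shift: "(\<Sum>h\<in>?R. N (inv g \<circ> h)) = (\<Sum>h\<in>?R. N h)" if g: "g \<in> ?R" for g
  proof (rule sum.reindex_bij_witness[of _ "\<lambda>h. g \<circ> h" "\<lambda>h. inv g \<circ> h"])
    have gi: "?r \<circ> inv g = ?r"
    proof -
      have "?r \<circ> g = ?r" "g \<in> symgroup ?d" using g by simp_all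
      then show ?thesis using symgroup_cancel(3)[of g ?d ?r] by simp
    qed
    show "inv g \<circ> h \<in> ?R" if "h \<in> ?R" for h
      using that g gi by (simp add: o_assoc)
    show "g \<circ> h \<in> ?R" if "h \<in> ?R" for h
      using that g by (simp add: o_assoc)
    show "g \<circ> (inv g \<circ> h) = h" "inv g \<circ> (g \<circ> h) = h" for h
      using g by (simp_all add: symgroup_cancel[of g ?d])
  qed simp
  have "(\<Sum>u\<in>?W. (\<Sum>g\<in>?R. ?D (u \<circ> g))\<^sup>2) = (\<Sum>u\<in>?W. \<Sum>g\<in>?R. \<Sum>h\<in>?R. ?D (u \<circ> g) * ?D (u \<circ> h))"
    by (simp add: power2_eq_square sum_product)
  also have "\<dots> = (\<Sum>g\<in>?R. \<Sum>h\<in>?R. \<Sum>u\<in>?W. ?D (u \<circ> g) * ?D (u \<circ> h))"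
    by (subst sum.swap) (intro sum.cong refl sum.swap)
  also have "\<dots> = (\<Sum>g\<in>?R. \<Sum>h\<in>?R. N (inv g \<circ> h))"
  proof (intro sum.cong refl)
    fix g h assume g: "g \<in> ?R" and h: "h \<in> ?R"
    have "(\<Sum>u\<in>?W. ?D (u \<circ> g) * ?D (u \<circ> h)) = (\<Sum>u\<in>?W. ?D (u \<circ> inv g \<circ> g) * ?D (u \<circ> inv g \<circ> h))"
      using g sum_words_comp[of "inv g" ?d "\<lambda>u. ?D (u \<circ> g) * ?D (u \<circ> h)" n] by simp
    moreover have "u \<circ> inv g \<circ> g = u" for u :: "nat \<Rightarrow> nat"
      using g by (intro symgroup_cancel(4)[of g ?d]) simp
    ultimately show "(\<Sum>u\<in>?W. ?D (u \<circ> g) * ?D (u \<circ> h)) = N (inv g \<circ> h)"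
      by (simp only: N_def o_assoc)
  qed
  also have "\<dots> = (\<Sum>g\<in>?R. first_fund_const n k)"
    unfolding const by (rule sum.cong[OF refl shift])
  also have "\<dots> = int (card ?R) * first_fund_const n k"
    by simp
  finally have eq: "(\<Sum>u\<in>?W. (\<Sum>g\<in>?R. ?D (u \<circ> g))\<^sup>2) = int (card ?R) * first_fund_const n k" .
  have "(\<Sum>g\<in>?R. ?D (?r \<circ> g)) = (\<Sum>g\<in>?R. 1)"
    by (intro sum.cong refl) (simp add: det_tensor_row_word)
  then have sum_R: "(\<Sum>g\<in>?R. ?D (?r \<circ> g)) = int (card ?R)"
    by simp
  have "id \<in> ?R" by simp
  then have "card ?R > 0"
    using finR card_gt_0_iff by blast
  then have "0 < (\<Sum>g\<in>?R. ?D (?r \<circ> g))\<^sup>2"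
    unfolding sum_R by (intro zero_less_power) (simp only: of_nat_0_less_iff)
  also have "\<dots> \<le> (\<Sum>u\<in>?W. (\<Sum>g\<in>?R. ?D (u \<circ> g))\<^sup>2)"
    using row_word_words[of n k] by (intro member_le_sum) simp_all
  finally show ?thesis
    unfolding eq using \<open>card ?R > 0\<close> by (simp add: zero_less_mult_iff)
qed

text \<open>The first fundamental theorem for \<open>SL\<^sub>n\<close>: comparing the multilinear parts of the two sides of
  the relative invariance expresses every invariant tensor by products of determinants.\<close>

lemma first_fundamental_theorem:
  assumes n: "n \<ge> 1" and x: "sl_invariant n (k * n) x" and w: "w \<in> words (k * n) n"
  shows "(\<Sum>g\<in>symgroup (k * n). x (row_word n k \<circ> inv g) * of_int (det_tensor n k (w \<circ> g)))
    = of_int (first_fund_const n k) * x w"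
proof -
  let ?d = "k * n" and ?r = "row_word n k"
  let ?W = "words ?d n" and ?G = "symgroup ?d"
  define D where "D w = (of_int (det_tensor n k w) :: complex)" for w
  define fw where "fw c = restrict (fst \<circ> c) {..<?d}" for c :: "nat \<Rightarrow> nat \<times> nat"
  define sw where "sw c = restrict (snd \<circ> c) {..<?d}" for c :: "nat \<Rightarrow> nat \<times> nat"
  define pw where "pw u v = (\<lambda>i\<in>{..<?d}. (u i, v i))" for u v :: "nat \<Rightarrow> nat"
  have fw_pw: "fw (pw u v) = u" "sw (pw u v) = v" if "u \<in> ?W" "v \<in> ?W" for u v
    using that by (auto simp: fw_def sw_def pw_def fun_eq_iff PiE_iff extensional_def)
  let ?J = "{..<n} \<times> {..<n}"
  \<comment> \<open>The coefficients of the relative invariance as a polynomial in the matrix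
    entries, where c lists d positions in the matrix. The power of the determinant is expanded as
    well, as the transposed action on \<open>det_tensor\<close> evaluated at
    \<open>row_word\<close>, where \<open>det_tensor\<close> is 1.\<close>
  define F where "F c = x (sw c) * (if fw c = w then 1 else 0) - x w * (D (fw c) * (if sw c = ?r then 1 else 0))" for c
  have key: "(\<Sum>g\<in>?G. x (v \<circ> g) * (if u \<circ> g = w then 1 else 0))
      = x w * (\<Sum>g\<in>?G. D (u \<circ> g) * (if v \<circ> g = ?r then 1 else 0))"
    if u: "u \<in> ?W" and v: "v \<in> ?W" for u v
  proof -
    have "(\<Sum>g\<in>?G. F (pw u v \<circ> g)) = 0"
    proof (rule polarization[of ?J])
      show "pw u v \<in> {..<?d} \<rightarrow>\<^sub>E ?J"
        using u v by (auto simp: pw_def)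
      fix y :: "nat \<times> nat \<Rightarrow> complex"
      define A where "A = mat n n y"
      have A: "A \<in> carrier_mat n n" by (simp add: A_def)
      have entry: "A $$ p = y p" if "p \<in> ?J" for p
        using that by (cases p) (simp add: A_def)
      have "(\<Sum>c\<in>{..<?d} \<rightarrow>\<^sub>E ?J. F c * (\<Prod>i<?d. y (c i)))
          = (\<Sum>(w1, w2)\<in>?W \<times> ?W. F (pw w1 w2) * (\<Prod>i<?d. A $$ (w1 i, w2 i)))"
      proof (rule sum.reindex_bij_witness[of _ "\<lambda>(w1, w2). pw w1 w2" "\<lambda>c. (fw c, sw c)"])
        fix c assume c: "c \<in> {..<?d} \<rightarrow>\<^sub>E ?J"
        then have pw_fw: "pw (fw c) (sw c) = c"
          by (auto simp: fun_eq_iff pw_def fw_def sw_def PiE_iff extensional_def)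
        then show "(case (fw c, sw c) of (w1, w2) \<Rightarrow> pw w1 w2) = c" by simp
        show "(fw c, sw c) \<in> ?W \<times> ?W"
          using c by (auto simp: fw_def sw_def PiE_iff mem_Times_iff)
        have "(\<Prod>i<?d. A $$ (fw c i, sw c i)) = (\<Prod>i<?d. y (c i))"
          using c by (intro prod.cong refl) (auto simp: entry fw_def sw_def PiE_iff mem_Times_iff)
        then show "(case (fw c, sw c) of (w1, w2) \<Rightarrow> F (pw w1 w2) * (\<Prod>i<?d. A $$ (w1 i, w2 i)))
            = F c * (\<Prod>i<?d. y (c i))"
          by (simp add: pw_fw)
      next
        fix p assume "p \<in> ?W \<times> ?W"
        then obtain w1 w2 where p: "p = (w1, w2)" "w1 \<in> ?W" "w2 \<in> ?W" by auto
        then show "(fw (case p of (w1, w2) \<Rightarrow> pw w1 w2), sw (case p of (w1, w2) \<Rightarrow> pw w1 w2)) = p"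
          by (simp add: fw_pw)
        show "(case p of (w1, w2) \<Rightarrow> pw w1 w2) \<in> {..<?d} \<rightarrow>\<^sub>E ?J"
          using p by (auto simp: pw_def)
      qed
      also have "\<dots> = (\<Sum>w1\<in>?W. \<Sum>w2\<in>?W. F (pw w1 w2) * (\<Prod>i<?d. A $$ (w1 i, w2 i)))"
        by (simp add: sum.cartesian_product)
      also have "\<dots> = (\<Sum>w1\<in>?W. \<Sum>w2\<in>?W. (if w1 = w then x w2 * (\<Prod>i<?d. A $$ (w i, w2 i)) else 0)
          - (if w2 = ?r then x w * (D w1 * (\<Prod>i<?d. A $$ (w1 i, ?r i))) else 0))"
        by (intro sum.cong refl) (simp add: F_def fw_pw left_diff_distrib)
      also have "\<dots> = (\<Sum>w2\<in>?W. \<Sum>w1\<in>?W. if w1 = w then x w2 * (\<Prod>i<?d. A $$ (w i, w2 i)) else 0)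
          - (\<Sum>w1\<in>?W. \<Sum>w2\<in>?W. if w2 = ?r then x w * (D w1 * (\<Prod>i<?d. A $$ (w1 i, ?r i))) else 0)"
        unfolding sum_subtractf by (subst sum.swap) (rule refl)
      also have "\<dots> = (\<Sum>w2\<in>?W. x w2 * (\<Prod>i<?d. A $$ (w i, w2 i)))
          - x w * (\<Sum>w1\<in>?W. D w1 * (\<Prod>i<?d. A $$ (w1 i, ?r i)))"
        using w row_word_words[of n k] by (simp add: sum_distrib_left)
      also have "(\<Sum>w2\<in>?W. x w2 * (\<Prod>i<?d. A $$ (w i, w2 i))) = det A ^ k * x w"
        by (rule sl_invariant_semi_invariant[OF n x A w])
      also have "(\<Sum>w1\<in>?W. D w1 * (\<Prod>i<?d. A $$ (w1 i, ?r i)))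
          = (\<Sum>w1\<in>?W. D w1 * (\<Prod>i<?d. transpose_mat A $$ (?r i, w1 i)))"
        using A words_less[OF row_word_words[of n k]] words_less
        by (intro sum.cong refl arg_cong2[where f = "(*)"] prod.cong) auto
      also have "\<dots> = det (transpose_mat A) ^ k * D ?r"
        unfolding D_def using A by (intro det_tensor_semi_invariant row_word_words) simp
      also have "\<dots> = det A ^ k"
        by (simp add: det_transpose[OF A] D_def det_tensor_row_word)
      finally show "(\<Sum>c\<in>{..<?d} \<rightarrow>\<^sub>E ?J. F c * (\<Prod>i<?d. y (c i))) = 0"
        by simp
    qed simp
    moreover have "F (pw u v \<circ> g) = x (v \<circ> g) * (if u \<circ> g = w then 1 else 0)
        - x w * (D (u \<circ> g) * (if v \<circ> g = ?r then 1 else 0))" if g: "g \<in> ?G" for g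
    proof -
      have "pw u v \<circ> g = pw (u \<circ> g) (v \<circ> g)"
        using g symgroup_lt[OF g] by (auto simp: pw_def fun_eq_iff symgroup_def permutes_def)
      then show ?thesis
        using fw_pw[OF words_comp[OF u g] words_comp[OF v g]] by (simp add: F_def)
    qed
    ultimately show ?thesis
      by (simp add: sum_subtractf sum_distrib_left)
  qed
  have comp_eq: "u \<circ> g = w \<longleftrightarrow> u = w \<circ> inv g" if "g \<in> ?G" for u w :: "nat \<Rightarrow> nat" and g
    using that symgroup_cancel(3,4)[OF that] by metis
  \<comment> \<open>Multiply \<open>key\<close> for v = \<open>row_word\<close> by
    \<open>D u\<close> and sum over u: on one side u is forced to be \<open>w \<circ> inv g\<close>,
    on the other the sum is the constant.\<close>
  have "(\<Sum>g\<in>?G. x (?r \<circ> inv g) * D (w \<circ> g)) = (\<Sum>g\<in>?G. x (?r \<circ> g) * D (w \<circ> inv g))"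
    using sum_symgroup_inv[of "\<lambda>g. x (?r \<circ> inv g) * D (w \<circ> g)" ?d] by simp
  also have "\<dots> = (\<Sum>g\<in>?G. \<Sum>u\<in>?W. D u * (x (?r \<circ> g) * (if u \<circ> g = w then 1 else 0)))"
  proof (rule sum.cong[OF refl])
    fix g assume g: "g \<in> ?G"
    have "(\<Sum>u\<in>?W. D u * (x (?r \<circ> g) * (if u \<circ> g = w then 1 else 0)))
        = (\<Sum>u\<in>?W. if u = w \<circ> inv g then x (?r \<circ> g) * D u else 0)"
      by (intro sum.cong refl) (simp add: comp_eq[OF g])
    then show "x (?r \<circ> g) * D (w \<circ> inv g) = (\<Sum>u\<in>?W. D u * (x (?r \<circ> g) * (if u \<circ> g = w then 1 else 0)))"
      using words_comp[OF w symgroup_inv[OF g]] by simp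
  qed
  also have "\<dots> = (\<Sum>u\<in>?W. D u * (\<Sum>g\<in>?G. x (?r \<circ> g) * (if u \<circ> g = w then 1 else 0)))"
    by (subst sum.swap) (simp only: sum_distrib_left)
  also have "\<dots> = (\<Sum>u\<in>?W. D u * (x w * (\<Sum>g\<in>?G. D (u \<circ> g) * (if ?r \<circ> g = ?r then 1 else 0))))"
    by (intro sum.cong refl) (simp only: key[OF _ row_word_words])
  also have "\<dots> = x w * (\<Sum>g\<in>?G. \<Sum>u\<in>?W. D u * (D (u \<circ> g) * (if ?r \<circ> g = ?r then 1 else 0)))"
    by (subst sum.swap) (simp only: sum_distrib_left mult.left_commute)
  also have "(\<Sum>g\<in>?G. \<Sum>u\<in>?W. D u * (D (u \<circ> g) * (if ?r \<circ> g = ?r then 1 else 0)))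
      = of_int (first_fund_const n k)"
    unfolding first_fund_const_def of_int_sum by (intro sum.cong refl) (simp add: D_def)
  finally show ?thesis
    unfolding D_def by (simp only: mult.commute[of "x w"])
qed

lemma row_word_row_group:
  assumes p: "p \<in> row_group (rect_partition k n)"
  shows "row_word n k \<circ> p = row_word n k"
proof
  fix x
  let ?\<alpha> = "rect_partition k n"
  note \<alpha> = rect_partition_partitions[of k n]
  have pG: "p \<in> symgroup (k * n)" by (rule row_group_symgroup[OF \<alpha> p])
  show "(row_word n k \<circ> p) x = row_word n k x"
  proof (cases "x < k * n")
    case True
    then obtain i j where ij: "j < ?\<alpha> i" "x = box ?\<alpha> i j"
      by (rule partition_box_cases[OF \<alpha>])
    have "p ` tableau_row ?\<alpha> i = tableau_row ?\<alpha> i"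
      using p by (simp add: row_group_def)
    moreover have "x \<in> tableau_row ?\<alpha> i"
      using ij by (simp add: in_tableau_row_box)
    ultimately have "p x \<in> tableau_row ?\<alpha> i" by blast
    then obtain j' where j': "j' < ?\<alpha> i" "p x = box ?\<alpha> i j'"
      by (auto simp: tableau_row_box)
    have i: "i < n" "?\<alpha> i = k"
      using ij(1) by (auto simp: rect_partition_def split: if_splits)
    have "row_word n k (i * k + j'') = i" if "j'' < k" for j''
      using that i(1) by (simp add: row_word_def box_index_less)
    then show ?thesis
      using ij j' i rect_box[OF i(1)] by simp
  next
    case False
    then show ?thesis using pG by (simp add: symgroup_def permutes_def)
  qed
qed

text \<open>From functions on the group to invariant tensors. By the first fundamental theorem every
  invariant tensor arises in this way when \<open>n \<ge> 1\<close>.\<close>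

definition det_sum :: "nat \<Rightarrow> nat \<Rightarrow> ((nat \<Rightarrow> nat) \<Rightarrow> complex) \<Rightarrow> (nat \<Rightarrow> nat) \<Rightarrow> complex" where
  "det_sum n k y w = (\<Sum>g\<in>symgroup (k * n). y g * of_int (det_tensor n k (w \<circ> g)))"

text \<open>The way back: read x along the translates of \<open>row_word\<close> and multiply by the
  column sum from the right (\<open>col_proj_row_proj\<close>). The value 0 off the group makes the
  result the coefficient function of a group algebra element.\<close>

definition col_proj :: "nat \<Rightarrow> nat \<Rightarrow> ((nat \<Rightarrow> nat) \<Rightarrow> complex) \<Rightarrow> (nat \<Rightarrow> nat) \<Rightarrow> complex" where
  "col_proj n k x g = (if g \<in> symgroup (k * n) then
     \<Sum>q\<in>col_group (rect_partition k n). of_int (sign q) * x (row_word n k \<circ> q \<circ> inv g) else 0)"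

lemma det_sum_invariant: "sl_invariant n (k * n) (det_sum n k y)"
  unfolding det_sum_def[abs_def]
  by (intro sl_invariant_sum sl_invariant_comp det_tensor_sl_invariant)

lemma det_sum_equivariant:
  assumes h: "h \<in> symgroup (k * n)"
  shows "det_sum n k (\<lambda>g. y (inv h \<circ> g)) w = det_sum n k y (w \<circ> h)"
proof -
  have "det_sum n k (\<lambda>g. y (inv h \<circ> g)) w
      = (\<Sum>g\<in>symgroup (k * n). y (inv h \<circ> (h \<circ> g)) * of_int (det_tensor n k (w \<circ> (h \<circ> g))))"
    unfolding det_sum_def by (rule sum_symgroup_left[OF h, symmetric])
  then show ?thesis
    using h by (simp add: det_sum_def o_assoc)
qed

lemma row_col_word_words:
  assumes "q \<in> col_group (rect_partition k n)" "g \<in> symgroup (k * n)"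
  shows "row_word n k \<circ> q \<circ> inv g \<in> words (k * n) n"
  using assms col_group_symgroup[OF rect_partition_partitions]
  by (intro words_comp[OF words_comp[OF row_word_words]]) auto

lemma col_proj_cong:
  "(\<And>w. w \<in> words (k * n) n \<Longrightarrow> x w = x' w) \<Longrightarrow> col_proj n k x g = col_proj n k x' g"
  unfolding col_proj_def by (intro if_cong refl sum.cong) (simp add: row_col_word_words)

lemma col_proj_equivariant:
  assumes h: "h \<in> symgroup (k * n)"
  shows "col_proj n k (\<lambda>w. x (w \<circ> h)) g = col_proj n k x (inv h \<circ> g)"
proof (cases "g \<in> symgroup (k * n)")
  case True
  then show ?thesis
    using h by (simp add: col_proj_def symgroup_inv_comp[of _ "k * n"] comp_assoc)
next
  case False
  have "inv h \<circ> g \<notin> symgroup (k * n)"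
  proof
    assume "inv h \<circ> g \<in> symgroup (k * n)"
    then have "h \<circ> (inv h \<circ> g) \<in> symgroup (k * n)" using h by (rule symgroup_comp[rotated])
    then show False using False h by simp
  qed
  then show ?thesis using False by (simp add: col_proj_def)
qed

context
  fixes n k :: nat
begin

definition row_proj :: "((nat \<Rightarrow> nat) \<Rightarrow> complex) \<Rightarrow> ((nat \<Rightarrow> nat) \<Rightarrow>\<^sub>0 complex)" where
  "row_proj x = of_fun (symgroup (k * n)) (\<lambda>g. x (row_word n k \<circ> inv g))"

lemma coef_gmult_col_sum:
  assumes g: "g \<in> symgroup (k * n)"
  shows "coef (gmult (k * n) y (col_sum (rect_partition k n))) g
    = (\<Sum>q\<in>col_group (rect_partition k n). of_int (sign q) * coef y (g \<circ> inv q))"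
proof -
  note \<alpha> = rect_partition_partitions[of k n]
  have sub: "col_group (rect_partition k n) \<subseteq> symgroup (k * n)"
    using col_group_symgroup[OF \<alpha>] by blast
  have "coef (gmult (k * n) y (col_sum (rect_partition k n))) g
      = (\<Sum>q\<in>symgroup (k * n). if q \<in> col_group (rect_partition k n) then of_int (sign q) * coef y (g \<circ> inv q) else 0)"
    unfolding coef_gmult'[OF g] by (intro sum.cong refl) (simp add: coef_col_sum[OF \<alpha>])
  then show ?thesis
    using sub by (simp add: sum.inter_restrict[symmetric] Int_absorb1)
qed

lemma col_proj_row_proj:
  "col_proj n k x = coef (gmult (k * n) (row_proj x) (col_sum (rect_partition k n)))"
proof
  fix g
  note \<alpha> = rect_partition_partitions[of k n]
  show "col_proj n k x g = coef (gmult (k * n) (row_proj x) (col_sum (rect_partition k n))) g"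
  proof (cases "g \<in> symgroup (k * n)")
    case True
    have "coef (row_proj x) (g \<circ> inv q) = x (row_word n k \<circ> q \<circ> inv g)" if "q \<in> col_group (rect_partition k n)" for q
      using True col_group_symgroup[OF \<alpha> that]
      by (simp add: row_proj_def symgroup_inv_comp[of _ "k * n"] o_assoc)
    then show ?thesis
      using True by (simp add: coef_gmult_col_sum[OF True] col_proj_def)
  next
    case False
    have "gmult (k * n) (row_proj x) (col_sum (rect_partition k n)) \<in> free_on (symgroup (k * n))"
      by (intro gmult_free_on col_sum_free_on[OF \<alpha>])
    then show ?thesis using False by (simp add: col_proj_def in_free_on_iff)
  qed
qed

lemma row_proj_row_sum:
  "gmult (k * n) (row_proj x) (row_sum (rect_partition k n))
    = smul (of_nat (card (row_group (rect_partition k n)))) (row_proj x)"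
proof (rule poly_mapping_eqI)
  fix g
  note \<alpha> = rect_partition_partitions[of k n]
  show "coef (gmult (k * n) (row_proj x) (row_sum (rect_partition k n))) g
      = coef (smul (of_nat (card (row_group (rect_partition k n)))) (row_proj x)) g"
  proof (cases "g \<in> symgroup (k * n)")
    case True
    have sub: "row_group (rect_partition k n) \<subseteq> symgroup (k * n)"
      using row_group_symgroup[OF \<alpha>] by blast
    have "coef (gmult (k * n) (row_proj x) (row_sum (rect_partition k n))) g
        = (\<Sum>p\<in>symgroup (k * n). if p \<in> row_group (rect_partition k n) then coef (row_proj x) (g \<circ> inv p) else 0)"
      unfolding coef_gmult'[OF True] by (intro sum.cong refl) (simp add: coef_row_sum[OF \<alpha>])
    also have "\<dots> = (\<Sum>p\<in>row_group (rect_partition k n). coef (row_proj x) (g \<circ> inv p))"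
      using sub by (simp add: sum.inter_restrict[symmetric] Int_absorb1)
    also have "\<dots> = (\<Sum>p\<in>row_group (rect_partition k n). coef (row_proj x) g)"
    proof (rule sum.cong[OF refl])
      fix p assume p: "p \<in> row_group (rect_partition k n)"
      then have "p \<in> symgroup (k * n)" using sub by blast
      then show "coef (row_proj x) (g \<circ> inv p) = coef (row_proj x) g"
        using True row_word_row_group[OF p]
        by (simp add: row_proj_def symgroup_inv_comp[of _ "k * n"] o_assoc)
    qed
    finally show ?thesis by simp
  next
    case False
    have "gmult (k * n) (row_proj x) (row_sum (rect_partition k n)) \<in> free_on (symgroup (k * n))"
      by (intro gmult_free_on row_sum_free_on[OF \<alpha>])
    then show ?thesis using False by (simp add: row_proj_def in_free_on_iff)
  qed
qed

text \<open>Like \<open>row_word\<close>, \<open>row_proj x\<close> is invariant under the row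
  group, here from the right. It absorbs the row sum a up to the order of that group, so multiplying
  by b amounts to multiplying by a b.\<close>

lemma row_proj_col_sum:
  "gmult (k * n) (row_proj x) (col_sum (rect_partition k n))
    = smul (inverse (of_nat (card (row_group (rect_partition k n)))))
        (gmult (k * n) (row_proj x) (young_symmetrizer (rect_partition k n)))"
proof -
  note \<alpha> = rect_partition_partitions[of k n]
  have "gmult (k * n) (row_proj x) (young_symmetrizer (rect_partition k n))
      = gmult (k * n) (gmult (k * n) (row_proj x) (row_sum (rect_partition k n))) (col_sum (rect_partition k n))"
    by (simp only: young_symmetrizer_eq[OF \<alpha>] gmult_assoc)
  then show ?thesis
    using card_row_group_pos[OF \<alpha>] by (simp add: row_proj_row_sum gmult_smul_left)
qed

lemma col_proj_irrep:
  "\<exists>t\<in>irrep (rect_partition k n). col_proj n k x = coef t"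
proof -
  note \<alpha> = rect_partition_partitions[of k n]
  have "gmult (k * n) (row_proj x) (col_sum (rect_partition k n)) \<in> irrep (rect_partition k n)"
    unfolding row_proj_col_sum
    by (rule free_vs.subspace_scale[OF subspace_irrep[OF \<alpha>]]) (simp add: irrep_eq[OF \<alpha>])
  then show ?thesis
    using col_proj_row_proj by blast
qed

text \<open>Moving q from x over to \<open>det_tensor\<close> produces a second sign of q, so every
  q contributes the same sum, which the first fundamental theorem evaluates.\<close>

lemma det_sum_col_proj:
  assumes n: "n \<ge> 1" and x: "sl_invariant n (k * n) x" and w: "w \<in> words (k * n) n"
  shows "det_sum n k (col_proj n k x) w
    = of_nat (card (col_group (rect_partition k n))) * of_int (first_fund_const n k) * x w"
proof -
  note \<alpha> = rect_partition_partitions[of k n]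
  let ?G = "symgroup (k * n)" and ?C = "col_group (rect_partition k n)"
  let ?D = "\<lambda>w. of_int (det_tensor n k w) :: complex"
  have "det_sum n k (col_proj n k x) w
      = (\<Sum>g\<in>?G. \<Sum>q\<in>?C. of_int (sign q) * x (row_word n k \<circ> q \<circ> inv g) * ?D (w \<circ> g))"
    by (simp add: det_sum_def col_proj_def sum_distrib_right)
  also have "\<dots> = (\<Sum>q\<in>?C. \<Sum>g\<in>?G. of_int (sign q) * x (row_word n k \<circ> q \<circ> inv g) * ?D (w \<circ> g))"
    by (rule sum.swap)
  also have "\<dots> = (\<Sum>q\<in>?C. \<Sum>g\<in>?G. x (row_word n k \<circ> inv g) * ?D (w \<circ> g))"
  proof (rule sum.cong[OF refl])
    fix q assume q: "q \<in> ?C"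
    have qG: "q \<in> ?G" by (rule col_group_symgroup[OF \<alpha> q])
    have "(\<Sum>g\<in>?G. of_int (sign q) * x (row_word n k \<circ> q \<circ> inv g) * ?D (w \<circ> g))
        = (\<Sum>g\<in>?G. of_int (sign q) * x (row_word n k \<circ> q \<circ> inv (g \<circ> q)) * ?D (w \<circ> (g \<circ> q)))"
      by (rule sum_symgroup_right[OF qG, symmetric])
    also have "\<dots> = (\<Sum>g\<in>?G. x (row_word n k \<circ> inv g) * ?D (w \<circ> g))"
    proof (rule sum.cong[OF refl])
      fix g assume g: "g \<in> ?G"
      have "row_word n k \<circ> q \<circ> inv (g \<circ> q) = row_word n k \<circ> inv g"
        using g qG by (simp add: symgroup_inv_comp[of _ "k * n"] comp_assoc)
      moreover have "?D (w \<circ> (g \<circ> q)) = of_int (sign q) * ?D (w \<circ> g)"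
        using det_tensor_col_group[OF q words_comp[OF w g]] by (simp add: o_assoc)
      moreover have "of_int (sign q) * of_int (sign q) = (1 :: complex)"
        by (simp flip: of_int_mult)
      ultimately show "of_int (sign q) * x (row_word n k \<circ> q \<circ> inv (g \<circ> q)) * ?D (w \<circ> (g \<circ> q))
          = x (row_word n k \<circ> inv g) * ?D (w \<circ> g)"
        by (simp add: mult.assoc mult.left_commute)
    qed
    finally show "(\<Sum>g\<in>?G. of_int (sign q) * x (row_word n k \<circ> q \<circ> inv g) * ?D (w \<circ> g))
        = (\<Sum>g\<in>?G. x (row_word n k \<circ> inv g) * ?D (w \<circ> g))" .
  qed
  also have "\<dots> = of_nat (card ?C) * of_int (first_fund_const n k) * x w"
    by (simp add: first_fundamental_theorem[OF n x w] mult.assoc)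
  finally show ?thesis .
qed

lemma row_proj_det_sum:
  assumes "y \<in> free_on (symgroup (k * n))"
  shows "row_proj (det_sum n k (coef y)) = gmult (k * n) y (row_proj (\<lambda>w. of_int (det_tensor n k w)))"
proof (rule poly_mapping_eqI)
  fix g
  let ?e = "row_proj (\<lambda>w. of_int (det_tensor n k w))"
  show "coef (row_proj (det_sum n k (coef y))) g = coef (gmult (k * n) y ?e) g"
  proof (cases "g \<in> symgroup (k * n)")
    case True
    then show ?thesis
      by (simp add: row_proj_def det_sum_def coef_gmult symgroup_inv_comp[of _ "k * n"] o_assoc)
  next
    case False
    have "gmult (k * n) y ?e \<in> free_on (symgroup (k * n))"
      by (intro gmult_free_on) (simp add: row_proj_def)
    then show ?thesis using False by (simp add: row_proj_def in_free_on_iff)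
  qed
qed

text \<open>The composite is right multiplication by a fixed element, a multiple of
  \<open>e c\<^sub>\<alpha>\<close> on row-invariant arguments. On the left ideal it is a scalar,
  because y is a multiple of \<open>y c\<^sub>\<alpha>\<close> and
  \<open>c\<^sub>\<alpha> e c\<^sub>\<alpha>\<close> is a multiple of
  \<open>c\<^sub>\<alpha>\<close>.\<close>

lemma col_proj_det_sum:
  assumes n: "n \<ge> 1"
  shows "\<exists>s. s \<noteq> 0 \<and> (\<forall>y\<in>irrep (rect_partition k n). \<forall>g. col_proj n k (det_sum n k (coef y)) g = s * coef y g)"
proof -
  note \<alpha> = rect_partition_partitions[of k n]
  let ?\<alpha> = "rect_partition k n" and ?d = "k * n"
  let ?Y = "young_symmetrizer ?\<alpha>" and ?D = "\<lambda>w. of_int (det_tensor n k w) :: complex"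
  let ?e = "row_proj ?D"
  define s where "s = inverse (of_nat (card (row_group ?\<alpha>))) * young_form ?d ?\<alpha> ?e"
  have eq: "col_proj n k (det_sum n k (coef y)) g = s * coef y g" if y: "y \<in> irrep ?\<alpha>" for y g
  proof -
    obtain x where x: "y = gmult ?d x ?Y" using y unfolding irrep_eq[OF \<alpha>] by blast
    have yG: "y \<in> free_on (symgroup ?d)" using y irrep_free_on[OF \<alpha>] by blast
    let ?h = "young_scalar ?d ?\<alpha>"
    have yY: "gmult ?d y ?Y = smul ?h y"
      by (simp add: x gmult_assoc young_scalar_eq[OF \<alpha>] gmult_smul)
    have "smul ?h (gmult ?d y (gmult ?d ?e ?Y)) = gmult ?d (gmult ?d y ?Y) (gmult ?d ?e ?Y)"
      by (simp only: yY gmult_smul_left)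
    also have "\<dots> = gmult ?d y (gmult ?d ?Y (gmult ?d ?e ?Y))"
      by (simp only: gmult_assoc)
    also have "\<dots> = smul (young_form ?d ?\<alpha> ?e) (smul ?h y)"
      by (simp only: young_form_eq[OF \<alpha>] gmult_smul yY)
    also have "\<dots> = smul ?h (smul (young_form ?d ?\<alpha> ?e) y)"
      by (rule free_vs.scale_left_commute)
    finally have yeY: "gmult ?d y (gmult ?d ?e ?Y) = smul (young_form ?d ?\<alpha> ?e) y"
      using young_scalar_neq_0[OF \<alpha>] free_vs.scale_left_imp_eq by blast
    have "col_proj n k (det_sum n k (coef y)) = coef (gmult ?d (gmult ?d y ?e) (col_sum ?\<alpha>))"
      by (simp only: col_proj_row_proj row_proj_det_sum[OF yG])
    also have "gmult ?d (gmult ?d y ?e) (col_sum ?\<alpha>) = gmult ?d y (gmult ?d ?e (col_sum ?\<alpha>))"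
      by (simp only: gmult_assoc)
    also have "\<dots> = smul s y"
      by (simp only: row_proj_col_sum gmult_smul yeY s_def free_vs.scale_scale)
    finally show ?thesis by simp
  qed
  \<comment> \<open>The composite in the other order is the nonzero scalar K on
    \<open>det_tensor\<close>. Were s = 0, \<open>col_proj\<close> of \<open>det_tensor\<close>
    would vanish, and with it K times the value 1 of \<open>det_tensor\<close> at
    \<open>row_word\<close>.\<close>
  have "s \<noteq> 0"
  proof
    assume s0: "s = 0"
    let ?K = "of_nat (card (col_group ?\<alpha>)) * of_int (first_fund_const n k) :: complex"
    have K0: "?K \<noteq> 0"
      using card_col_group_pos[OF \<alpha>] first_fund_const_pos[of n k] by simp
    note inv = det_tensor_sl_invariant[of n k]
    obtain t where t: "t \<in> irrep ?\<alpha>" "col_proj n k ?D = coef t"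
      using col_proj_irrep by blast
    have "coef t g = 0" for g
    proof -
      have "0 = col_proj n k (det_sum n k (coef t)) g"
        by (simp add: eq[OF t(1)] s0)
      also have "\<dots> = col_proj n k (\<lambda>w. ?K * ?D w) g"
        unfolding t(2)[symmetric] by (rule col_proj_cong) (rule det_sum_col_proj[OF n inv])
      also have "\<dots> = ?K * col_proj n k ?D g"
        by (simp add: col_proj_def sum_distrib_left mult.left_commute)
      finally show ?thesis using K0 t(2) by simp
    qed
    then have "det_sum n k (col_proj n k ?D) (row_word n k) = 0"
      by (simp add: t(2) det_sum_def)
    then show False
      using det_sum_col_proj[OF n inv row_word_words] K0 by (simp add: det_tensor_row_word)
  qed
  with eq show ?thesis by blast
qed

end

section \<open>Polynomials and symmetric tensors\<close>

lemma dim_injective_image: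
  assumes f: "lin f" and E: "free_vs.subspace E" and inj: "inj_on f E"
  shows "free_vs.dim (f ` E) = free_vs.dim E"
proof -
  obtain B where B: "B \<subseteq> E" "free_vs.independent B" "E \<subseteq> free_vs.span B" "card B = free_vs.dim E"
    by (rule free_vs.basis_exists)
  have span: "free_vs.span B = E"
    using B(1,3) free_vs.span_minimal[OF B(1) E] by blast
  have "free_vs.independent (f ` B)"
    using free_pair.linear_independent_injective_image[OF f B(2)] inj span by simp
  moreover have "free_vs.span (f ` B) = f ` E"
    using free_pair.linear_span_image[OF f, of B] span by simp
  ultimately have "free_vs.dim (f ` E) = card (f ` B)"
    using free_vs.dim_span_eq_card_independent by metis
  also have "\<dots> = card B"
    using inj_on_subset[OF inj B(1)] by (rule card_image)
  finally show ?thesis using B(4) by simp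
qed

section \<open>The tensor square of a Specht module\<close>

lemma irrep_young:
  assumes \<alpha>: "\<alpha> \<in> partitions d" and y: "y \<in> irrep \<alpha>"
  shows "gmult d y (smul (inverse (young_scalar d \<alpha>)) (young_symmetrizer \<alpha>)) = y"
proof -
  obtain x where "y = gmult d x (young_symmetrizer \<alpha>)"
    using y unfolding irrep_eq[OF \<alpha>] by blast
  then show ?thesis
    using young_scalar_neq_0[OF \<alpha>] by (simp add: gmult_smul gmult_assoc young_scalar_eq[OF \<alpha>])
qed

lemma irrep_left_action:
  "\<alpha> \<in> partitions d \<Longrightarrow> g \<in> symgroup d \<Longrightarrow> t \<in> irrep \<alpha> \<Longrightarrow> left_action g t \<in> irrep \<alpha>"
  using sym_rep.subrep_cyclic[OF sym_rep_left_action, of d "young_symmetrizer \<alpha>"]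
  by (auto simp: irrep_eq subrep_def)

text \<open>The multiple e of \<open>c\<^sub>\<alpha>\<close> is a right unit of the left ideal. If
  all rows and columns of z lie in the ideal, using this in both variables writes z as the sum of
  z(g, h) times the tensor of g e and h e. Membership thus becomes a condition on
  coefficients.\<close>

lemma tensor_space_iff:
  assumes \<alpha>: "\<alpha> \<in> partitions d"
  shows "z \<in> tensor_space (irrep \<alpha>) (irrep \<alpha>) \<longleftrightarrow>
    (\<forall>g. \<exists>t\<in>irrep \<alpha>. \<forall>h. coef z (g, h) = coef t h) \<and> (\<forall>h. \<exists>t\<in>irrep \<alpha>. \<forall>g. coef z (g, h) = coef t g)"
    (is "_ \<longleftrightarrow> ?R z")
proof
  note sub = subspace_irrep[OF \<alpha>]
  have "free_vs.subspace {z. ?R z}"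
  proof (rule free_vs.subspaceI)
    show "0 \<in> {z. ?R z}"
      using free_vs.subspace_0[OF sub] by (auto intro: bexI[of _ 0])
  next
    fix x y assume xy: "x \<in> {z. ?R z}" "y \<in> {z. ?R z}"
    have "\<exists>t\<in>irrep \<alpha>. \<forall>h. coef (x + y) (g, h) = coef t h" for g
    proof -
      obtain t t' where "t \<in> irrep \<alpha>" "t' \<in> irrep \<alpha>" "\<forall>h. coef x (g, h) = coef t h" "\<forall>h. coef y (g, h) = coef t' h"
        using xy by blast
      then show ?thesis
        using free_vs.subspace_add[OF sub] by (intro bexI[of _ "t + t'"]) (simp_all add: lookup_add)
    qed
    moreover have "\<exists>t\<in>irrep \<alpha>. \<forall>g. coef (x + y) (g, h) = coef t g" for h
    proof -
      obtain t t' where "t \<in> irrep \<alpha>" "t' \<in> irrep \<alpha>" "\<forall>g. coef x (g, h) = coef t g" "\<forall>g. coef y (g, h) = coef t' g"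
        using xy by blast
      then show ?thesis
        using free_vs.subspace_add[OF sub] by (intro bexI[of _ "t + t'"]) (simp_all add: lookup_add)
    qed
    ultimately show "x + y \<in> {z. ?R z}" by simp
  next
    fix c x assume x: "x \<in> {z. ?R z}"
    have "\<exists>t\<in>irrep \<alpha>. \<forall>h. coef (smul c x) (g, h) = coef t h" for g
    proof -
      obtain t where "t \<in> irrep \<alpha>" "\<forall>h. coef x (g, h) = coef t h"
        using x by blast
      then show ?thesis
        using free_vs.subspace_scale[OF sub] by (intro bexI[of _ "smul c t"]) simp_all
    qed
    moreover have "\<exists>t\<in>irrep \<alpha>. \<forall>g. coef (smul c x) (g, h) = coef t g" for h
    proof -
      obtain t where "t \<in> irrep \<alpha>" "\<forall>g. coef x (g, h) = coef t g"
        using x by blast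
      then show ?thesis
        using free_vs.subspace_scale[OF sub] by (intro bexI[of _ "smul c t"]) simp_all
    qed
    ultimately show "smul c x \<in> {z. ?R z}" by simp
  qed
  moreover have "{tensor u w |u w. u \<in> irrep \<alpha> \<and> w \<in> irrep \<alpha>} \<subseteq> {z. ?R z}"
  proof clarify
    fix u w assume uw: "u \<in> irrep \<alpha>" "w \<in> irrep \<alpha>"
    have "\<exists>t\<in>irrep \<alpha>. \<forall>h. coef (tensor u w) (g, h) = coef t h" for g
      using uw free_vs.subspace_scale[OF sub] by (intro bexI[of _ "smul (coef u g) w"]) (simp_all add: coef_tensor)
    moreover have "\<exists>t\<in>irrep \<alpha>. \<forall>g. coef (tensor u w) (g, h) = coef t g" for h
      using uw free_vs.subspace_scale[OF sub] by (intro bexI[of _ "smul (coef w h) u"]) (simp_all add: coef_tensor)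
    ultimately show "?R (tensor u w)" by simp
  qed
  ultimately have "tensor_space (irrep \<alpha>) (irrep \<alpha>) \<subseteq> {z. ?R z}"
    unfolding tensor_space_def by (intro free_vs.span_minimal)
  then show "z \<in> tensor_space (irrep \<alpha>) (irrep \<alpha>) \<Longrightarrow> ?R z" by blast
next
  assume R: "?R z"
  define e where "e = smul (inverse (young_scalar d \<alpha>)) (young_symmetrizer \<alpha>)"
  have gen: "left_action g e \<in> irrep \<alpha>" if "g \<in> symgroup d" for g
    unfolding e_def using that irrep_young_mem[OF \<alpha>]
    by (intro irrep_left_action[OF \<alpha>] free_vs.subspace_scale[OF subspace_irrep[OF \<alpha>]])
  have repro: "(\<Sum>g\<in>symgroup d. coef t g * coef e (inv g \<circ> k)) = coef t k" if "t \<in> irrep \<alpha>" for t k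
    unfolding coef_gmult[symmetric] by (simp only: e_def irrep_young[OF \<alpha> that])
  have "z = (\<Sum>g\<in>symgroup d. \<Sum>h\<in>symgroup d. smul (coef z (g, h)) (tensor (left_action g e) (left_action h e)))"
  proof (rule poly_mapping_eqI)
    fix p :: "(nat \<Rightarrow> nat) \<times> (nat \<Rightarrow> nat)"
    obtain k l where p: "p = (k, l)" by (cases p)
    have "coef (\<Sum>g\<in>symgroup d. \<Sum>h\<in>symgroup d. smul (coef z (g, h)) (tensor (left_action g e) (left_action h e))) p
        = (\<Sum>g\<in>symgroup d. coef e (inv g \<circ> k) * (\<Sum>h\<in>symgroup d. coef z (g, h) * coef e (inv h \<circ> l)))"
      unfolding p coef_sum sum_distrib_left
      by (intro sum.cong refl) (simp add: coef_tensor coef_left_action mult.left_commute)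
    also have "\<dots> = (\<Sum>g\<in>symgroup d. coef z (g, l) * coef e (inv g \<circ> k))"
    proof (rule sum.cong[OF refl])
      fix g
      obtain t where "t \<in> irrep \<alpha>" "\<forall>h. coef z (g, h) = coef t h" using R by blast
      then show "coef e (inv g \<circ> k) * (\<Sum>h\<in>symgroup d. coef z (g, h) * coef e (inv h \<circ> l))
          = coef z (g, l) * coef e (inv g \<circ> k)"
        by (simp add: repro mult.commute)
    qed
    also have "\<dots> = coef z p"
    proof -
      obtain t where "t \<in> irrep \<alpha>" "\<forall>g. coef z (g, l) = coef t g" using R by blast
      then show ?thesis by (simp add: repro p)
    qed
    finally show "coef z p = coef (\<Sum>g\<in>symgroup d. \<Sum>h\<in>symgroup d.
        smul (coef z (g, h)) (tensor (left_action g e) (left_action h e))) p" by simp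
  qed
  note z_eq = this
  have "tensor (left_action g e) (left_action h e) \<in> {tensor u w |u w. u \<in> irrep \<alpha> \<and> w \<in> irrep \<alpha>}"
    if "g \<in> symgroup d" "h \<in> symgroup d" for g h
    using gen[OF that(1)] gen[OF that(2)] by blast
  then have "(\<Sum>g\<in>symgroup d. \<Sum>h\<in>symgroup d. smul (coef z (g, h)) (tensor (left_action g e) (left_action h e)))
      \<in> tensor_space (irrep \<alpha>) (irrep \<alpha>)"
    unfolding tensor_space_def
    by (intro free_vs.span_sum free_vs.span_scale free_vs.span_base)
  then show "z \<in> tensor_space (irrep \<alpha>) (irrep \<alpha>)"
    unfolding z_eq[symmetric] .
qed

lemma tensor_space_free_on:
  assumes \<alpha>: "\<alpha> \<in> partitions d"
  shows "tensor_space (irrep \<alpha>) (irrep \<alpha>) \<subseteq> free_on (symgroup d \<times> symgroup d)"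
proof
  fix z assume "z \<in> tensor_space (irrep \<alpha>) (irrep \<alpha>)"
  then have R: "\<forall>g. \<exists>t\<in>irrep \<alpha>. \<forall>h. coef z (g, h) = coef t h" "\<forall>h. \<exists>t\<in>irrep \<alpha>. \<forall>g. coef z (g, h) = coef t g"
    using tensor_space_iff[OF \<alpha>] by blast+
  have "coef t k = 0" if "t \<in> irrep \<alpha>" "k \<notin> symgroup d" for t k
    using irrep_free_on[OF \<alpha>] that by (auto simp: in_free_on_iff)
  then have "coef z (g, h) = 0" if "g \<notin> symgroup d \<or> h \<notin> symgroup d" for g h
    using R that by metis
  then show "z \<in> free_on (symgroup d \<times> symgroup d)"
    by (auto simp: in_free_on_iff)
qed

lemma tensor_space_subrep:
  assumes \<alpha>: "\<alpha> \<in> partitions d"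
  shows "subrep d diagonal_action (tensor_space (irrep \<alpha>) (irrep \<alpha>))"
  unfolding subrep_def
proof (intro conjI ballI)
  show "free_vs.subspace (tensor_space (irrep \<alpha>) (irrep \<alpha>))"
    unfolding tensor_space_def by (rule free_vs.subspace_span)
  fix g z assume g: "g \<in> symgroup d" and z: "z \<in> tensor_space (irrep \<alpha>) (irrep \<alpha>)"
  have R: "\<exists>t\<in>irrep \<alpha>. \<forall>h. coef z (k, h) = coef t h" "\<exists>t\<in>irrep \<alpha>. \<forall>h. coef z (h, k) = coef t h" for k
    using z tensor_space_iff[OF \<alpha>] by blast+
  show "diagonal_action g z \<in> tensor_space (irrep \<alpha>) (irrep \<alpha>)"
    unfolding tensor_space_iff[OF \<alpha>] coef_diagonal_action[OF g]
  proof (intro conjI allI)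
    fix k
    obtain t where "t \<in> irrep \<alpha>" "\<forall>h. coef z (inv g \<circ> k, h) = coef t h"
      using R(1) by blast
    then show "\<exists>t\<in>irrep \<alpha>. \<forall>h. coef z (inv g \<circ> k, inv g \<circ> h) = coef t h"
      using irrep_left_action[OF \<alpha> g] coef_left_action[OF g] by (intro bexI[of _ "left_action g t"]) simp_all
    obtain t where "t \<in> irrep \<alpha>" "\<forall>h. coef z (h, inv g \<circ> k) = coef t h"
      using R(2) by blast
    then show "\<exists>t\<in>irrep \<alpha>. \<forall>h. coef z (inv g \<circ> h, inv g \<circ> k) = coef t h"
      using irrep_left_action[OF \<alpha> g] coef_left_action[OF g] by (intro bexI[of _ "left_action g t"]) simp_all
  qed
qed

section \<open>Monomials as words of variables up to rearrangement\<close>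

abbreviation vars :: "nat \<Rightarrow> nat \<Rightarrow> (nat \<times> nat \<times> nat) set" where
  "vars m n \<equiv> {..<m} \<times> {..<n} \<times> {..<n}"

abbreviation vwords :: "nat \<Rightarrow> nat \<Rightarrow> nat \<Rightarrow> (nat \<Rightarrow> nat \<times> nat \<times> nat) set" where
  "vwords d m n \<equiv> {..<d} \<rightarrow>\<^sub>E vars m n"

lemma finite_vwords [simp]: "finite (vwords d m n)"
  by (simp add: finite_PiE)

definition monom_of :: "nat \<Rightarrow> (nat \<Rightarrow> 'v) \<Rightarrow> ('v \<Rightarrow>\<^sub>0 nat)" where
  "monom_of d c = (\<Sum>i<d. Poly_Mapping.single (c i) 1)"

lemma coef_monom_of: "coef (monom_of d c) v = card {i. i \<in> {..<d} \<and> c i = v}"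
proof -
  have "coef (monom_of d c) v = (\<Sum>i<d. if c i = v then 1 else 0)"
    by (simp add: monom_of_def lookup_sum lookup_single when_def del: One_nat_def)
  then show ?thesis by (simp add: sum.If_cases Int_def)
qed

lemma keys_monom_of: "Poly_Mapping.keys (monom_of d c) = c ` {..<d}"
  by (auto simp: in_keys_iff coef_monom_of card_eq_0_iff)

lemma degree_monom_of: "(\<Sum>v\<in>Poly_Mapping.keys (monom_of d c). coef (monom_of d c) v) = d"
proof -
  have "d = (\<Sum>i<d. 1)" by simp
  also have "\<dots> = (\<Sum>v\<in>c ` {..<d}. \<Sum>i\<in>{i. i \<in> {..<d} \<and> c i = v}. 1)"
    by (rule sum.image_gen) simp
  finally show ?thesis by (simp add: keys_monom_of coef_monom_of)
qed

lemma prod_monom_of: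
  fixes y :: "'v \<Rightarrow> complex"
  shows "(\<Prod>v\<in>Poly_Mapping.keys (monom_of d c). y v ^ coef (monom_of d c) v) = (\<Prod>i<d. y (c i))"
proof -
  have "(\<Prod>i<d. y (c i)) = (\<Prod>v\<in>c ` {..<d}. \<Prod>i\<in>{i. i \<in> {..<d} \<and> c i = v}. y (c i))"
    by (rule prod.image_gen) simp
  also have "\<dots> = (\<Prod>v\<in>c ` {..<d}. y v ^ card {i. i \<in> {..<d} \<and> c i = v})"
    by (intro prod.cong refl) simp
  finally show ?thesis by (simp add: keys_monom_of coef_monom_of)
qed

lemma monom_of_comp:
  assumes "g \<in> symgroup d"
  shows "monom_of d (c \<circ> g) = monom_of d c"
  using sum.permute[of g "{..<d}" "\<lambda>i. Poly_Mapping.single (c i) (1 :: nat)"] assms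
  by (simp add: monom_of_def symgroup_def o_def)

lemma monom_of_eq_imp_comp:
  assumes c: "c \<in> {..<d} \<rightarrow>\<^sub>E J" and c': "c' \<in> {..<d} \<rightarrow>\<^sub>E J" and eq: "monom_of d c = monom_of d c'"
  obtains g where "g \<in> symgroup d" "c' = c \<circ> g"
proof -
  have count: "count (mset (map c [0..<d])) v = coef (monom_of d c) v" for c :: "nat \<Rightarrow> 'a" and d v
    by (induction d) (simp_all add: monom_of_def lookup_add lookup_single when_def)
  have "mset (map c' [0..<d]) = mset (map c [0..<d])"
    by (rule multiset_eqI) (simp only: count eq)
  then obtain p where p: "p permutes {..<length (map c [0..<d])}" "permute_list p (map c [0..<d]) = map c' [0..<d]"
    by (rule mset_eq_permutation)
  have pd: "p permutes {..<d}" using p(1) by simp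
  have "c' i = c (p i)" if i: "i < d" for i
  proof -
    have "map c' [0..<d] ! i = map c [0..<d] ! p i"
      unfolding p(2)[symmetric] using i by (intro permute_list_nth[OF p(1)]) simp
    moreover have "p i < d" using permutes_in_image[OF pd, of i] i by simp
    ultimately show ?thesis using i by simp
  qed
  moreover have "c' i = c (p i)" if i: "\<not> i < d" for i
  proof -
    have "p i = i" using pd i by (simp add: permutes_def)
    then show ?thesis using c c' i by (simp add: PiE_iff extensional_def)
  qed
  ultimately have "c' = c \<circ> p" by (auto simp: fun_eq_iff)
  moreover have "p \<in> symgroup d" using pd by (simp add: symgroup_def)
  ultimately show ?thesis by (intro that)
qed

lemma monom_of_surj:
  fixes t :: "'v \<Rightarrow>\<^sub>0 nat"
  assumes J: "finite J"
  shows "Poly_Mapping.keys t \<subseteq> J \<Longrightarrow> (\<Sum>v\<in>J. coef t v) = d \<Longrightarrow> \<exists>c\<in>{..<d} \<rightarrow>\<^sub>E J. monom_of d c = t"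
proof (induction d arbitrary: t)
  case 0
  then have "coef t v = 0" for v
    using J by (cases "v \<in> J") (auto simp: in_keys_iff)
  then have "t = 0" by (intro poly_mapping_eqI) simp
  then show ?case by (intro bexI[of _ "\<lambda>_. undefined"]) (simp_all add: monom_of_def)
next
  case (Suc d)
  have "\<exists>v\<in>J. coef t v \<noteq> 0"
  proof (rule ccontr)
    assume "\<not> ?thesis"
    then have "(\<Sum>v\<in>J. coef t v) = 0" by simp
    then show False using Suc.prems(2) by simp
  qed
  then obtain v where v: "v \<in> J" "coef t v \<noteq> 0" by blast
  define t' where "t' = t - Poly_Mapping.single v 1"
  have coef_t': "coef t' x = (if x = v then coef t v - 1 else coef t x)" for x
    by (simp add: t'_def lookup_minus lookup_single when_def)
  have "Poly_Mapping.keys t' \<subseteq> J"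
    using Suc.prems(1) v by (auto simp: in_keys_iff coef_t' split: if_splits)
  moreover have "(\<Sum>x\<in>J. coef t' x) = d"
  proof -
    have "(\<Sum>x\<in>J. coef t x) = coef t v + (\<Sum>x\<in>J - {v}. coef t x)"
      using J v by (intro sum.remove)
    moreover have "(\<Sum>x\<in>J. coef t' x) = coef t' v + (\<Sum>x\<in>J - {v}. coef t' x)"
      using J v by (intro sum.remove)
    moreover have "(\<Sum>x\<in>J - {v}. coef t' x) = (\<Sum>x\<in>J - {v}. coef t x)"
      by (intro sum.cong refl) (simp add: coef_t')
    ultimately show ?thesis using Suc.prems(2) v by (simp add: coef_t')
  qed
  ultimately obtain c where c: "c \<in> {..<d} \<rightarrow>\<^sub>E J" "monom_of d c = t'"
    using Suc.IH by blast
  have "monom_of (Suc d) (c(d := v)) = monom_of d c + Poly_Mapping.single v 1"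
    by (simp add: monom_of_def)
  also have "\<dots> = t"
    using v by (intro poly_mapping_eqI) (auto simp: c(2) lookup_add coef_t' lookup_single when_def)
  finally have "monom_of (Suc d) (c(d := v)) = t" .
  moreover have "c(d := v) \<in> {..<Suc d} \<rightarrow>\<^sub>E J"
    using c(1) v by (auto simp: PiE_iff extensional_def)
  ultimately show ?case by blast
qed

text \<open>Contraction of a tensor with the variables. Rearranged words give the same monomial, so
  uniqueness holds among symmetric tensors (\<open>poly_of_eq_0D\<close>).\<close>

definition poly_of :: "nat \<Rightarrow> nat \<Rightarrow> nat \<Rightarrow> ((nat \<Rightarrow> nat \<times> nat \<times> nat) \<Rightarrow> complex) \<Rightarrow> mat_poly" where
  "poly_of d m n P = (\<Sum>c\<in>vwords d m n. Poly_Mapping.single (monom_of d c) (P c))"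

lemma coef_poly_of: "coef (poly_of d m n P) t = (\<Sum>c\<in>vwords d m n. if monom_of d c = t then P c else 0)"
  by (simp add: poly_of_def coef_sum lookup_single when_def)

lemma poly_of_cong: "(\<And>c. c \<in> vwords d m n \<Longrightarrow> P c = P' c) \<Longrightarrow> poly_of d m n P = poly_of d m n P'"
  unfolding poly_of_def by (intro sum.cong refl) simp

lemma keys_poly_of: "Poly_Mapping.keys (poly_of d m n P) \<subseteq> monom_of d ` vwords d m n"
proof
  fix t assume "t \<in> Poly_Mapping.keys (poly_of d m n P)"
  then have "coef (poly_of d m n P) t \<noteq> 0" by (simp add: in_keys_iff)
  then show "t \<in> monom_of d ` vwords d m n"
    unfolding coef_poly_of by (auto elim!: sum.not_neutral_contains_not_neutral split: if_splits)
qed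

definition mat_val :: "(nat \<Rightarrow> complex mat) \<Rightarrow> nat \<times> nat \<times> nat \<Rightarrow> complex" where
  "mat_val X = (\<lambda>(l, i, j). X l $$ (i, j))"

lemma eval_poly_of: "Defs.eval_poly (poly_of d m n P) X = (\<Sum>c\<in>vwords d m n. P c * (\<Prod>i<d. mat_val X (c i)))"
proof -
  define M where "M t = (\<Prod>v\<in>Poly_Mapping.keys t. mat_val X v ^ coef t v)" for t :: "nat \<times> nat \<times> nat \<Rightarrow>\<^sub>0 nat"
  have M: "M (monom_of d c) = (\<Prod>i<d. mat_val X (c i))" for c
    unfolding M_def by (rule prod_monom_of)
  have "Defs.eval_poly (poly_of d m n P) X = (\<Sum>t\<in>Poly_Mapping.keys (poly_of d m n P). coef (poly_of d m n P) t * M t)"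
    unfolding Defs.eval_poly_def M_def mat_val_def by (intro sum.cong refl) (simp add: case_prod_unfold)
  also have "\<dots> = (\<Sum>t\<in>monom_of d ` vwords d m n. coef (poly_of d m n P) t * M t)"
    by (rule sum.mono_neutral_left) (auto simp: in_keys_iff keys_poly_of)
  also have "\<dots> = (\<Sum>t\<in>monom_of d ` vwords d m n. \<Sum>c\<in>vwords d m n. if monom_of d c = t then P c * M t else 0)"
    unfolding coef_poly_of sum_distrib_right by (intro sum.cong refl) simp
  also have "\<dots> = (\<Sum>c\<in>vwords d m n. \<Sum>t\<in>monom_of d ` vwords d m n. if t = monom_of d c then P c * M t else 0)"
    by (subst sum.swap) (intro sum.cong refl if_cong eq_commute)
  also have "\<dots> = (\<Sum>c\<in>vwords d m n. P c * (\<Prod>i<d. mat_val X (c i)))"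
    by (intro sum.cong refl) (simp add: M)
  finally show ?thesis .
qed

lemma poly_of_mat_polys: "poly_of d m n P \<in> mat_polys n m"
proof -
  have "Poly_Mapping.keys t \<subseteq> vars m n" if t: "t \<in> Poly_Mapping.keys (poly_of d m n P)" for t
  proof -
    obtain c where c: "c \<in> vwords d m n" "t = monom_of d c"
      using subsetD[OF keys_poly_of t] by blast
    show ?thesis
      unfolding c(2) keys_monom_of by (rule image_subsetI) (rule PiE_mem[OF c(1)])
  qed
  then show ?thesis by (simp add: mat_polys_def)
qed

lemma poly_of_homogeneous: "homogeneous d (poly_of d m n P)"
  unfolding homogeneous_def
proof
  fix t assume "t \<in> Poly_Mapping.keys (poly_of d m n P)"
  from subsetD[OF keys_poly_of this] obtain c where "t = monom_of d c"
    by blast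
  then show "(\<Sum>v\<in>Poly_Mapping.keys t. coef t v) = d"
    by (simp only: degree_monom_of)
qed

text \<open>The symmetric preimage of p: the coefficient of a monomial is shared equally among its
  words.\<close>

definition tensor_of_poly :: "nat \<Rightarrow> nat \<Rightarrow> nat \<Rightarrow> mat_poly \<Rightarrow> (nat \<Rightarrow> nat \<times> nat \<times> nat) \<Rightarrow> complex" where
  "tensor_of_poly d m n p c
     = coef p (monom_of d c) / of_nat (card {c' \<in> vwords d m n. monom_of d c' = monom_of d c})"

lemma poly_of_tensor_of_poly:
  assumes p: "p \<in> mat_polys n m" and hom: "homogeneous d p"
  shows "poly_of d m n (tensor_of_poly d m n p) = p"
proof (rule poly_mapping_eqI)
  fix t
  let ?S = "{c' \<in> vwords d m n. monom_of d c' = t}"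
  have finS: "finite ?S" by simp
  have "coef (poly_of d m n (tensor_of_poly d m n p)) t = (\<Sum>c\<in>?S. coef p t / of_nat (card ?S))"
    unfolding coef_poly_of sum.inter_filter[OF finite_vwords]
    by (intro sum.cong refl) (simp add: tensor_of_poly_def)
  also have "\<dots> = coef p t"
  proof (cases "?S = {}")
    case True
    have "coef p t = 0"
    proof (rule ccontr)
      assume "coef p t \<noteq> 0"
      then have t: "t \<in> Poly_Mapping.keys p" by (simp add: in_keys_iff)
      then have sub: "Poly_Mapping.keys t \<subseteq> vars m n"
        using p by (auto simp: mat_polys_def)
      have "(\<Sum>v\<in>vars m n. coef t v) = (\<Sum>v\<in>Poly_Mapping.keys t. coef t v)"
        using sub by (intro sum.mono_neutral_right) (auto simp: in_keys_iff)
      also have "\<dots> = d"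
        using hom t by (simp add: homogeneous_def)
      finally have "\<exists>c\<in>vwords d m n. monom_of d c = t"
        using sub by (intro monom_of_surj) simp_all
      then show False using True by blast
    qed
    then show ?thesis by simp
  next
    case False
    then have "card ?S \<noteq> 0" using finS by simp
    then show ?thesis by simp
  qed
  finally show "coef (poly_of d m n (tensor_of_poly d m n p)) t = coef p t" .
qed

lemma tensor_of_poly_comp:
  "g \<in> symgroup d \<Longrightarrow> tensor_of_poly d m n p (c \<circ> g) = tensor_of_poly d m n p c"
  by (simp add: tensor_of_poly_def monom_of_comp)

text \<open>The words of one monomial form a single orbit (\<open>monom_of_eq_imp_comp\<close>), so
  the coefficient of that monomial is the orbit size times \<open>P c\<close>.\<close>

lemma poly_of_eq_0D:
  assumes sym: "\<And>g c. g \<in> symgroup d \<Longrightarrow> c \<in> vwords d m n \<Longrightarrow> P (c \<circ> g) = P c"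
    and 0: "poly_of d m n P = 0" and c: "c \<in> vwords d m n"
  shows "P c = 0"
proof -
  let ?S = "{c' \<in> vwords d m n. monom_of d c' = monom_of d c}"
  have P: "P c' = P c" if c': "c' \<in> ?S" for c'
  proof -
    have "monom_of d c = monom_of d c'" "c' \<in> vwords d m n" using c' by simp_all
    then obtain g where "g \<in> symgroup d" "c' = c \<circ> g"
      using monom_of_eq_imp_comp[OF c] by metis
    then show ?thesis using sym c by simp
  qed
  have "0 = coef (poly_of d m n P) (monom_of d c)" by (simp add: 0)
  also have "\<dots> = (\<Sum>c'\<in>?S. P c')"
    unfolding coef_poly_of by (rule sum.inter_filter[symmetric]) simp
  also have "\<dots> = (\<Sum>c'\<in>?S. P c)"
    by (rule sum.cong[OF refl P])
  also have "\<dots> = of_nat (card ?S) * P c" by simp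
  finally have "of_nat (card ?S) * P c = 0" by simp
  moreover have "card ?S \<noteq> 0" using c by auto
  ultimately show ?thesis by simp
qed

section \<open>Invariants of \<open>SL\<^sub>n \<times> SL\<^sub>n\<close>\<close>

definition pair_word :: "nat \<Rightarrow> (nat \<Rightarrow> 'a) \<Rightarrow> (nat \<Rightarrow> 'b) \<Rightarrow> nat \<Rightarrow> 'a \<times> 'b" where
  "pair_word d a b = (\<lambda>i\<in>{..<d}. (a i, b i))"

definition fst_word :: "nat \<Rightarrow> (nat \<Rightarrow> 'a \<times> 'b) \<Rightarrow> nat \<Rightarrow> 'a" where
  "fst_word d c = (\<lambda>i\<in>{..<d}. fst (c i))"

definition snd_word :: "nat \<Rightarrow> (nat \<Rightarrow> 'a \<times> 'b) \<Rightarrow> nat \<Rightarrow> 'b" where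
  "snd_word d c = (\<lambda>i\<in>{..<d}. snd (c i))"

lemma pair_word_in: "a \<in> {..<d} \<rightarrow>\<^sub>E S \<Longrightarrow> b \<in> {..<d} \<rightarrow>\<^sub>E T \<Longrightarrow> pair_word d a b \<in> {..<d} \<rightarrow>\<^sub>E S \<times> T"
  by (auto simp: pair_word_def)

lemma fst_word_in: "c \<in> {..<d} \<rightarrow>\<^sub>E S \<times> T \<Longrightarrow> fst_word d c \<in> {..<d} \<rightarrow>\<^sub>E S"
  by (auto simp: fst_word_def PiE_iff mem_Times_iff)

lemma snd_word_in: "c \<in> {..<d} \<rightarrow>\<^sub>E S \<times> T \<Longrightarrow> snd_word d c \<in> {..<d} \<rightarrow>\<^sub>E T"
  by (auto simp: snd_word_def PiE_iff mem_Times_iff)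

lemma fst_word_pair_word: "a \<in> {..<d} \<rightarrow>\<^sub>E S \<Longrightarrow> fst_word d (pair_word d a b) = a"
  by (auto simp: fst_word_def pair_word_def fun_eq_iff PiE_iff extensional_def)

lemma snd_word_pair_word: "b \<in> {..<d} \<rightarrow>\<^sub>E T \<Longrightarrow> snd_word d (pair_word d a b) = b"
  by (auto simp: snd_word_def pair_word_def fun_eq_iff PiE_iff extensional_def)

lemma pair_word_proj: "c \<in> {..<d} \<rightarrow>\<^sub>E J \<Longrightarrow> pair_word d (fst_word d c) (snd_word d c) = c"
  by (auto simp: fst_word_def snd_word_def pair_word_def fun_eq_iff PiE_iff extensional_def)

lemma pair_word_comp:
  "g \<in> symgroup d \<Longrightarrow> pair_word d a b \<circ> g = pair_word d (a \<circ> g) (b \<circ> g)"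
  using symgroup_lt[of g d] by (auto simp: pair_word_def fun_eq_iff symgroup_def permutes_def)

lemma sum_pair_words:
  "(\<Sum>c\<in>{..<d} \<rightarrow>\<^sub>E S \<times> T. f c) = (\<Sum>a\<in>{..<d} \<rightarrow>\<^sub>E S. \<Sum>b\<in>{..<d} \<rightarrow>\<^sub>E T. f (pair_word d a b))"
proof -
  have "(\<Sum>c\<in>{..<d} \<rightarrow>\<^sub>E S \<times> T. f c)
      = (\<Sum>p\<in>({..<d} \<rightarrow>\<^sub>E S) \<times> ({..<d} \<rightarrow>\<^sub>E T). f (pair_word d (fst p) (snd p)))"
  proof (rule sum.reindex_bij_witness[of _ "\<lambda>p. pair_word d (fst p) (snd p)" "\<lambda>c. (fst_word d c, snd_word d c)"])
    fix p assume "p \<in> ({..<d} \<rightarrow>\<^sub>E S) \<times> ({..<d} \<rightarrow>\<^sub>E T)"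
    then have p: "fst p \<in> {..<d} \<rightarrow>\<^sub>E S" "snd p \<in> {..<d} \<rightarrow>\<^sub>E T" by (simp_all add: mem_Times_iff)
    show "pair_word d (fst p) (snd p) \<in> {..<d} \<rightarrow>\<^sub>E S \<times> T"
      using p by (rule pair_word_in)
    show "(fst_word d (pair_word d (fst p) (snd p)), snd_word d (pair_word d (fst p) (snd p))) = p"
      by (simp add: fst_word_pair_word[OF p(1)] snd_word_pair_word[OF p(2)])
  next
    fix c assume c: "c \<in> {..<d} \<rightarrow>\<^sub>E S \<times> T"
    show "pair_word d (fst (fst_word d c, snd_word d c)) (snd (fst_word d c, snd_word d c)) = c"
      by (simp add: pair_word_proj[OF c])
    then show "f (pair_word d (fst (fst_word d c, snd_word d c)) (snd (fst_word d c, snd_word d c))) = f c"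
      by simp
    show "(fst_word d c, snd_word d c) \<in> ({..<d} \<rightarrow>\<^sub>E S) \<times> ({..<d} \<rightarrow>\<^sub>E T)"
      using fst_word_in[OF c] snd_word_in[OF c] by simp
  qed
  then show ?thesis
    by (simp only: sum.cartesian_product' fst_conv snd_conv)
qed

definition tri :: "nat \<Rightarrow> (nat \<Rightarrow> nat) \<Rightarrow> (nat \<Rightarrow> nat) \<Rightarrow> (nat \<Rightarrow> nat) \<Rightarrow> nat \<Rightarrow> nat \<times> nat \<times> nat" where
  "tri d u v w = pair_word d u (pair_word d v w)"

lemma tri_apply: "i < d \<Longrightarrow> tri d u v w i = (u i, v i, w i)"
  by (simp add: tri_def pair_word_def)

lemma tri_in: "u \<in> words d m \<Longrightarrow> v \<in> words d n \<Longrightarrow> w \<in> words d n \<Longrightarrow> tri d u v w \<in> vwords d m n"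
  unfolding tri_def by (intro pair_word_in)

lemma tri_comp: "g \<in> symgroup d \<Longrightarrow> tri d u v w \<circ> g = tri d (u \<circ> g) (v \<circ> g) (w \<circ> g)"
  by (simp add: tri_def pair_word_comp)

lemma tri_cases:
  assumes "c \<in> vwords d m n"
  obtains u v w where "u \<in> words d m" "v \<in> words d n" "w \<in> words d n" "c = tri d u v w"
proof
  let ?s = "snd_word d c"
  have s: "?s \<in> {..<d} \<rightarrow>\<^sub>E {..<n} \<times> {..<n}" using assms by (rule snd_word_in)
  show "fst_word d c \<in> words d m" using assms by (rule fst_word_in)
  show "fst_word d ?s \<in> words d n" using s by (rule fst_word_in)
  show "snd_word d ?s \<in> words d n" using s by (rule snd_word_in)
  show "c = tri d (fst_word d c) (fst_word d ?s) (snd_word d ?s)"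
    by (simp add: tri_def pair_word_proj[OF s] pair_word_proj[OF assms])
qed

definition word1 :: "nat \<Rightarrow> (nat \<Rightarrow> nat \<times> nat \<times> nat) \<Rightarrow> nat \<Rightarrow> nat" where
  "word1 d c = fst_word d c"

definition word2 :: "nat \<Rightarrow> (nat \<Rightarrow> nat \<times> nat \<times> nat) \<Rightarrow> nat \<Rightarrow> nat" where
  "word2 d c = fst_word d (snd_word d c)"

definition word3 :: "nat \<Rightarrow> (nat \<Rightarrow> nat \<times> nat \<times> nat) \<Rightarrow> nat \<Rightarrow> nat" where
  "word3 d c = snd_word d (snd_word d c)"

lemma word_tri:
  assumes "u \<in> words d m" "v \<in> words d n" "w \<in> words d n"
  shows "word1 d (tri d u v w) = u" "word2 d (tri d u v w) = v" "word3 d (tri d u v w) = w"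
  using assms by (simp_all add: word1_def word2_def word3_def tri_def fst_word_pair_word
      snd_word_pair_word snd_word_pair_word[OF pair_word_in])

lemma sum_vwords:
  "(\<Sum>c\<in>vwords d m n. f c) = (\<Sum>u\<in>words d m. \<Sum>v\<in>words d n. \<Sum>w\<in>words d n. f (tri d u v w))"
  by (simp add: sum_pair_words tri_def)

text \<open>The coefficient tensor of the polynomial after substitution of A X B for X
  (\<open>eval_poly_of_transform\<close>); the word u of matrix numbers stays fixed.\<close>

definition transform :: "nat \<Rightarrow> nat \<Rightarrow> complex mat \<Rightarrow> complex mat \<Rightarrow> ((nat \<Rightarrow> nat \<times> nat \<times> nat) \<Rightarrow> complex)
    \<Rightarrow> (nat \<Rightarrow> nat) \<Rightarrow> (nat \<Rightarrow> nat) \<Rightarrow> (nat \<Rightarrow> nat) \<Rightarrow> complex" where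
  "transform d n A B P u v' w' = (\<Sum>v\<in>words d n. \<Sum>w\<in>words d n.
     P (tri d u v w) * ((\<Prod>i<d. A $$ (v i, v' i)) * (\<Prod>i<d. B $$ (w' i, w i))))"

lemma index_mult_mult_mat:
  assumes "A \<in> carrier_mat n n" "X \<in> carrier_mat n n" "B \<in> carrier_mat n n" "a < n" "b < n"
  shows "(A * X * B) $$ (a, b) = (\<Sum>p\<in>{..<n} \<times> {..<n}. A $$ (a, fst p) * X $$ p * B $$ (snd p, b))"
proof -
  have "(A * X * B) $$ (a, b) = (\<Sum>j<n. (\<Sum>i<n. A $$ (a, i) * X $$ (i, j)) * B $$ (j, b))"
    using assms by (simp add: scalar_prod_def atLeast0LessThan del: assoc_mult_mat)
  also have "\<dots> = (\<Sum>i<n. \<Sum>j<n. A $$ (a, i) * X $$ (i, j) * B $$ (j, b))"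
    by (subst sum.swap) (simp only: sum_distrib_right)
  finally show ?thesis
    by (simp add: sum.cartesian_product case_prod_unfold)
qed

lemma eval_poly_of_transform:
  assumes A: "A \<in> carrier_mat n n" and B: "B \<in> carrier_mat n n"
    and X: "\<And>l. l < m \<Longrightarrow> X l \<in> carrier_mat n n"
  shows "Defs.eval_poly (poly_of d m n P) (\<lambda>l. A * X l * B)
    = (\<Sum>u\<in>words d m. \<Sum>v'\<in>words d n. \<Sum>w'\<in>words d n.
        transform d n A B P u v' w' * (\<Prod>i<d. X (u i) $$ (v' i, w' i)))"
proof -
  let ?W = "words d n" and ?N = "{..<n} \<times> {..<n}"
  have expand: "(\<Prod>i<d. mat_val (\<lambda>l. A * X l * B) (tri d u v w i))
      = (\<Sum>v'\<in>?W. \<Sum>w'\<in>?W. (\<Prod>i<d. A $$ (v i, v' i)) * (\<Prod>i<d. B $$ (w' i, w i)) * (\<Prod>i<d. X (u i) $$ (v' i, w' i)))"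
    if u: "u \<in> words d m" and v: "v \<in> ?W" and w: "w \<in> ?W" for u v w
  proof -
    have "(\<Prod>i<d. mat_val (\<lambda>l. A * X l * B) (tri d u v w i))
        = (\<Prod>i<d. \<Sum>p\<in>?N. A $$ (v i, fst p) * X (u i) $$ p * B $$ (snd p, w i))"
    proof (intro prod.cong refl)
      fix i assume "i \<in> {..<d}"
      then have i: "i < d" by simp
      show "mat_val (\<lambda>l. A * X l * B) (tri d u v w i) = (\<Sum>p\<in>?N. A $$ (v i, fst p) * X (u i) $$ p * B $$ (snd p, w i))"
        unfolding tri_apply[OF i] mat_val_def case_prod_conv
        by (rule index_mult_mult_mat[OF A X[OF words_less[OF u i]] B words_less[OF v i] words_less[OF w i]])
    qed
    also have "\<dots> = (\<Sum>g\<in>{..<d} \<rightarrow>\<^sub>E ?N. \<Prod>i<d. A $$ (v i, fst (g i)) * X (u i) $$ g i * B $$ (snd (g i), w i))"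
      by (rule prod_sum_PiE) simp_all
    also have "\<dots> = (\<Sum>v'\<in>?W. \<Sum>w'\<in>?W. (\<Prod>i<d. A $$ (v i, v' i)) * (\<Prod>i<d. B $$ (w' i, w i)) * (\<Prod>i<d. X (u i) $$ (v' i, w' i)))"
      unfolding sum_pair_words
      by (intro sum.cong refl) (simp add: pair_word_def prod.distrib mult.commute mult.left_commute)
    finally show ?thesis .
  qed
  have "Defs.eval_poly (poly_of d m n P) (\<lambda>l. A * X l * B)
      = (\<Sum>u\<in>words d m. \<Sum>v\<in>?W. \<Sum>w\<in>?W. P (tri d u v w) * (\<Prod>i<d. mat_val (\<lambda>l. A * X l * B) (tri d u v w i)))"
    unfolding eval_poly_of sum_vwords ..
  also have "\<dots> = (\<Sum>u\<in>words d m. \<Sum>q\<in>?W \<times> ?W. \<Sum>r\<in>?W \<times> ?W. P (tri d u (fst q) (snd q)) *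
      ((\<Prod>i<d. A $$ (fst q i, fst r i)) * (\<Prod>i<d. B $$ (snd r i, snd q i))) * (\<Prod>i<d. X (u i) $$ (fst r i, snd r i)))"
    unfolding sum.cartesian_product' fst_conv snd_conv
    by (intro sum.cong refl) (simp add: expand sum_distrib_left mult.assoc)
  also have "\<dots> = (\<Sum>u\<in>words d m. \<Sum>r\<in>?W \<times> ?W. \<Sum>q\<in>?W \<times> ?W. P (tri d u (fst q) (snd q)) *
      ((\<Prod>i<d. A $$ (fst q i, fst r i)) * (\<Prod>i<d. B $$ (snd r i, snd q i))) * (\<Prod>i<d. X (u i) $$ (fst r i, snd r i)))"
    by (intro sum.cong[OF refl] sum.swap)
  also have "\<dots> = (\<Sum>u\<in>words d m. \<Sum>v'\<in>?W. \<Sum>w'\<in>?W.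
        transform d n A B P u v' w' * (\<Prod>i<d. X (u i) $$ (v' i, w' i)))"
    unfolding transform_def sum.cartesian_product' fst_conv snd_conv sum_distrib_right ..
  finally show ?thesis .
qed

definition slsl_invariant :: "nat \<Rightarrow> nat \<Rightarrow> nat \<Rightarrow> ((nat \<Rightarrow> nat \<times> nat \<times> nat) \<Rightarrow> complex) \<Rightarrow> bool" where
  "slsl_invariant d m n P \<longleftrightarrow> (\<forall>u\<in>words d m. \<forall>x\<in>words d n.
     sl_invariant n d (\<lambda>v. P (tri d u v x)) \<and> sl_invariant n d (\<lambda>w. P (tri d u x w)))"

lemma transpose_special_linear: "A \<in> special_linear n \<Longrightarrow> transpose_mat A \<in> special_linear n"
  by (auto simp: special_linear_def det_transpose)

lemma prod_transpose:
  assumes "A \<in> carrier_mat n n" "v \<in> words d n" "w \<in> words d n"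
  shows "(\<Prod>i<d. transpose_mat A $$ (v i, w i)) = (\<Prod>i<d. A $$ (w i, v i))"
  using assms words_less[OF assms(2)] words_less[OF assms(3)] by (intro prod.cong refl) auto

text \<open>The sums over w and over v are the two invariances in turn. A occurs transposed, which
  stays inside the special linear group.\<close>

lemma transform_slsl_invariant:
  assumes P: "slsl_invariant d m n P" and A: "A \<in> special_linear n" and B: "B \<in> special_linear n"
    and u: "u \<in> words d m" and v': "v' \<in> words d n" and w': "w' \<in> words d n"
  shows "transform d n A B P u v' w' = P (tri d u v' w')"
proof -
  have Ac: "A \<in> carrier_mat n n" using A by (simp add: special_linear_def)
  have "transform d n A B P u v' w'
      = (\<Sum>v\<in>words d n. (\<Sum>w\<in>words d n. P (tri d u v w) * (\<Prod>i<d. B $$ (w' i, w i))) * (\<Prod>i<d. A $$ (v i, v' i)))"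
    unfolding transform_def sum_distrib_right by (intro sum.cong refl) (simp only: mult_ac)
  also have "\<dots> = (\<Sum>v\<in>words d n. P (tri d u v w') * (\<Prod>i<d. transpose_mat A $$ (v' i, v i)))"
    using P B u w' v' unfolding slsl_invariant_def sl_invariant_def
    by (intro sum.cong refl) (simp add: prod_transpose[OF Ac])
  also have "\<dots> = P (tri d u v' w')"
    using P transpose_special_linear[OF A] u w' v' unfolding slsl_invariant_def sl_invariant_def by blast
  finally show ?thesis .
qed

lemma poly_of_invariant:
  assumes P: "slsl_invariant d m n P"
  shows "poly_of d m n P \<in> invariant_ring n m"
  unfolding invariant_ring_def mem_Collect_eq
proof (intro conjI ballI impI allI)
  show "poly_of d m n P \<in> mat_polys n m" by (rule poly_of_mat_polys)
  fix A B B' and X :: "nat \<Rightarrow> complex mat"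
  assume A: "A \<in> special_linear n" and B: "B \<in> special_linear n" and B': "B' \<in> carrier_mat n n"
    and inv: "inverts_mat B B'" and X: "\<forall>l<m. X l \<in> carrier_mat n n"
  have Bc: "B \<in> carrier_mat n n" and detB: "det B = 1" using B by (simp_all add: special_linear_def)
  have "B * B' = 1\<^sub>m n" using inv Bc by (simp add: inverts_mat_def)
  then have "det B * det B' = 1" using det_mult[OF Bc B'] by simp
  then have B'SL: "B' \<in> special_linear n" using detB B' by (simp add: special_linear_def)
  have Ac: "A \<in> carrier_mat n n" using A by (simp add: special_linear_def)
  have "Defs.eval_poly (poly_of d m n P) (\<lambda>l. A * X l * B')
      = (\<Sum>u\<in>words d m. \<Sum>v'\<in>words d n. \<Sum>w'\<in>words d n.
        transform d n A B' P u v' w' * (\<Prod>i<d. X (u i) $$ (v' i, w' i)))"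
    using X by (intro eval_poly_of_transform[OF Ac B']) blast
  also have "\<dots> = (\<Sum>u\<in>words d m. \<Sum>v'\<in>words d n. \<Sum>w'\<in>words d n.
        P (tri d u v' w') * (\<Prod>i<d. mat_val X (tri d u v' w' i)))"
    by (intro sum.cong refl arg_cong2[where f = "(*)"] prod.cong transform_slsl_invariant[OF P A B'SL])
      (simp_all add: tri_apply mat_val_def)
  also have "\<dots> = Defs.eval_poly (poly_of d m n P) X"
    unfolding eval_poly_of sum_vwords ..
  finally show "Defs.eval_poly (poly_of d m n P) (\<lambda>l. A * X l * B') = Defs.eval_poly (poly_of d m n P) X" .
qed

lemma transform_comp:
  assumes g: "g \<in> symgroup d" and u: "u \<in> words d m"
    and sym: "\<And>g c. g \<in> symgroup d \<Longrightarrow> c \<in> vwords d m n \<Longrightarrow> P (c \<circ> g) = P c"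
  shows "transform d n A B P (u \<circ> g) (v' \<circ> g) (w' \<circ> g) = transform d n A B P u v' w'"
proof -
  let ?W = "words d n"
  let ?f = "\<lambda>v w. P (tri d (u \<circ> g) v w) * ((\<Prod>i<d. A $$ (v i, (v' \<circ> g) i)) * (\<Prod>i<d. B $$ ((w' \<circ> g) i, w i)))"
  have "transform d n A B P (u \<circ> g) (v' \<circ> g) (w' \<circ> g) = (\<Sum>v\<in>?W. \<Sum>w\<in>?W. ?f v w)"
    by (simp only: transform_def)
  also have "\<dots> = (\<Sum>v\<in>?W. \<Sum>w\<in>?W. ?f (v \<circ> g) w)"
    by (rule sum_words_comp[OF g, symmetric])
  also have "\<dots> = (\<Sum>v\<in>?W. \<Sum>w\<in>?W. ?f (v \<circ> g) (w \<circ> g))"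
    by (rule sum.cong[OF refl], rule sum_words_comp[OF g, symmetric])
  also have "\<dots> = transform d n A B P u v' w'"
    unfolding transform_def
  proof (intro sum.cong refl)
    fix v w assume "v \<in> ?W" "w \<in> ?W"
    then have "P (tri d (u \<circ> g) (v \<circ> g) (w \<circ> g)) = P (tri d u v w)"
      using sym[OF g tri_in[OF u]] by (simp add: tri_comp[OF g])
    moreover have "(\<Prod>i<d. A $$ ((v \<circ> g) i, (v' \<circ> g) i)) = (\<Prod>i<d. A $$ (v i, v' i))"
      using prod_symgroup[OF g, of "\<lambda>i. A $$ (v i, v' i)"] by simp
    moreover have "(\<Prod>i<d. B $$ ((w' \<circ> g) i, (w \<circ> g) i)) = (\<Prod>i<d. B $$ (w' i, w i))"
      using prod_symgroup[OF g, of "\<lambda>i. B $$ (w' i, w i)"] by simp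
    ultimately show "?f (v \<circ> g) (w \<circ> g)
        = P (tri d u v w) * ((\<Prod>i<d. A $$ (v i, v' i)) * (\<Prod>i<d. B $$ (w' i, w i)))"
      by simp
  qed
  finally show ?thesis .
qed

text \<open>Invariance of the polynomial says that the difference F of the two tensors contracts to
  0 with the variables. By polarization its sum over all rearrangements is 0, and F is already
  symmetric.\<close>

lemma transform_invariant:
  assumes inv: "poly_of d m n P \<in> invariant_ring n m"
    and sym: "\<And>g c. g \<in> symgroup d \<Longrightarrow> c \<in> vwords d m n \<Longrightarrow> P (c \<circ> g) = P c"
    and A: "A \<in> special_linear n" and B: "B \<in> special_linear n"
    and u: "u \<in> words d m" and v: "v \<in> words d n" and w: "w \<in> words d n"
  shows "transform d n A B P u v w = P (tri d u v w)"
proof -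
  have Ac: "A \<in> carrier_mat n n" and Bc: "B \<in> carrier_mat n n" and detB: "det B = 1"
    using A B by (simp_all add: special_linear_def)
  \<comment> \<open>The second matrix acts through its inverse, so the group element to use is the
    inverse of B; as \<open>det B\<close> is 1, this is the adjugate.\<close>
  define C where "C = adj_mat B"
  have C: "C \<in> carrier_mat n n" "C * B = 1\<^sub>m n"
    using adj_mat[OF Bc] detB by (auto simp: C_def intro!: eq_matI)
  then have "det C = 1"
    using det_mult[OF C(1) Bc] detB by simp
  then have CSL: "C \<in> special_linear n" and CB: "inverts_mat C B"
    using C by (simp_all add: special_linear_def inverts_mat_def)
  define F where "F c = transform d n A B P (word1 d c) (word2 d c) (word3 d c) - P c" for c
  let ?c = "tri d u v w"
  have c: "?c \<in> vwords d m n" by (rule tri_in[OF u v w])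
  have "(\<Sum>g\<in>symgroup d. F (?c \<circ> g)) = 0"
  proof (rule polarization[OF _ _ c])
    show "finite (vars m n)" by simp
    fix y :: "nat \<times> nat \<times> nat \<Rightarrow> complex"
    define X where "X l = mat n n (\<lambda>(i, j). y (l, i, j))" for l
    have X: "X l \<in> carrier_mat n n" for l by (simp add: X_def)
    have Xy: "X (u i) $$ (v' i, w' i) = y (tri d u v' w' i)"
      if "i < d" "v' \<in> words d n" "w' \<in> words d n" for u v' w' i
      using that words_less[of v' d n i] words_less[of w' d n i] by (simp add: X_def tri_apply)
    have "Defs.eval_poly (poly_of d m n P) (\<lambda>l. A * X l * B) = Defs.eval_poly (poly_of d m n P) X"
      using inv A CSL Bc CB X unfolding invariant_ring_def by blast
    moreover have "Defs.eval_poly (poly_of d m n P) (\<lambda>l. A * X l * B)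
        = (\<Sum>u\<in>words d m. \<Sum>v'\<in>words d n. \<Sum>w'\<in>words d n.
            transform d n A B P u v' w' * (\<Prod>i<d. y (tri d u v' w' i)))"
      unfolding eval_poly_of_transform[OF Ac Bc X]
      by (intro sum.cong refl arg_cong2[where f = "(*)"] prod.cong Xy) simp_all
    moreover have "Defs.eval_poly (poly_of d m n P) X
        = (\<Sum>u\<in>words d m. \<Sum>v'\<in>words d n. \<Sum>w'\<in>words d n. P (tri d u v' w') * (\<Prod>i<d. y (tri d u v' w' i)))"
      unfolding eval_poly_of sum_vwords
      by (intro sum.cong refl arg_cong2[where f = "(*)"] prod.cong)
        (simp add: X_def mat_val_def tri_apply words_less)
    ultimately show "(\<Sum>c\<in>vwords d m n. F c * (\<Prod>i<d. y (c i))) = 0"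
      unfolding sum_vwords by (simp add: F_def word_tri left_diff_distrib sum_subtractf)
  qed
  moreover have "F (?c \<circ> g) = F ?c" if g: "g \<in> symgroup d" for g
  proof -
    have "F (?c \<circ> g) = transform d n A B P (u \<circ> g) (v \<circ> g) (w \<circ> g) - P (?c \<circ> g)"
      unfolding F_def tri_comp[OF g]
      by (simp only: word_tri[OF words_comp[OF u g] words_comp[OF v g] words_comp[OF w g]])
    also have "\<dots> = F ?c"
      by (simp add: F_def word_tri[OF u v w] transform_comp[OF g u sym] sym[OF g c])
    finally show ?thesis .
  qed
  ultimately have "of_nat (card (symgroup d)) * F ?c = 0" by simp
  moreover have "card (symgroup d) \<noteq> 0"
    using symgroup_id by (auto simp: card_eq_0_iff)
  ultimately have "F ?c = 0" by simp
  then show ?thesis by (simp add: F_def word_tri[OF u v w])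
qed

lemma prod_one_mat:
  assumes v: "v \<in> words d n" and w: "w \<in> words d n"
  shows "(\<Prod>i<d. (1\<^sub>m n :: complex mat) $$ (v i, w i)) = (if v = w then 1 else 0)"
proof (cases "v = w")
  case True
  then show ?thesis using words_less[OF w] by simp
next
  case False
  then obtain i where i: "i < d" "v i \<noteq> w i"
    using PiE_ext[OF v w] by blast
  then have "(1\<^sub>m n :: complex mat) $$ (v i, w i) = 0"
    using words_less[OF v] words_less[OF w] by simp
  then show ?thesis
    using False i by (auto intro!: prod_zero)
qed

text \<open>Each of the two invariances is obtained by taking the unit matrix on the other
  side.\<close>

lemma invariant_slsl_invariant:
  assumes inv: "poly_of d m n P \<in> invariant_ring n m"
    and sym: "\<And>g c. g \<in> symgroup d \<Longrightarrow> c \<in> vwords d m n \<Longrightarrow> P (c \<circ> g) = P c"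
  shows "slsl_invariant d m n P"
  unfolding slsl_invariant_def
proof (intro ballI conjI)
  fix u x assume u: "u \<in> words d m" and x: "x \<in> words d n"
  have one: "1\<^sub>m n \<in> special_linear n" by (simp add: special_linear_def)
  note tr = transform_invariant[OF inv sym]
  show "sl_invariant n d (\<lambda>v. P (tri d u v x))"
    unfolding sl_invariant_def
  proof (intro ballI)
    fix A v' assume A: "A \<in> special_linear n" and v': "v' \<in> words d n"
    have Ac: "A \<in> carrier_mat n n" using A by (simp add: special_linear_def)
    have "P (tri d u v' x) = transform d n (transpose_mat A) (1\<^sub>m n) P u v' x"
      by (rule tr[symmetric, OF _ _ transpose_special_linear[OF A] one u v' x])
    also have "\<dots> = (\<Sum>v\<in>words d n. \<Sum>w\<in>words d n. if w = x then P (tri d u v x) * (\<Prod>i<d. A $$ (v' i, v i)) else 0)"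
      unfolding transform_def
      by (intro sum.cong refl) (auto simp: prod_transpose[OF Ac _ v'] prod_one_mat[OF x])
    finally show "(\<Sum>w'\<in>words d n. P (tri d u w' x) * (\<Prod>i<d. A $$ (v' i, w' i))) = P (tri d u v' x)"
      using x by simp
  qed
  show "sl_invariant n d (\<lambda>w. P (tri d u x w))"
    unfolding sl_invariant_def
  proof (intro ballI)
    fix B w' assume B: "B \<in> special_linear n" and w': "w' \<in> words d n"
    have "P (tri d u x w') = transform d n (1\<^sub>m n) B P u x w'"
      by (rule tr[symmetric, OF _ _ one B u x w'])
    also have "\<dots> = (\<Sum>v\<in>words d n. if v = x then \<Sum>w\<in>words d n. P (tri d u x w) * (\<Prod>i<d. B $$ (w' i, w i)) else 0)"
      unfolding transform_def
      by (intro sum.cong refl) (auto simp: prod_one_mat[OF _ x] intro!: sum.neutral)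
    finally show "(\<Sum>w\<in>words d n. P (tri d u x w) * (\<Prod>i<d. B $$ (w' i, w i))) = P (tri d u x w')"
      using x by simp
  qed
qed

context
  fixes n m k :: nat
  assumes n: "n \<ge> 1"
begin

private abbreviation (input) "dd \<equiv> k * n"
private abbreviation (input) "TT \<equiv> irrep (rect_partition k n)"
private abbreviation (input) "MM \<equiv> tensor_space (irrep (rect_partition k n)) (irrep (rect_partition k n))"

interpretation diag: sym_rep "k * n" diagonal_action
  by (rule sym_rep_diagonal_action)

private abbreviation (input) "EE \<equiv> diag.equivariant_maps m (tensor_space (irrep (rect_partition k n)) (irrep (rect_partition k n)))"

text \<open>Products of determinants in the row indices and in the column indices turn the values in
  \<open>T \<otimes> T\<close> into \<open>SL\<^sub>n \<times> SL\<^sub>n\<close>-invariant tensors, where \<open>T\<close> belongs to the partition \<open>k\<^sup>n\<close>.\<close>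

definition tensor_of_map :: "((nat \<Rightarrow> nat) \<times> (nat \<Rightarrow> nat) \<times> (nat \<Rightarrow> nat) \<Rightarrow>\<^sub>0 complex) \<Rightarrow> (nat \<Rightarrow> nat \<times> nat \<times> nat) \<Rightarrow> complex" where
  "tensor_of_map F c = det_sum n k (\<lambda>g. det_sum n k (\<lambda>h. coef F (word1 dd c, g, h)) (word3 dd c)) (word2 dd c)"

lemma tensor_of_map_tri:
  assumes "u \<in> words dd m" "v \<in> words dd n" "w \<in> words dd n"
  shows "tensor_of_map F (tri dd u v w) = det_sum n k (\<lambda>g. det_sum n k (\<lambda>h. coef F (u, g, h)) w) v"
  unfolding tensor_of_map_def word_tri[OF assms] ..

lemma det_sum_swap:
  "det_sum n k (\<lambda>g. det_sum n k (\<lambda>h. y g h) w) v = det_sum n k (\<lambda>h. det_sum n k (\<lambda>g. y g h) v) w"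
  unfolding det_sum_def sum_distrib_right
  by (subst sum.swap) (intro sum.cong refl, simp only: mult_ac)

lemma subspace_EE: "free_vs.subspace EE"
proof (rule free_vs.subspaceI)
  note sl = free_pair.linear_0[OF lin_slice] free_pair.linear_add[OF lin_slice] free_pair.linear_scale[OF lin_slice]
  note rl = free_pair.linear_0[OF diag.lin_rep] free_pair.linear_add[OF diag.lin_rep] free_pair.linear_scale[OF diag.lin_rep]
  have sub: "free_vs.subspace MM"
    using tensor_space_subrep[OF rect_partition_partitions] by (simp add: subrep_def)
  note fo = subspace_free_on[of "words dd m \<times> (UNIV :: ((nat \<Rightarrow> nat) \<times> (nat \<Rightarrow> nat)) set)"]
  show "0 \<in> EE"
    using free_vs.subspace_0[OF sub] free_vs.subspace_0[OF fo] by (simp add: diag.equivariant_maps_def sl rl)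
  show "x + y \<in> EE" if "x \<in> EE" "y \<in> EE" for x y
    using that free_vs.subspace_add[OF sub] free_vs.subspace_add[OF fo] by (simp add: diag.equivariant_maps_def sl rl)
  show "smul c x \<in> EE" if "x \<in> EE" for c x
    using that free_vs.subspace_scale[OF sub] free_vs.subspace_scale[OF fo] by (simp add: diag.equivariant_maps_def sl rl)
qed

lemma det_sum_scale: "det_sum n k (\<lambda>g. c * y g) w = c * det_sum n k y w"
  by (simp add: det_sum_def sum_distrib_left mult.assoc)

lemma det_sum_add: "det_sum n k (\<lambda>g. y g + z g) w = det_sum n k y w + det_sum n k z w"
  by (simp add: det_sum_def sum.distrib distrib_right)

lemma lin_poly_of_tensor_of_map: "lin (\<lambda>F. poly_of dd m n (tensor_of_map F))"
proof (rule linI; rule poly_mapping_eqI)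
  fix x y :: "(nat \<Rightarrow> nat) \<times> (nat \<Rightarrow> nat) \<times> (nat \<Rightarrow> nat) \<Rightarrow>\<^sub>0 complex" and c t
  have add: "tensor_of_map (x + y) = (\<lambda>c. tensor_of_map x c + tensor_of_map y c)"
    by (simp add: tensor_of_map_def lookup_add det_sum_add fun_eq_iff)
  show "coef (poly_of dd m n (tensor_of_map (x + y))) t
      = coef (poly_of dd m n (tensor_of_map x) + poly_of dd m n (tensor_of_map y)) t"
    unfolding lookup_add coef_poly_of add sum.distrib[symmetric] by (rule sum.cong) simp_all
  have scale: "tensor_of_map (smul c x) = (\<lambda>a. c * tensor_of_map x a)"
    by (simp add: tensor_of_map_def det_sum_scale fun_eq_iff)
  show "coef (poly_of dd m n (tensor_of_map (smul c x))) t = coef (smul c (poly_of dd m n (tensor_of_map x))) t"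
    by (simp add: coef_poly_of scale sum_distrib_left if_distrib[of "(*) c"] cong: if_cong)
qed

lemma EE_slice:
  assumes F: "F \<in> EE" and u: "u \<in> words dd m"
  shows "\<exists>t\<in>TT. \<forall>h. coef F (u, g, h) = coef t h" "\<exists>t\<in>TT. \<forall>h. coef F (u, h, g) = coef t h"
proof -
  have "slice F u \<in> MM" using F u by (simp add: diag.equivariant_maps_def)
  from this[unfolded tensor_space_iff[OF rect_partition_partitions] coef_slice]
  show "\<exists>t\<in>TT. \<forall>h. coef F (u, g, h) = coef t h" "\<exists>t\<in>TT. \<forall>h. coef F (u, h, g) = coef t h"
    by blast+
qed

lemma EE_equivariant:
  assumes F: "F \<in> EE" and u: "u \<in> words dd m" and p: "p \<in> symgroup dd"
  shows "coef F (u \<circ> p, g, h) = coef F (u, p \<circ> g, p \<circ> h)"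
proof -
  have "slice F (u \<circ> inv (inv p)) = diagonal_action (inv p) (slice F u)"
    using F u symgroup_inv[OF p] unfolding diag.equivariant_maps_def by blast
  then have "slice F (u \<circ> p) = diagonal_action (inv p) (slice F u)"
    using p by simp
  from arg_cong[OF this, of "\<lambda>x. coef x (g, h)"] show ?thesis
    using p by (simp add: coef_diagonal_action[OF symgroup_inv[OF p]])
qed

text \<open>The permutation acts on u through the equivariance of F, and on v and w through
  \<open>det_sum_equivariant\<close>; the two effects cancel.\<close>

lemma tensor_of_map_comp:
  assumes F: "F \<in> EE" and p: "p \<in> symgroup dd" and c: "c \<in> vwords dd m n"
  shows "tensor_of_map F (c \<circ> p) = tensor_of_map F c"
proof -
  obtain u v w where uvw: "u \<in> words dd m" "v \<in> words dd n" "w \<in> words dd n" "c = tri dd u v w"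
    using c by (rule tri_cases)
  note q = symgroup_inv[OF p]
  have "tensor_of_map F (c \<circ> p)
      = det_sum n k (\<lambda>g. det_sum n k (\<lambda>h. coef F (u, inv (inv p) \<circ> g, inv (inv p) \<circ> h)) (w \<circ> p)) (v \<circ> p)"
    unfolding uvw(4) tri_comp[OF p] tensor_of_map_tri[OF words_comp[OF uvw(1) p] words_comp[OF uvw(2) p] words_comp[OF uvw(3) p]]
    by (simp only: EE_equivariant[OF F uvw(1) p] symgroup_inv_inv[OF p])
  also have "\<dots> = det_sum n k (\<lambda>g. det_sum n k (\<lambda>h. coef F (u, inv (inv p) \<circ> g, h)) (w \<circ> p \<circ> inv p)) (v \<circ> p)"
    by (simp only: det_sum_equivariant[OF q, where y = "\<lambda>h. coef F (u, _ \<circ> _, h)"])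
  also have "\<dots> = det_sum n k (\<lambda>g. det_sum n k (\<lambda>h. coef F (u, g, h)) (w \<circ> p \<circ> inv p)) (v \<circ> p \<circ> inv p)"
    by (rule det_sum_equivariant[OF q, where y = "\<lambda>g. det_sum n k (\<lambda>h. coef F (u, g, h)) (w \<circ> p \<circ> inv p)"])
  also have "\<dots> = tensor_of_map F c"
    using p by (simp add: uvw(4) tensor_of_map_tri[OF uvw(1-3)])
  finally show ?thesis .
qed

lemma tensor_of_map_slsl_invariant: "slsl_invariant dd m n (tensor_of_map F)"
  unfolding slsl_invariant_def
proof (intro ballI conjI)
  fix u x assume u: "u \<in> words dd m" and x: "x \<in> words dd n"
  have cong: "sl_invariant n dd f" if "sl_invariant n dd f'" "\<And>w. w \<in> words dd n \<Longrightarrow> f w = f' w" for f f'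
    using that unfolding sl_invariant_def by (simp cong: sum.cong)
  show "sl_invariant n dd (\<lambda>v. tensor_of_map F (tri dd u v x))"
    by (rule cong[OF det_sum_invariant]) (rule tensor_of_map_tri[OF u _ x])
  show "sl_invariant n dd (\<lambda>w. tensor_of_map F (tri dd u x w))"
    by (rule cong[OF det_sum_invariant]) (simp only: tensor_of_map_tri[OF u x] det_sum_swap[of _ _ x])
qed

text \<open>On the Specht module \<open>col_proj\<close> recovers y from its determinant sum up to a
  nonzero factor.\<close>

lemma det_sum_eq_0D:
  assumes "\<exists>t\<in>TT. \<forall>g. y g = coef t g" and "\<And>w. w \<in> words dd n \<Longrightarrow> det_sum n k y w = 0"
  shows "y g = 0"
proof -
  obtain t where t: "t \<in> TT" "y = coef t" using assms(1) by (auto simp: fun_eq_iff)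
  obtain s where s: "s \<noteq> 0" "\<forall>y\<in>TT. \<forall>g. col_proj n k (det_sum n k (coef y)) g = s * coef y g"
    using col_proj_det_sum[OF n] by blast
  have "s * coef t g = col_proj n k (det_sum n k (coef t)) g" using s(2) t(1) by simp
  also have "\<dots> = col_proj n k (\<lambda>_. 0) g"
    using assms(2) unfolding t(2) by (rule col_proj_cong)
  also have "\<dots> = 0" by (simp add: col_proj_def)
  finally show ?thesis using s(1) t(2) by simp
qed

lemma irrep_linear_combination:
  assumes "\<And>i. i \<in> I \<Longrightarrow> \<exists>t\<in>TT. \<forall>g. y i g = coef t g"
  shows "\<exists>t\<in>TT. \<forall>g. (\<Sum>i\<in>I. y i g * c i) = coef t g"
proof -
  obtain t where t: "\<And>i. i \<in> I \<Longrightarrow> t i \<in> TT \<and> (\<forall>g. y i g = coef (t i) g)"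
    using assms by metis
  note sub = subspace_irrep[OF rect_partition_partitions]
  have "(\<Sum>i\<in>I. smul (c i) (t i)) \<in> TT"
    using t by (intro free_vs.subspace_sum[OF sub] free_vs.subspace_scale[OF sub]) blast
  moreover have "\<forall>g. (\<Sum>i\<in>I. y i g * c i) = coef (\<Sum>i\<in>I. smul (c i) (t i)) g"
    unfolding coef_sum using t by (intro allI sum.cong refl) simp
  ultimately show ?thesis by (rule bexI[rotated])
qed

text \<open>The tensor is symmetric and so vanishes with its polynomial; the two determinant sums
  are then stripped off one after the other. For the outer one, the inner sum has to lie in the
  Specht module as a function of g, which holds because it is a combination of slices of F.\<close>

lemma poly_of_tensor_of_map_eq_0D:
  assumes F: "F \<in> EE" and 0: "poly_of dd m n (tensor_of_map F) = 0"
  shows "F = 0"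
proof (rule poly_mapping_eqI)
  fix x :: "(nat \<Rightarrow> nat) \<times> (nat \<Rightarrow> nat) \<times> (nat \<Rightarrow> nat)"
  obtain u g h where x: "x = (u, g, h)" by (metis prod_cases3)
  have "coef F (u, g, h) = 0"
  proof (cases "u \<in> words dd m")
    case True
    have z: "det_sum n k (\<lambda>g. det_sum n k (\<lambda>h. coef F (u, g, h)) w) v = 0"
      if "v \<in> words dd n" "w \<in> words dd n" for v w
      using poly_of_eq_0D[OF tensor_of_map_comp[OF F] 0 tri_in[OF True that]] tensor_of_map_tri[OF True that] by simp
    have "det_sum n k (\<lambda>h. coef F (u, g, h)) w = 0" if w: "w \<in> words dd n" for w
    proof (rule det_sum_eq_0D[where y = "\<lambda>g. det_sum n k (\<lambda>h. coef F (u, g, h)) w"])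
      show "\<exists>t\<in>TT. \<forall>g. det_sum n k (\<lambda>h. coef F (u, g, h)) w = coef t g"
        unfolding det_sum_def by (rule irrep_linear_combination) (rule EE_slice(2)[OF F True])
    qed (rule z[OF _ w])
    then show ?thesis
      by (rule det_sum_eq_0D[OF EE_slice(1)[OF F True]])
  next
    case False
    then show ?thesis
      using F by (simp add: diag.equivariant_maps_def in_free_on_iff)
  qed
  then show "coef F x = coef 0 x" by (simp add: x)
qed

lemma col_proj_swap:
  "col_proj n k (\<lambda>v. col_proj n k (\<lambda>w. X v w) h) g = col_proj n k (\<lambda>w. col_proj n k (\<lambda>v. X v w) g) h"
proof (cases "g \<in> symgroup dd \<and> h \<in> symgroup dd")
  case True
  then show ?thesis
    unfolding col_proj_def by (simp add: sum_distrib_left) (subst sum.swap, simp only: mult.left_commute)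
next
  case False
  then show ?thesis by (auto simp: col_proj_def)
qed

lemma det_sum_col_proj_swap:
  "det_sum n k (\<lambda>h. col_proj n k (\<lambda>v. Z v h) g) w = col_proj n k (\<lambda>v. det_sum n k (\<lambda>h. Z v h) w) g"
proof (cases "g \<in> symgroup dd")
  case True
  then show ?thesis
    unfolding det_sum_def col_proj_def
    by (simp add: sum_distrib_left sum_distrib_right mult.assoc) (rule sum.swap)
qed (simp add: det_sum_def col_proj_def)

lemma col_proj_scale: "col_proj n k (\<lambda>w. c * x w) g = c * col_proj n k x g"
  by (simp add: col_proj_def sum_distrib_left mult.left_commute)

lemma tensor_of_map_surj:
  assumes inv: "slsl_invariant dd m n P"
    and sym: "\<And>g c. g \<in> symgroup dd \<Longrightarrow> P (c \<circ> g) = P c"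
  shows "\<exists>F\<in>EE. \<forall>c\<in>vwords dd m n. tensor_of_map F c = P c"
proof -
  note \<alpha> = rect_partition_partitions[of k n]
  let ?G = "symgroup dd"
  define K where "K = (of_nat (card (col_group (rect_partition k n))) * of_int (first_fund_const n k) :: complex)"
  have K: "K \<noteq> 0"
    using card_col_group_pos[OF \<alpha>] first_fund_const_pos[of n k] by (simp add: K_def)
  \<comment> \<open>\<open>col_proj\<close> in both variables; each factor \<open>inverse K\<close>
    undoes the scalar of \<open>det_sum_col_proj\<close> for one of the words v and w.\<close>
  define Y where "Y u g h = inverse K * inverse K * col_proj n k (\<lambda>v. col_proj n k (\<lambda>w. P (tri dd u v w)) h) g" for u g h
  define F where "F = glue (words dd m) (\<lambda>u. of_fun (?G \<times> ?G) (\<lambda>(g, h). Y u g h))"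
  have Y0: "Y u g h = 0" if "g \<notin> ?G \<or> h \<notin> ?G" for u g h
    using that by (auto simp: Y_def col_proj_def)
  have coef_F: "coef F (u, g, h) = Y u g h" if "u \<in> words dd m" for u g h
    using that Y0[of g h u] by (auto simp: F_def coef_glue)
  have "F \<in> EE"
    unfolding diag.equivariant_maps_def mem_Collect_eq
  proof (intro conjI ballI)
    show "F \<in> free_on (words dd m \<times> UNIV)"
      by (auto simp: in_free_on_iff F_def coef_glue)
    fix u assume u: "u \<in> words dd m"
    show "slice F u \<in> MM"
      unfolding tensor_space_iff[OF \<alpha>] coef_slice coef_F[OF u]
    proof (intro conjI allI)
      note sub = subspace_irrep[OF \<alpha>]
      fix g
      obtain t where t: "t \<in> TT" "col_proj n k (\<lambda>w. col_proj n k (\<lambda>v. P (tri dd u v w)) g) = coef t"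
        using col_proj_irrep by blast
      show "\<exists>t\<in>TT. \<forall>h. Y u g h = coef t h"
        unfolding Y_def col_proj_swap[of _ _ g] t(2)
        using t(1) by (intro bexI[of _ "smul (inverse K * inverse K) t"] free_vs.subspace_scale[OF sub]) simp_all
      obtain t' where t': "t' \<in> TT" "col_proj n k (\<lambda>v. col_proj n k (\<lambda>w. P (tri dd u v w)) g) = coef t'"
        using col_proj_irrep by blast
      show "\<exists>t\<in>TT. \<forall>h. Y u h g = coef t h"
        unfolding Y_def t'(2)
        using t'(1) by (intro bexI[of _ "smul (inverse K * inverse K) t'"] free_vs.subspace_scale[OF sub]) simp_all
    qed
    fix p assume p: "p \<in> ?G"
    \<comment> \<open>Symmetry of P moves the permutation from u over to v and w, where
      \<open>col_proj_equivariant\<close> applies.\<close>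
    have P: "P (tri dd (u \<circ> inv p) v w) = P (tri dd u (v \<circ> p) (w \<circ> p))" for v w
    proof -
      have "tri dd (u \<circ> inv p) v w \<circ> p = tri dd u (v \<circ> p) (w \<circ> p)"
        using p by (simp add: tri_comp[OF p])
      then show ?thesis using sym[OF p] by metis
    qed
    have "Y (u \<circ> inv p) g h = Y u (inv p \<circ> g) (inv p \<circ> h)" for g h
      unfolding Y_def P
      by (simp only: col_proj_equivariant[OF p, of "\<lambda>w. P (tri dd u (_ \<circ> p) w)"]
          col_proj_equivariant[OF p, of "\<lambda>v. col_proj n k (\<lambda>w. P (tri dd u v w)) (inv p \<circ> h)"])
    then show "slice F (u \<circ> inv p) = diagonal_action p (slice F u)"
      using coef_F[OF u] coef_F[OF words_comp[OF u symgroup_inv[OF p]]]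
      by (intro poly_mapping_eqI) (auto simp: coef_diagonal_action[OF p])
  qed
  moreover have "tensor_of_map F c = P c" if c: "c \<in> vwords dd m n" for c
  proof -
    obtain u v w where uvw: "u \<in> words dd m" "v \<in> words dd n" "w \<in> words dd n" "c = tri dd u v w"
      using c by (rule tri_cases)
    have inv1: "sl_invariant n dd (\<lambda>v. P (tri dd u v x))" "sl_invariant n dd (\<lambda>w. P (tri dd u x w))" if "x \<in> words dd n" for x
      using inv that uvw(1) unfolding slsl_invariant_def by blast+
    have inner: "det_sum n k (\<lambda>h. Y u g h) w = inverse K * col_proj n k (\<lambda>v. P (tri dd u v w)) g" for g
    proof -
      have "det_sum n k (\<lambda>h. Y u g h) w
          = inverse K * inverse K * col_proj n k (\<lambda>v. det_sum n k (\<lambda>h. col_proj n k (\<lambda>w. P (tri dd u v w)) h) w) g"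
        unfolding Y_def det_sum_scale det_sum_col_proj_swap ..
      also have "col_proj n k (\<lambda>v. det_sum n k (\<lambda>h. col_proj n k (\<lambda>w. P (tri dd u v w)) h) w) g
          = col_proj n k (\<lambda>v. K * P (tri dd u v w)) g"
        unfolding K_def
        by (rule col_proj_cong) (rule det_sum_col_proj[OF n inv1(2) uvw(3)])
      finally show ?thesis
        using K by (simp add: col_proj_scale)
    qed
    have "tensor_of_map F c = det_sum n k (\<lambda>g. det_sum n k (\<lambda>h. Y u g h) w) v"
      unfolding uvw(4) tensor_of_map_tri[OF uvw(1-3)] coef_F[OF uvw(1)] ..
    also have "\<dots> = inverse K * det_sum n k (col_proj n k (\<lambda>v. P (tri dd u v w))) v"
      unfolding inner det_sum_scale ..
    also have "\<dots> = inverse K * (K * P (tri dd u v w))"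
      unfolding det_sum_col_proj[OF n inv1(1)[OF uvw(3)] uvw(2)] K_def ..
    also have "\<dots> = P c"
      using K by (simp add: uvw(4))
    finally show ?thesis .
  qed
  ultimately show ?thesis by blast
qed

text \<open>The symmetric tensor of an invariant polynomial is invariant in its row and column
  words, so \<open>tensor_of_map_surj\<close> provides an equivariant map for it.\<close>

lemma invariant_component_eq:
  "invariant_component n m dd = (\<lambda>F. poly_of dd m n (tensor_of_map F)) ` EE"
proof
  show "(\<lambda>F. poly_of dd m n (tensor_of_map F)) ` EE \<subseteq> invariant_component n m dd"
    by (auto simp: invariant_component_def intro: poly_of_invariant tensor_of_map_slsl_invariant poly_of_homogeneous)
  show "invariant_component n m dd \<subseteq> (\<lambda>F. poly_of dd m n (tensor_of_map F)) ` EE"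
  proof
    fix p assume "p \<in> invariant_component n m dd"
    then have p: "p \<in> invariant_ring n m" "homogeneous dd p" "p \<in> mat_polys n m"
      by (simp_all add: invariant_component_def invariant_ring_def)
    let ?P = "tensor_of_poly dd m n p"
    have eq: "poly_of dd m n ?P = p"
      by (rule poly_of_tensor_of_poly[OF p(3,2)])
    have "slsl_invariant dd m n ?P"
      by (rule invariant_slsl_invariant) (simp_all only: eq p(1) tensor_of_poly_comp)
    from tensor_of_map_surj[OF this tensor_of_poly_comp]
    obtain F where F: "F \<in> EE" "\<And>c. c \<in> vwords dd m n \<Longrightarrow> tensor_of_map F c = ?P c"
      by blast
    have "p = poly_of dd m n (tensor_of_map F)"
      by (simp only: poly_of_cong[of dd m n "tensor_of_map F" ?P, OF F(2)] eq)
    then show "p \<in> (\<lambda>F. poly_of dd m n (tensor_of_map F)) ` EE"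
      using F(1) by (rule image_eqI)
  qed
qed

lemma dim_invariant_component:
  "free_vs.dim (invariant_component n m dd) = (\<Sum>\<alpha>\<in>partitions dd.
     kronecker_coeff (rect_partition k n) (rect_partition k n) \<alpha> * free_vs.dim (schur_functor \<alpha> m))"
proof -
  note \<rho> = rect_partition_partitions[of k n]
  note M = tensor_space_subrep[OF \<rho>] tensor_space_free_on[OF \<rho>] finite_cartesian_product[OF finite_symgroup finite_symgroup]
  have "inj_on (\<lambda>F. poly_of dd m n (tensor_of_map F)) EE"
    using free_pair.linear_inj_on_iff_eq_0[OF lin_poly_of_tensor_of_map subspace_EE] poly_of_tensor_of_map_eq_0D by blast
  then have "free_vs.dim (invariant_component n m dd) = free_vs.dim EE"
    unfolding invariant_component_eq by (rule dim_injective_image[OF lin_poly_of_tensor_of_map subspace_EE])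
  also have "\<dots> = (\<Sum>\<alpha>\<in>partitions dd. free_vs.dim (diag.young_act \<alpha> ` MM) * free_vs.dim (schur_functor \<alpha> m))"
    by (rule diag.dim_equivariant_maps[OF M])
  also have "\<dots> = (\<Sum>\<alpha>\<in>partitions dd.
     kronecker_coeff (rect_partition k n) (rect_partition k n) \<alpha> * free_vs.dim (schur_functor \<alpha> m))"
  proof (rule sum.cong[OF refl])
    fix \<alpha> assume \<alpha>: "\<alpha> \<in> partitions dd"
    show "free_vs.dim (diag.young_act \<alpha> ` MM) * free_vs.dim (schur_functor \<alpha> m)
        = kronecker_coeff (rect_partition k n) (rect_partition k n) \<alpha> * free_vs.dim (schur_functor \<alpha> m)"
      unfolding kronecker_coeff_def partition_size_partitions[OF \<alpha>] diag.rep_multiplicity_eq_dim[OF \<alpha> M] ..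
  qed
  finally show ?thesis .
qed

end

theorem lemma1p14:
  fixes n m k :: nat
  assumes "n \<ge> 1" and "m \<ge> 1"
  shows "free_vs.dim (invariant_component n m (k * n)) =
    (\<Sum>\<alpha>\<in>partitions (k * n).
       kronecker_coeff (rect_partition k n) (rect_partition k n) \<alpha> *
       free_vs.dim (schur_functor \<alpha> m))"
  using dim_invariant_component[OF assms(1)] .

end
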